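(* The processor $\mathit{Proc}_{\mathtt{statcrit}}$ that maps a DP problem $(\mathcal P_1\uplus\mathcal P_2,\mathcal R,\mathtt{computable}_{\mathcal U},f)$ to $\{(\mathcal P_2,\mathcal R,\mathtt{computable}_{\mathcal U},f)\}$ if there exists a projection function $\nu$ for $\mathcal P_1\uplus\mathcal P_2$ such that $\overline\nu(\ell)\sqsupset\overline\nu(p)$ for all $\ell\Rrightarrow p\ (A)\in\mathcal P_1$ and $\overline\nu(\ell)=\overline\nu(p)$ for all $\ell\Rrightarrow p\ (A)\in\mathcal P_2$ (and maps every other DP problem $N$ to $\{N\}$) is sound and complete. Here $\sqsupset$ is the relation on base-type (meta-)terms with $s\sqsupset t$ iff $s\ne t$ and either (a) $s\unrhd_{\mathrm{acc}}t$, or (b) there is a meta-variable $Z$ with $s\unrhd_{\mathrm{acc}}Z\langle x_1,\dots,x_k\rangle$ for some variables $x_1,\dots,x_k$ and $t=Z\langle t_1,\dots,t_e\rangle\,s_1\cdots s_n$ for some meta-terms $t_j,s_j$.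
   Context: Basic notions (higher-order rewriting with meta-variables). Types are built from sorts by $\to$. There are disjoint sets of function symbols, variables $\mathcal V$ and meta-variables (each typed; meta-variables $Z$ have an arity; infinitely many variables and meta-variables of each type). Meta-terms are built from variables, function symbols, application $s\,t$, abstraction $\lambda x.s$ and meta-variable applications $Z\langle s_1,..,s_k\rangle$ ($k=\mathit{arity}(Z)$), all well-typed; terms are meta-terms without meta-variables; modulo $\alpha$; $FV,FMV$ = free variables, meta-variables; closed = no free variables. A pattern is $Z\langle x_1..x_k\rangle$ (distinct variables), $\lambda x.\ell$, or $a\,\ell_1\cdots\ell_n$ with $a$ a function symbol or variable. Substitutions map variables/meta-variables to (meta-)terms; $Z\langle s_1..s_k\rangle\gamma=u[x_1:=s_1\gamma..x_n:=s_n\gamma](s_{n+1}\gamma)\cdots(s_k\gamma)$ if $\gamma(Z)=\lambda x_1..x_n.u$ ($n=k$, or $n<k$ and $u$ not an abstraction), otherwise substitution is homomorphic and capture-avoiding. A rule is $\ell\Rightarrow r$ with $\ell,r$ closed meta-terms of the same type, $\ell$ a pattern $\mathsf f\,\ell_1\cdots\ell_n$, $FMV(r)\subseteq FMV(\ell)$. $\to_{\mathcal R}$ is the closure under all contexts of $\ell\delta\to r\delta$ ($\ell\Rightarrow r\in\mathcal R$, $\mathrm{dom}(\delta)=FMV(\ell)$) and $\beta$: $(\lambda x.s)t\to s[x:=t]$. The signature used for terms contains marked symbols $\mathsf f^\sharp$, and for each type countably many symbols not used in the rules. Accessibility: fix a quasi-ordering $\succeq$ on sorts with well-founded strict part $\succ$;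 for $\sigma=\sigma_1\to..\to\sigma_m\to\kappa$ and sort $\iota$: $\iota\succeq_+\sigma$ iff $\iota\succeq\kappa$ and $\iota\succ_-\sigma_i$ for all $i$; $\iota\succ_-\sigma$ iff $\iota\succ\kappa$ and $\iota\succeq_+\sigma_i$ for all $i$. For a function symbol $\mathsf f:\sigma_1\to..\to\sigma_m\to\iota$, $\mathit{Acc}(\mathsf f)=\{i\mid\iota\succeq_+\sigma_i\}$; for $x\in\mathcal V$ of that type, $\mathit{Acc}(x)=\{i\mid\sigma_i=\tau_1\to..\to\tau_n\to\kappa,\ \iota\succeq\kappa\}$. $s\unrhd_{\mathrm{acc}}t$ iff $s=t$, or $s=\lambda x.s'$ with $s'\unrhd_{\mathrm{acc}}t$, or $s=a\,s_1\cdots s_n$ with $a$ a function symbol or variable and $s_i\unrhd_{\mathrm{acc}}t$ for some $i\in\mathit{Acc}(a)$ with $a\notin FV(s_i)$. Dependency pairs: a DP is a triple $\ell\Rrightarrow p\ (A)$ with $\ell$ a closed pattern $\mathsf f\,\ell_1\cdots\ell_k$, $p$ a closed meta-term $\mathsf g\,p_1\cdots p_n$, $A$ a set of conditions $Z:i$; conservative if $FMV(p)\subseteq FMV(\ell)$. $\gamma$ respects $A$ if for all $Z:i\in A$, $\gamma(Z)=\lambda x_1..x_j.t$ with $i>j$ or ($i\le j$ and $x_i\in FV(t)$). $s\trianglerighteq^\beta_A t$: $s=t$; or $s=\lambda x.u$, $u\trianglerighteq^\beta_A t$; or $s=(\lambda x.u)s_0\cdots s_n$ and some $s_i\trianglerighteq^\beta_At$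 or $u[x:=s_0]s_1\cdots s_n\trianglerighteq^\beta_At$; or $s=a\,s_1\cdots s_n$ ($a$ function symbol or variable) and some $s_i\trianglerighteq^\beta_At$; or $s=Z\langle t_1..t_e\rangle s_1\cdots s_n$ and some $s_i\trianglerighteq^\beta_At$, or some $t_i\trianglerighteq^\beta_At$ with $(Z:i)\in A$. Chains: a $(\mathcal P,\mathcal R)$-chain is a finite or infinite sequence $[(\ell_0\Rrightarrow p_0(A_0),s_0,t_0),\dots]$ of DPs in $\mathcal P$ and terms such that for all $i$ some substitution $\gamma_i$ on domain $FMV(\ell_i)\cup FMV(p_i)$ respecting $A_i$ has $s_i=\ell_i\gamma_i,t_i=p_i\gamma_i$, and $t_i=\mathsf f\,u_1\cdots u_n$, $s_{i+1}=\mathsf f\,w_1\cdots w_n$ with $u_j\to^*_{\mathcal R}w_j$. Minimal: strict subterms of all $t_i$ are $\to_{\mathcal R}$-terminating. For rules $\mathcal U$, an RC-set is a set $I$ of base-type terms, all $\to_{\mathcal U}$-terminating, closed under $\to_{\mathcal U}$, containing each $x\,s_1..s_n$ ($x\in\mathcal V$) or $(\lambda x.u)s_0..s_n$ whose reducts all lie in $I$; $I$-computable: base-type terms in $I$, and $s:\sigma\to\tau$ with $s\,t$ $I$-computable for all $I$-computable $t$. $\mathsf f\,s_1..s_m\rightsquigarrow_I s_i\,t_1..t_n$ if both sides have base type, $i\in\mathit{Acc}(\mathsf f)$, all $t_j$ $I$-computable. $C_{\mathcal U}$ is an RC-set with $C_{\mathcal U}=\{s$ base type, terminating under $\to_{\mathcal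 U}\cup\rightsquigarrow_{C_{\mathcal U}}$, with $s\to^*_{\mathcal U}\mathsf f\,s_1..s_m$ implying $s_i$ $C_{\mathcal U}$-computable for $i\in\mathit{Acc}(\mathsf f)\}$. A chain is $\mathcal U$-computable if $\to_{\mathcal U}\supseteq\to_{\mathcal R}$ and for all $i$, $(\lambda x_1..x_n.v)\gamma_i$ is $C_{\mathcal U}$-computable whenever $p_i\trianglerighteq^\beta_Bv$, $\gamma_i$ respects $B$, $FV(v)=\{x_1..x_n\}$. Formative: a reduction $s\to^*_{\mathcal R}\ell\gamma$ is $\ell$-formative if inductively: $\ell$ is not fully extended linear (a meta-variable occurs twice, or $\ell$ has a sub-meta-term $\lambda x.C[Z\langle\vec s\rangle]$ with $x\notin\vec s$); or $\ell=Z\langle\vec x\rangle$ and $s=\ell\gamma$; or $s=a\,s_1..s_n$, $\ell=a\,\ell_1..\ell_n$ ($a$ a (marked) function symbol or variable) with $s_i\to^*\ell_i\gamma$ $\ell_i$-formative; or $s=\lambda x.s'$, $\ell=\lambda x.\ell'$, $s'\to^*\ell'\gamma$ $\ell'$-formative; or $s=(\lambda x.u)v\,w_1..w_n$ and $u[x:=v]w_1..w_n\to^*\ell\gamma$ $\ell$-formative; or $\ell$ is not a meta-variable application and there are a rule $\ell'\Rightarrow r'$, meta-variables $Z_1..Z_n$, $\delta$ with $s\to^*(\ell'Z_1..Z_n)\delta$ $(\ell'Z_1..Z_n)$-formative and $(r'Z_1..Z_n)\delta\to^*\ell\gamma$ $\ell$-formative. A chain is formative if each $t_i\to^*_{\mathcal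 R}s_{i+1}$ is $\ell_{i+1}$-formative. DP problems: $(\mathcal P,\mathcal R,m,f)$ with $m\in\{\mathtt{minimal},\mathtt{arbitrary}\}\cup\{\mathtt{computable}_{\mathcal U}\}$, $f\in\{\mathtt{formative},\mathtt{all}\}$. Finite: no infinite $(\mathcal P,\mathcal R)$-chain that is $\mathcal U$-computable if $m=\mathtt{computable}_{\mathcal U}$, minimal if $m=\mathtt{minimal}$, formative if $f=\mathtt{formative}$. Infinite: $\to_{\mathcal R}$ non-terminating or an infinite $(\mathcal P,\mathcal R)$-chain with only conservative DPs exists. A processor maps a DP problem to NO or a set of DP problems; sound if $M$ is finite whenever $\mathit{Proc}(M)\ne$ NO and all its elements are finite; complete if $M$ is infinite whenever $\mathit{Proc}(M)=$ NO or contains an infinite element. Projection functions: $\mathtt{heads}(\mathcal P)$ is the set of symbols occurring as head of a left- or right-hand side of a DP in $\mathcal P$; a projection function is $\nu:\mathtt{heads}(\mathcal P)\to\mathbb N$ such that $\overline\nu(\mathsf f\,s_1\cdots s_n)=s_{\nu(\mathsf f)}$ is well-defined on both sides of every DP in $\mathcal P$. *)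

theory Defs
  imports Main
begin

datatype 's ty = Sort 's | Arr "'s ty" "'s ty" (infixr "\<rightarrow>" 65)

fun arg_tys :: "'s ty \<Rightarrow> 's ty list" where
  "arg_tys (Sort \<iota>) = []"
| "arg_tys (\<sigma> \<rightarrow> \<tau>) = \<sigma> # arg_tys \<tau>"

fun out_sort :: "'s ty \<Rightarrow> 's" where
  "out_sort (Sort \<iota>) = \<iota>"
| "out_sort (\<sigma> \<rightarrow> \<tau>) = out_sort \<tau>"

text \<open>Variables and meta-variables carry their type (and arity) in their name, so that there are
  infinitely many of each kind.\<close>

datatype 's var = Var (var_ty: "'s ty") nat

datatype 's mvar = MVar (mvar_ty: "'s ty") (arity: nat) nat

text \<open>\<open>'f\<close> is the set of function symbols. The signature used for terms also has the marked
  copies and, for each type, countably many \<open>Fresh\<close> symbols, which no rule may use.\<close>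

datatype ('f, 's) sym = Plain 'f | Marked 'f | Fresh "'s ty" nat

text \<open>Meta-terms modulo \<open>\<alpha>\<close> in locally nameless form: bound variables are de Bruijn indices,
  free variables are named. The operation \<open>lam x s\<close> below is the named abstraction. Raw
  expressions with dangling indices are excluded by the typing judgement.\<close>

datatype ('f, 's) tm =
    Free "'s var"
  | Bnd nat
  | Fn "('f, 's) sym"
  | App "('f, 's) tm" "('f, 's) tm"
  | is_Lam: Lam "'s ty" "('f, 's) tm"
  | is_Meta: Meta "'s mvar" "('f, 's) tm list"

fun fv :: "('f, 's) tm \<Rightarrow> 's var set" where
  "fv (Free x) = {x}"
| "fv (Bnd i) = {}"
| "fv (Fn f) = {}"
| "fv (App s t) = fv s \<union> fv t"
| "fv (Lam \<sigma> s) = fv s"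
| "fv (Meta Z ts) = (\<Union>t \<in> set ts. fv t)"

fun mvs :: "('f, 's) tm \<Rightarrow> 's mvar list" where
  "mvs (Free x) = []"
| "mvs (Bnd i) = []"
| "mvs (Fn f) = []"
| "mvs (App s t) = mvs s @ mvs t"
| "mvs (Lam \<sigma> s) = mvs s"
| "mvs (Meta Z ts) = Z # concat (map mvs ts)"

definition fmv :: "('f, 's) tm \<Rightarrow> 's mvar set" where
  "fmv s = set (mvs s)"

fun syms :: "('f, 's) tm \<Rightarrow> ('f, 's) sym set" where
  "syms (Free x) = {}"
| "syms (Bnd i) = {}"
| "syms (Fn f) = {f}"
| "syms (App s t) = syms s \<union> syms t"
| "syms (Lam \<sigma> s) = syms s"
| "syms (Meta Z ts) = (\<Union>t \<in> set ts. syms t)"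

definition apps :: "('f, 's) tm \<Rightarrow> ('f, 's) tm list \<Rightarrow> ('f, 's) tm" where
  "apps s ts = foldl App s ts"

fun head :: "('f, 's) tm \<Rightarrow> ('f, 's) tm" where
  "head (App s t) = head s"
| "head s = s"

fun args :: "('f, 's) tm \<Rightarrow> ('f, 's) tm list" where
  "args (App s t) = args s @ [t]"
| "args s = []"

definition atom :: "('f, 's) tm \<Rightarrow> bool" where
  "atom a \<longleftrightarrow> (\<exists>f. a = Fn f) \<or> (\<exists>x. a = Free x)"

fun bind :: "'s var \<Rightarrow> nat \<Rightarrow> ('f, 's) tm \<Rightarrow> ('f, 's) tm" where
  "bind x k (Free y) = (if y = x then Bnd k else Free y)"
| "bind x k (Bnd i) = Bnd i"
| "bind x k (Fn f) = Fn f"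
| "bind x k (App s t) = App (bind x k s) (bind x k t)"
| "bind x k (Lam \<sigma> s) = Lam \<sigma> (bind x (Suc k) s)"
| "bind x k (Meta Z ts) = Meta Z (map (bind x k) ts)"

definition lam :: "'s var \<Rightarrow> ('f, 's) tm \<Rightarrow> ('f, 's) tm" where
  "lam x s = Lam (var_ty x) (bind x 0 s)"

definition lams :: "'s var list \<Rightarrow> ('f, 's) tm \<Rightarrow> ('f, 's) tm" where
  "lams xs s = foldr lam xs s"

fun shift :: "nat \<Rightarrow> nat \<Rightarrow> ('f, 's) tm \<Rightarrow> ('f, 's) tm" where
  "shift d c (Free x) = Free x"
| "shift d c (Bnd i) = Bnd (if i < c then i else i + d)"
| "shift d c (Fn f) = Fn f"
| "shift d c (App s t) = App (shift d c s) (shift d c t)"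
| "shift d c (Lam \<sigma> s) = Lam \<sigma> (shift d (Suc c) s)"
| "shift d c (Meta Z ts) = Meta Z (map (shift d c) ts)"

text \<open>Simultaneous replacement of the indices \<open>k, k + 1, \<dots>\<close> by the elements of a list.\<close>

fun inst :: "nat \<Rightarrow> ('f, 's) tm list \<Rightarrow> ('f, 's) tm \<Rightarrow> ('f, 's) tm" where
  "inst k ss (Free x) = Free x"
| "inst k ss (Bnd i) =
    (if i < k then Bnd i
     else if i - k < length ss then shift k 0 (ss ! (i - k))
     else Bnd (i - length ss))"
| "inst k ss (Fn f) = Fn f"
| "inst k ss (App s t) = App (inst k ss s) (inst k ss t)"
| "inst k ss (Lam \<sigma> s) = Lam \<sigma> (inst (Suc k) ss s)"
| "inst k ss (Meta Z ts) = Meta Z (map (inst k ss) ts)"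

fun nlams :: "('f, 's) tm \<Rightarrow> nat" where
  "nlams (Lam \<sigma> s) = Suc (nlams s)"
| "nlams s = 0"

fun unlam :: "nat \<Rightarrow> ('f, 's) tm \<Rightarrow> ('f, 's) tm" where
  "unlam (Suc n) (Lam \<sigma> s) = unlam n s"
| "unlam n s = s"

text \<open>\<open>mapply (\<lambda>x\<^sub>1\<dots>x\<^sub>n. u) [s\<^sub>1, \<dots>, s\<^sub>k]\<close> is \<open>u[x\<^sub>1 := s\<^sub>1, \<dots>, x\<^sub>n := s\<^sub>n] s\<^sub>n\<^sub>+\<^sub>1 \<dots> s\<^sub>k\<close>, where
  \<open>n = k\<close>, or \<open>n < k\<close> and \<open>u\<close> is not an abstraction. The list is reversed because \<open>x\<^sub>n\<close> is the
  innermost binder and so has index \<open>0\<close> in \<open>u\<close>.\<close>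

definition mapply :: "('f, 's) tm \<Rightarrow> ('f, 's) tm list \<Rightarrow> ('f, 's) tm" where
  "mapply u ss =
    (let n = min (length ss) (nlams u)
     in apps (inst 0 (rev (take n ss)) (unlam n u)) (drop n ss))"

text \<open>A substitution is a partial map; what is outside its domain is left unchanged. The values
  that matter have no dangling indices, so going below a \<open>Lam\<close> captures nothing.\<close>

type_synonym ('f, 's) subst = "'s var + 's mvar \<rightharpoonup> ('f, 's) tm"

fun subst :: "('f, 's) subst \<Rightarrow> ('f, 's) tm \<Rightarrow> ('f, 's) tm" where
  "subst \<gamma> (Free x) = (case \<gamma> (Inl x) of None \<Rightarrow> Free x | Some u \<Rightarrow> u)"
| "subst \<gamma> (Bnd i) = Bnd i"
| "subst \<gamma> (Fn f) = Fn f"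
| "subst \<gamma> (App s t) = App (subst \<gamma> s) (subst \<gamma> t)"
| "subst \<gamma> (Lam \<sigma> s) = Lam \<sigma> (subst \<gamma> s)"
| "subst \<gamma> (Meta Z ts) =
    (case \<gamma> (Inr Z) of
       None \<Rightarrow> Meta Z (map (subst \<gamma>) ts)
     | Some u \<Rightarrow> mapply u (map (subst \<gamma>) ts))"

definition terminating :: "('a \<Rightarrow> 'a \<Rightarrow> bool) \<Rightarrow> 'a \<Rightarrow> bool" where
  "terminating r s \<longleftrightarrow> \<not> (\<exists>q. q 0 = s \<and> (\<forall>i. r (q i) (q (Suc i))))"

type_synonym ('f, 's) rule = "('f, 's) tm \<times> ('f, 's) tm"

text \<open>Argument positions, in meta-variable conditions and everywhere else, are counted from \<open>0\<close>.\<close>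

type_synonym 's conds = "('s mvar \<times> nat) set"

type_synonym ('f, 's) dp = "('f, 's) tm \<times> ('f, 's) tm \<times> 's conds"

datatype ('f, 's) mflag = Minimal | Arbitrary | Computable "('f, 's) rule set"

datatype fflag = Formative | All

type_synonym ('f, 's) problem =
  "('f, 's) dp set \<times> ('f, 's) rule set \<times> ('f, 's) mflag \<times> fflag"

text \<open>\<open>None\<close> is the answer NO.\<close>

type_synonym ('f, 's) processor = "('f, 's) problem \<Rightarrow> ('f, 's) problem set option"

locale afsm =
  fixes fty :: "'f \<Rightarrow> 's ty"
    and geq :: "'s \<Rightarrow> 's \<Rightarrow> bool"  (infix "\<succeq>" 50)
begin

fun sym_ty :: "('f, 's) sym \<Rightarrow> 's ty" where
  "sym_ty (Plain f) = fty f"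
| "sym_ty (Marked f) = fty f"
| "sym_ty (Fresh \<sigma> n) = \<sigma>"

text \<open>The list holds the types of the dangling indices.\<close>

inductive has_ty :: "'s ty list \<Rightarrow> ('f, 's) tm \<Rightarrow> 's ty \<Rightarrow> bool" where
  "has_ty \<Gamma> (Free x) (var_ty x)"
| "i < length \<Gamma> \<Longrightarrow> has_ty \<Gamma> (Bnd i) (\<Gamma> ! i)"
| "has_ty \<Gamma> (Fn f) (sym_ty f)"
| "has_ty \<Gamma> s (\<sigma> \<rightarrow> \<tau>) \<Longrightarrow> has_ty \<Gamma> t \<sigma> \<Longrightarrow> has_ty \<Gamma> (App s t) \<tau>"
| "has_ty (\<sigma> # \<Gamma>) s \<tau> \<Longrightarrow> has_ty \<Gamma> (Lam \<sigma> s) (\<sigma> \<rightarrow> \<tau>)"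
| "mvar_ty Z = foldr Arr \<sigma>s \<tau> \<Longrightarrow> length \<sigma>s = arity Z \<Longrightarrow> length ts = arity Z \<Longrightarrow>
   (\<forall>i < length ts. has_ty \<Gamma> (ts ! i) (\<sigma>s ! i)) \<Longrightarrow> has_ty \<Gamma> (Meta Z ts) \<tau>"

definition meta_term :: "('f, 's) tm \<Rightarrow> bool" where
  "meta_term s \<longleftrightarrow> (\<exists>\<sigma>. has_ty [] s \<sigma>)"

definition is_term :: "('f, 's) tm \<Rightarrow> bool" where
  "is_term s \<longleftrightarrow> meta_term s \<and> fmv s = {}"

definition base :: "('f, 's) tm \<Rightarrow> bool" where
  "base s \<longleftrightarrow> (\<exists>\<iota>. has_ty [] s (Sort \<iota>))"

definition base_term :: "('f, 's) tm \<Rightarrow> bool" where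
  "base_term s \<longleftrightarrow> is_term s \<and> base s"

definition term_subst :: "('f, 's) subst \<Rightarrow> bool" where
  "term_subst \<gamma> \<longleftrightarrow>
    (\<forall>x u. \<gamma> (Inl x) = Some u \<longrightarrow> is_term u \<and> has_ty [] u (var_ty x)) \<and>
    (\<forall>Z u. \<gamma> (Inr Z) = Some u \<longrightarrow> is_term u \<and> has_ty [] u (mvar_ty Z))"

text \<open>Whenever an abstraction is written as \<open>lam x s\<close>, the premise \<open>meta_term s\<close> (or
  \<open>is_term s\<close>) makes sure that \<open>s\<close> has no dangling index which \<open>lam x\<close> would capture.\<close>

inductive pattern :: "('f, 's) tm \<Rightarrow> bool" where
  "distinct xs \<Longrightarrow> pattern (Meta Z (map Free xs))"
| "meta_term l \<Longrightarrow> pattern l \<Longrightarrow> pattern (lam x l)"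
| "atom a \<Longrightarrow> (\<forall>l \<in> set ls. pattern l) \<Longrightarrow> pattern (apps a ls)"

definition is_rule :: "('f, 's) rule \<Rightarrow> bool" where
  "is_rule = (\<lambda>(l, r).
    (\<exists>\<sigma>. has_ty [] l \<sigma> \<and> has_ty [] r \<sigma>) \<and> fv l = {} \<and> fv r = {} \<and>
    pattern l \<and> (\<exists>f ls. l = apps (Fn f) ls) \<and> fmv r \<subseteq> fmv l \<and>
    (\<forall>\<sigma> n. Fresh \<sigma> n \<notin> syms l \<union> syms r))"

inductive rstep :: "('f, 's) rule set \<Rightarrow> ('f, 's) tm \<Rightarrow> ('f, 's) tm \<Rightarrow> bool"
  for R :: "('f, 's) rule set" where
  rule: "(l, r) \<in> R \<Longrightarrow> term_subst \<delta> \<Longrightarrow> dom \<delta> = Inr ` fmv l \<Longrightarrow>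
    rstep R (subst \<delta> l) (subst \<delta> r)"
| beta: "is_term s \<Longrightarrow> is_term (App (lam x s) t) \<Longrightarrow>
    rstep R (App (lam x s) t) (subst [Inl x \<mapsto> t] s)"
| appL: "rstep R s s' \<Longrightarrow> is_term (App s t) \<Longrightarrow> rstep R (App s t) (App s' t)"
| appR: "rstep R t t' \<Longrightarrow> is_term (App s t) \<Longrightarrow> rstep R (App s t) (App s t')"
| abs: "rstep R s s' \<Longrightarrow> is_term s \<Longrightarrow> rstep R (lam x s) (lam x s')"

definition gt :: "'s \<Rightarrow> 's \<Rightarrow> bool"  (infix "\<succ>" 50) where
  "\<iota> \<succ> \<kappa> \<longleftrightarrow> \<iota> \<succeq> \<kappa> \<and> \<not> \<kappa> \<succeq> \<iota>"

inductive geq_pos :: "'s \<Rightarrow> 's ty \<Rightarrow> bool" and gt_neg :: "'s \<Rightarrow> 's ty \<Rightarrow> bool" where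
  "\<iota> \<succeq> out_sort \<sigma> \<Longrightarrow> (\<forall>\<tau> \<in> set (arg_tys \<sigma>). gt_neg \<iota> \<tau>) \<Longrightarrow> geq_pos \<iota> \<sigma>"
| "\<iota> \<succ> out_sort \<sigma> \<Longrightarrow> (\<forall>\<tau> \<in> set (arg_tys \<sigma>). geq_pos \<iota> \<tau>) \<Longrightarrow> gt_neg \<iota> \<sigma>"

fun Acc :: "('f, 's) tm \<Rightarrow> nat set" where
  "Acc (Fn f) = {i. i < length (arg_tys (sym_ty f)) \<and>
    geq_pos (out_sort (sym_ty f)) (arg_tys (sym_ty f) ! i)}"
| "Acc (Free x) = {i. i < length (arg_tys (var_ty x)) \<and>
    out_sort (var_ty x) \<succeq> out_sort (arg_tys (var_ty x) ! i)}"
| "Acc _ = {}"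

inductive acc_sub :: "('f, 's) tm \<Rightarrow> ('f, 's) tm \<Rightarrow> bool"  (infix "\<unrhd>\<^sub>a\<^sub>c\<^sub>c" 50) where
  "s \<unrhd>\<^sub>a\<^sub>c\<^sub>c s"
| "meta_term s \<Longrightarrow> s \<unrhd>\<^sub>a\<^sub>c\<^sub>c t \<Longrightarrow> lam x s \<unrhd>\<^sub>a\<^sub>c\<^sub>c t"
| "atom a \<Longrightarrow> i < length ss \<Longrightarrow> i \<in> Acc a \<Longrightarrow> fv a \<inter> fv (ss ! i) = {} \<Longrightarrow> ss ! i \<unrhd>\<^sub>a\<^sub>c\<^sub>c t \<Longrightarrow>
   apps a ss \<unrhd>\<^sub>a\<^sub>c\<^sub>c t"

definition sqsupset :: "('f, 's) tm \<Rightarrow> ('f, 's) tm \<Rightarrow> bool"  (infix "\<sqsupset>" 50) where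
  "s \<sqsupset> t \<longleftrightarrow> base s \<and> base t \<and> s \<noteq> t \<and>
    (s \<unrhd>\<^sub>a\<^sub>c\<^sub>c t \<or>
     (\<exists>Z xs ts ss. s \<unrhd>\<^sub>a\<^sub>c\<^sub>c Meta Z (map Free xs) \<and> t = apps (Meta Z ts) ss))"

definition is_dp :: "('f, 's) dp \<Rightarrow> bool" where
  "is_dp = (\<lambda>(l, p, A).
    meta_term l \<and> meta_term p \<and> fv l = {} \<and> fv p = {} \<and> pattern l \<and>
    (\<exists>f ls. l = apps (Fn f) ls) \<and> (\<exists>g ps. p = apps (Fn g) ps))"

definition conservative :: "('f, 's) dp \<Rightarrow> bool" where
  "conservative = (\<lambda>(l, p, A). fmv p \<subseteq> fmv l)"

text \<open>The prefix \<open>xs\<close> is the maximal one, as \<open>t\<close> is not an abstraction. Meta-variables outside the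
  domain stand for \<open>\<lambda>x\<^sub>1\<dots>x\<^sub>k. Z\<langle>x\<^sub>1, \<dots>, x\<^sub>k\<rangle>\<close> and respect every condition.\<close>

definition respects_conds :: "('f, 's) subst \<Rightarrow> 's conds \<Rightarrow> bool" where
  "respects_conds \<gamma> A \<longleftrightarrow>
    (\<forall>(Z, i) \<in> A. \<forall>u. \<gamma> (Inr Z) = Some u \<longrightarrow>
      (\<exists>xs t. u = lams xs t \<and> distinct xs \<and> meta_term t \<and> \<not> is_Lam t \<and>
        (length xs \<le> i \<or> i < length xs \<and> xs ! i \<in> fv t)))"

inductive beta_sub :: "'s conds \<Rightarrow> ('f, 's) tm \<Rightarrow> ('f, 's) tm \<Rightarrow> bool"
  for A :: "'s conds" where
  "beta_sub A s s"
| "meta_term u \<Longrightarrow> beta_sub A u t \<Longrightarrow> beta_sub A (lam x u) t"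
| "s \<in> set (s\<^sub>0 # ss) \<Longrightarrow> beta_sub A s t \<Longrightarrow> beta_sub A (apps (lam x u) (s\<^sub>0 # ss)) t"
| "meta_term u \<Longrightarrow> beta_sub A (apps (subst [Inl x \<mapsto> s\<^sub>0] u) ss) t \<Longrightarrow>
   beta_sub A (apps (lam x u) (s\<^sub>0 # ss)) t"
| "atom a \<Longrightarrow> s \<in> set ss \<Longrightarrow> beta_sub A s t \<Longrightarrow> beta_sub A (apps a ss) t"
| "s \<in> set ss \<Longrightarrow> beta_sub A s t \<Longrightarrow> beta_sub A (apps (Meta Z ts) ss) t"
| "i < length ts \<Longrightarrow> (Z, i) \<in> A \<Longrightarrow> beta_sub A (ts ! i) t \<Longrightarrow>
   beta_sub A (apps (Meta Z ts) ss) t"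

text \<open>Finiteness and infiniteness of DP problems refer to infinite chains only. The substitutions
  \<open>\<gamma> i\<close> witnessing the chain are kept explicit because computability refers to them.\<close>

definition inf_chain ::
  "('f, 's) dp set \<Rightarrow> ('f, 's) rule set \<Rightarrow> (nat \<Rightarrow> ('f, 's) dp \<times> ('f, 's) tm \<times> ('f, 's) tm) \<Rightarrow>
   (nat \<Rightarrow> ('f, 's) subst) \<Rightarrow> bool" where
  "inf_chain P R c \<gamma> \<longleftrightarrow> (\<forall>i. \<exists>l p A s t l' s' t'.
    c i = ((l, p, A), s, t) \<and> c (Suc i) = (l', s', t') \<and> (l, p, A) \<in> P \<and>
    term_subst (\<gamma> i) \<and> dom (\<gamma> i) = Inr ` (fmv l \<union> fmv p) \<and> respects_conds (\<gamma> i) A \<and>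
    s = subst (\<gamma> i) l \<and> t = subst (\<gamma> i) p \<and>
    (\<exists>f us ws. t = apps (Fn f) us \<and> s' = apps (Fn f) ws \<and> length us = length ws \<and>
      (\<forall>j < length us. (rstep R)\<^sup>*\<^sup>* (us ! j) (ws ! j))))"

inductive subterm :: "('f, 's) tm \<Rightarrow> ('f, 's) tm \<Rightarrow> bool"  (infix "\<unrhd>" 50) where
  "s \<unrhd> s"
| "meta_term s \<Longrightarrow> s \<unrhd> t \<Longrightarrow> lam x s \<unrhd> t"
| "s \<unrhd> t \<Longrightarrow> App s u \<unrhd> t"
| "u \<unrhd> t \<Longrightarrow> App s u \<unrhd> t"
| "u \<in> set ts \<Longrightarrow> u \<unrhd> t \<Longrightarrow> Meta Z ts \<unrhd> t"

definition minimal_chain ::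
  "('f, 's) rule set \<Rightarrow> (nat \<Rightarrow> ('f, 's) dp \<times> ('f, 's) tm \<times> ('f, 's) tm) \<Rightarrow> bool" where
  "minimal_chain R c \<longleftrightarrow>
    (\<forall>i dp s t u. c i = (dp, s, t) \<longrightarrow> t \<unrhd> u \<longrightarrow> u \<noteq> t \<longrightarrow> terminating (rstep R) u)"

definition rc_set :: "('f, 's) rule set \<Rightarrow> ('f, 's) tm set \<Rightarrow> bool" where
  "rc_set U I \<longleftrightarrow>
    (\<forall>s \<in> I. base_term s \<and> terminating (rstep U) s) \<and>
    (\<forall>s \<in> I. \<forall>t. rstep U s t \<longrightarrow> t \<in> I) \<and>
    (\<forall>s. base_term s \<and>
         ((\<exists>x ss. s = apps (Free x) ss) \<or> (\<exists>x u s\<^sub>0 ss. s = apps (lam x u) (s\<^sub>0 # ss))) \<and>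
         (\<forall>t. rstep U s t \<longrightarrow> t \<in> I) \<longrightarrow> s \<in> I)"

fun comp_at :: "('f, 's) tm set \<Rightarrow> 's ty \<Rightarrow> ('f, 's) tm \<Rightarrow> bool" where
  "comp_at I (Sort \<iota>) s \<longleftrightarrow> is_term s \<and> has_ty [] s (Sort \<iota>) \<and> s \<in> I"
| "comp_at I (\<sigma> \<rightarrow> \<tau>) s \<longleftrightarrow> is_term s \<and> has_ty [] s (\<sigma> \<rightarrow> \<tau>) \<and>
    (\<forall>t. comp_at I \<sigma> t \<longrightarrow> comp_at I \<tau> (App s t))"

definition computable :: "('f, 's) tm set \<Rightarrow> ('f, 's) tm \<Rightarrow> bool" where
  "computable I s \<longleftrightarrow> (\<exists>\<sigma>. comp_at I \<sigma> s)"

definition acc_step :: "('f, 's) tm set \<Rightarrow> ('f, 's) tm \<Rightarrow> ('f, 's) tm \<Rightarrow> bool" where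
  "acc_step I s t \<longleftrightarrow> base_term s \<and> base_term t \<and>
    (\<exists>f ss i ts. s = apps (Fn f) ss \<and> i < length ss \<and> i \<in> Acc (Fn f) \<and>
      t = apps (ss ! i) ts \<and> (\<forall>u \<in> set ts. computable I u))"

definition is_C :: "('f, 's) rule set \<Rightarrow> ('f, 's) tm set \<Rightarrow> bool" where
  "is_C U I \<longleftrightarrow> rc_set U I \<and>
    I = {s. base_term s \<and> terminating (\<lambda>u v. rstep U u v \<or> acc_step I u v) s \<and>
      (\<forall>f ss i. (rstep U)\<^sup>*\<^sup>* s (apps (Fn f) ss) \<longrightarrow> i < length ss \<longrightarrow> i \<in> Acc (Fn f) \<longrightarrow>
        computable I (ss ! i))}"

text \<open>Such a set exists for every set of rules, provided that \<open>\<succeq>\<close> is a quasi-ordering with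
  well-founded strict part (by recursion on \<open>\<succ>\<close>, taking a least fixed point for each sort), but it
  is not unique; one of them is chosen.\<close>

definition C_set :: "('f, 's) rule set \<Rightarrow> ('f, 's) tm set" where
  "C_set U = (SOME I. is_C U I)"

definition computable_chain ::
  "('f, 's) rule set \<Rightarrow> ('f, 's) rule set \<Rightarrow>
   (nat \<Rightarrow> ('f, 's) dp \<times> ('f, 's) tm \<times> ('f, 's) tm) \<Rightarrow> (nat \<Rightarrow> ('f, 's) subst) \<Rightarrow> bool" where
  "computable_chain U R c \<gamma> \<longleftrightarrow> (\<forall>s t. rstep R s t \<longrightarrow> rstep U s t) \<and>
    (\<forall>i l p A s t B v xs. c i = ((l, p, A), s, t) \<longrightarrow> beta_sub B p v \<longrightarrow>
      respects_conds (\<gamma> i) B \<longrightarrow> distinct xs \<longrightarrow> set xs = fv v \<longrightarrow> computable (C_set U) (subst (\<gamma> i) (lams xs v)))"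

definition fully_extended_linear :: "('f, 's) tm \<Rightarrow> bool" where
  "fully_extended_linear l \<longleftrightarrow> distinct (mvs l) \<and>
    \<not> (\<exists>x u Z ss. l \<unrhd> lam x u \<and> meta_term u \<and> u \<unrhd> Meta Z ss \<and> Free x \<notin> set ss)"

text \<open>\<open>formative R s l \<gamma>\<close>: there is an \<open>l\<close>-formative reduction from \<open>s\<close> to \<open>l\<gamma>\<close>.\<close>

inductive formative ::
  "('f, 's) rule set \<Rightarrow> ('f, 's) tm \<Rightarrow> ('f, 's) tm \<Rightarrow> ('f, 's) subst \<Rightarrow> bool"
  for R :: "('f, 's) rule set" where
  "\<not> fully_extended_linear l \<Longrightarrow> (rstep R)\<^sup>*\<^sup>* s (subst \<gamma> l) \<Longrightarrow> formative R s l \<gamma>"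
| "l = Meta Z (map Free xs) \<Longrightarrow> s = subst \<gamma> l \<Longrightarrow> formative R s l \<gamma>"
| "atom a \<Longrightarrow> length ss = length ls \<Longrightarrow>
   (\<forall>i < length ls. formative R (ss ! i) (ls ! i) \<gamma>) \<Longrightarrow>
   formative R (apps a ss) (apps a ls) \<gamma>"
| "is_term s \<Longrightarrow> meta_term l \<Longrightarrow> Inl x \<notin> dom \<gamma> \<Longrightarrow> (\<forall>u \<in> ran \<gamma>. x \<notin> fv u) \<Longrightarrow>
   formative R s l \<gamma> \<Longrightarrow> formative R (lam x s) (lam x l) \<gamma>"
| "is_term u \<Longrightarrow> is_term v \<Longrightarrow> formative R (apps (subst [Inl x \<mapsto> v] u) ws) l \<gamma> \<Longrightarrow>
   formative R (apps (lam x u) (v # ws)) l \<gamma>"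
| "\<not> is_Meta l \<Longrightarrow> (l', r') \<in> R \<Longrightarrow> Zs' = map (\<lambda>Z. Meta Z []) Zs \<Longrightarrow>
   meta_term (apps l' Zs') \<Longrightarrow> term_subst \<delta> \<Longrightarrow> dom \<delta> = Inr ` fmv (apps l' Zs') \<Longrightarrow>
   formative R s (apps l' Zs') \<delta> \<Longrightarrow> formative R (subst \<delta> (apps r' Zs')) l \<gamma> \<Longrightarrow>
   formative R s l \<gamma>"

definition formative_chain ::
  "('f, 's) rule set \<Rightarrow> (nat \<Rightarrow> ('f, 's) dp \<times> ('f, 's) tm \<times> ('f, 's) tm) \<Rightarrow>
   (nat \<Rightarrow> ('f, 's) subst) \<Rightarrow> bool" where
  "formative_chain R c \<gamma> \<longleftrightarrow>
    (\<forall>i dp s t l p A s' t'. c i = (dp, s, t) \<longrightarrow> c (Suc i) = ((l, p, A), s', t') \<longrightarrow>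
      formative R t l (\<gamma> (Suc i)))"

definition is_problem :: "('f, 's) problem \<Rightarrow> bool" where
  "is_problem = (\<lambda>(P, R, m, f).
    (\<forall>d \<in> P. is_dp d) \<and> (\<forall>\<rho> \<in> R. is_rule \<rho>) \<and>
    (\<forall>U. m = Computable U \<longrightarrow> (\<forall>\<rho> \<in> U. is_rule \<rho>)))"

definition finite_problem :: "('f, 's) problem \<Rightarrow> bool" where
  "finite_problem = (\<lambda>(P, R, m, f).
    \<not> (\<exists>c \<gamma>. inf_chain P R c \<gamma> \<and>
      (\<forall>U. m = Computable U \<longrightarrow> computable_chain U R c \<gamma>) \<and>
      (m = Minimal \<longrightarrow> minimal_chain R c) \<and>
      (f = Formative \<longrightarrow> formative_chain R c \<gamma>)))"

definition infinite_problem :: "('f, 's) problem \<Rightarrow> bool" where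
  "infinite_problem = (\<lambda>(P, R, m, f).
    (\<exists>s. is_term s \<and> \<not> terminating (rstep R) s) \<or>
    (\<exists>c \<gamma>. inf_chain P R c \<gamma> \<and> (\<forall>i. conservative (fst (c i)))))"

definition sound :: "('f, 's) processor \<Rightarrow> bool" where
  "sound Proc \<longleftrightarrow> (\<forall>M. is_problem M \<longrightarrow>
    (\<exists>X. Proc M = Some X \<and> (\<forall>N \<in> X. finite_problem N)) \<longrightarrow> finite_problem M)"

definition complete :: "('f, 's) processor \<Rightarrow> bool" where
  "complete Proc \<longleftrightarrow> (\<forall>M. is_problem M \<longrightarrow>
    (Proc M = None \<or> (\<exists>X. Proc M = Some X \<and> (\<exists>N \<in> X. infinite_problem N))) \<longrightarrow>
    infinite_problem M)"

text \<open>Only the values of \<open>\<nu>\<close> on the heads of left- and right-hand sides in \<open>P\<close> matter.\<close>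

definition projection :: "('f, 's) dp set \<Rightarrow> (('f, 's) sym \<Rightarrow> nat) \<Rightarrow> bool" where
  "projection P \<nu> \<longleftrightarrow> (\<forall>(l, p, A) \<in> P. \<forall>s \<in> {l, p}. \<exists>f.
    head s = Fn f \<and> \<nu> f < length (args s))"

definition proj :: "(('f, 's) sym \<Rightarrow> nat) \<Rightarrow> ('f, 's) tm \<Rightarrow> ('f, 's) tm" where
  "proj \<nu> s = (case head s of Fn f \<Rightarrow> args s ! \<nu> f)"

definition statcrit_step :: "('f, 's) problem \<Rightarrow> ('f, 's) problem \<Rightarrow> bool" where
  "statcrit_step M N \<longleftrightarrow> (\<exists>P\<^sub>1 P\<^sub>2 R U f \<nu>.
    M = (P\<^sub>1 \<union> P\<^sub>2, R, Computable U, f) \<and> P\<^sub>1 \<inter> P\<^sub>2 = {} \<and> N = (P\<^sub>2, R, Computable U, f) \<and>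
    projection (P\<^sub>1 \<union> P\<^sub>2) \<nu> \<and>
    (\<forall>(l, p, A) \<in> P\<^sub>1. proj \<nu> l \<sqsupset> proj \<nu> p) \<and>
    (\<forall>(l, p, A) \<in> P\<^sub>2. proj \<nu> l = proj \<nu> p))"

text \<open>Different choices of \<open>\<nu>\<close> can split the same set of DPs differently, so the description
  of the processor leaves a choice; any function that makes some choice is admitted.\<close>

definition is_statcrit :: "('f, 's) processor \<Rightarrow> bool" where
  "is_statcrit Proc \<longleftrightarrow> (\<forall>M. is_problem M \<longrightarrow>
    (if \<exists>N. statcrit_step M N
     then \<exists>N. statcrit_step M N \<and> Proc M = Some {N}
     else Proc M = Some {M}))"

end

end

theory Submission
  imports Defs
begin

text \<open>
  Let \<open>C\<close> be the set of computable terms of base type. In a \<open>U\<close>-computable chain, the projected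
  right-hand sides \<open>p\<gamma>\<close> of base type lie in \<open>C\<close>, and so they are terminating with respect to the union of
  \<open>\<rightarrow>\<^sub>U\<close> and the accessibility steps \<open>f s\<^sub>1 \<dots> s\<^sub>m \<leadsto> s\<^sub>i t\<^sub>1 \<dots> t\<^sub>n\<close>. It therefore suffices that \<open>s \<sqsupset> t\<close>
  implies that \<open>s\<gamma>\<close> reduces to \<open>t\<gamma>\<close> in at least one step of this union: then DPs in \<open>P\<^sub>1\<close> occur only
  finitely often in the chain, and a tail of it is a chain over \<open>P\<^sub>2\<close>.

  For \<open>s \<unrhd>\<^sub>a\<^sub>c\<^sub>c t\<close> one shows, by induction, that for every computable valuation of the variables of \<open>t\<close>
  and all computable arguments there are a computable valuation and computable arguments for \<open>s\<close> from
  which \<open>t\<close> is reached. Below an abstraction one more argument is supplied; at a variable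
  head \<open>x s\<^sub>1 \<dots> s\<^sub>n\<close> the value of \<open>x\<close> is chosen as \<open>\<lambda>y\<^sub>1\<dots>y\<^sub>m. c (y\<^sub>i us)\<close> with a fresh symbol \<open>c\<close>.
  The set \<open>C\<close> itself is built by recursion on \<open>\<succ>\<close>, as a least fixed point on each class of equivalent sorts.
\<close>

section \<open>Strong normalisation\<close>

text \<open>The first step is guaranteed because both sides of a DP are closed and
  \<open>\<sqsupset>\<close> compares terms of base type: a strict derivation of
  \<open>\<unrhd>\<^sub>a\<^sub>c\<^sub>c\<close> can start neither at an abstraction nor at a free
  variable, hence it starts at a function symbol with an accessibility step. All later parts of the
  derivation may cost zero steps. Accessibility at a variable compares output sorts only and asks
  for no positivity of argument types. The symbol \<open>c\<close> makes up for this: its type is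
  \<kappa> \<rightarrow> \<iota> with base sorts \<kappa> and \<iota>, so its argument is accessible
  as soon as \<iota> \<succeq> \<kappa>. Giving the variable a new value leaves the chosen argument
  alone, since the variable does not occur in it. When t is headed by a meta-variable, the variables
  in its pattern must take the values of the arguments in t. Patterns have distinct variables, so
  this is a valuation; its computability comes from that of the chain, but only at positions that
  the substitution respects. \<open>C_set\<close> is chosen by \<open>SOME\<close>, so nothing is
  known of it before some such set has been constructed; this is where well-foundedness
  enters.\<close>

abbreviation SN :: "('a \<Rightarrow> 'a \<Rightarrow> bool) \<Rightarrow> 'a \<Rightarrow> bool" where
  "SN r \<equiv> Wellfounded.accp (\<lambda>y x. r x y)"

text \<open>Accessibility provides induction over reducts; dependent choice extracts an infinite
  sequence where it fails.\<close>

lemma terminating_iff_SN: "terminating r s \<longleftrightarrow> SN r s"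
proof
  assume t: "terminating r s"
  show "SN r s"
  proof (rule ccontr)
    assume "\<not> SN r s"
    then have "\<exists>q. \<forall>n. (\<not> SN r (q n) \<and> (n = 0 \<longrightarrow> q n = s)) \<and> r (q n) (q (Suc n))"
      by (intro dependent_nat_choice) (auto intro: accp.accI)
    then show False using t unfolding terminating_def by blast
  qed
next
  assume "SN r s"
  then show "terminating r s"
  proof (induction rule: accp.induct)
    case (accI x)
    show ?case unfolding terminating_def
    proof safe
      fix q assume "x = q 0" and q: "\<forall>i. r (q i) (q (Suc i))"
      then have "terminating r (q (Suc 0))" using accI by blast
      moreover have "\<exists>q'. q' 0 = q (Suc 0) \<and> (\<forall>i. r (q' i) (q' (Suc i)))"
        using q by (intro exI[of _ "\<lambda>i. q (Suc i)"]) auto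
      ultimately show False unfolding terminating_def by blast
    qed
  qed
qed

text \<open>A simulation argument. The invariant \<open>P\<close> records typing or the shape of the
  term, without which steps could not be simulated.\<close>

lemma SN_image:
  assumes "SN r (f s)" "P s" "\<And>s t. P s \<Longrightarrow> r' s t \<Longrightarrow> P t \<and> r (f s) (f t)"
  shows "SN r' s"
  using assms(1,2)
proof (induction "f s" arbitrary: s rule: accp.induct)
  case accI
  show ?case using accI assms(3) by (blast intro: accp.accI)
qed

text \<open>Tailored to chains, where most steps are weak but infinitely many are strict. The
  induction works because the part of the sequence after a strict step is reachable from a proper
  reduct of \<open>x\<close>.\<close>

lemma SN_no_descending:
  assumes "SN r x" "r\<^sup>*\<^sup>* x (a 0)" "\<And>k. r\<^sup>*\<^sup>* (a k) (a (Suc k))" "\<And>n. \<exists>k\<ge>n. r\<^sup>+\<^sup>+ (a k) (a (Suc k))"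
  shows False
  using assms
proof (induction arbitrary: a rule: accp.induct)
  case (accI x)
  obtain k where k: "r\<^sup>+\<^sup>+ (a k) (a (Suc k))" using accI(5) by blast
  have "r\<^sup>*\<^sup>* x (a k)" using accI(3)
    by (induction k) (auto intro: accI(4) rtranclp_trans)
  then have "r\<^sup>+\<^sup>+ x (a (Suc k))" using k by simp
  then obtain y where y: "r x y" "r\<^sup>*\<^sup>* y (a (Suc k))" by (metis tranclpD)
  show False
  proof (rule accI(2)[OF y(1), of "\<lambda>i. a (Suc k + i)"])
    show "r\<^sup>*\<^sup>* y (a (Suc k + 0))" using y by simp
    show "r\<^sup>*\<^sup>* (a (Suc k + i)) (a (Suc k + Suc i))" for i using accI(4) by simp
    show "\<exists>i\<ge>n. r\<^sup>+\<^sup>+ (a (Suc k + i)) (a (Suc k + Suc i))" for n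
    proof -
      obtain m where "m \<ge> Suc k + n" "r\<^sup>+\<^sup>+ (a m) (a (Suc m))" using accI(5) by blast
      then show ?thesis by (intro exI[of _ "m - Suc k"]) auto
    qed
  qed
qed

section \<open>Locally nameless operations\<close>

fun lc :: "nat \<Rightarrow> ('f, 's) tm \<Rightarrow> bool" where
  "lc k (Free x) \<longleftrightarrow> True"
| "lc k (Bnd i) \<longleftrightarrow> i < k"
| "lc k (Fn f) \<longleftrightarrow> True"
| "lc k (App s t) \<longleftrightarrow> lc k s \<and> lc k t"
| "lc k (Lam \<sigma> s) \<longleftrightarrow> lc (Suc k) s"
| "lc k (Meta Z ts) \<longleftrightarrow> (\<forall>t \<in> set ts. lc k t)"

lemma lc_mono: "lc k t \<Longrightarrow> k \<le> k' \<Longrightarrow> lc k' t"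
  by (induction t arbitrary: k k') (force+)

lemma shift_lc: "lc c t \<Longrightarrow> shift d c t = t"
  by (induction t arbitrary: c) (auto simp: map_idI)

lemma shift_zero: "shift 0 c t = t"
  by (induction t arbitrary: c) (auto simp: map_idI)

lemma shift_shift: "c' \<le> c \<Longrightarrow> c \<le> c' + d' \<Longrightarrow> shift d c (shift d' c' t) = shift (d + d') c' t"
  by (induction t arbitrary: c c') auto

lemma inst_lc: "lc k t \<Longrightarrow> inst k L t = t"
  by (induction t arbitrary: k) (auto simp: map_idI)

lemma inst_closed: "lc 0 t \<Longrightarrow> inst k L t = t"
  using inst_lc lc_mono by blast

lemma inst_shift: "c \<le> j \<Longrightarrow> inst (j + k) L (shift k c s) = shift k c (inst j L s)"
proof (induction s arbitrary: c j)
  case (Bnd i)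
  then show ?case by (auto simp: shift_shift add.commute)
next
  case (Lam \<sigma> s)
  have "inst (Suc j + k) L (shift k (Suc c) s) = shift k (Suc c) (inst (Suc j) L s)"
    using Lam by blast
  then show ?case by simp
qed auto

text \<open>The outer instantiation only meets what the inner one has put in, as \<open>b\<close> has no further
  dangling indices.\<close>

lemma inst_inst: "lc (k + length ss) b \<Longrightarrow>
    inst (j + k) L (inst k ss b) = inst k (map (inst j L) ss) b"
proof (induction b arbitrary: k)
  case (Lam \<sigma> b)
  from Lam.prems have "lc (Suc k + length ss) b" by simp
  from Lam.IH[OF this] show ?case by simp
qed (auto simp: inst_shift)

lemma apps_simps [simp]: "apps s [] = s" "apps s (t # ts) = apps (App s t) ts"
  by (simp_all add: apps_def)

lemma apps_append [simp]: "apps s (ts @ us) = apps (apps s ts) us"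
  by (simp add: apps_def)

lemma head_apps [simp]: "head (apps s ts) = head s"
  by (induction ts arbitrary: s) auto

lemma args_apps [simp]: "args (apps s ts) = args s @ ts"
  by (induction ts arbitrary: s) auto

lemma apps_head_args [simp]: "apps (head s) (args s) = s"
  by (induction s) auto

lemma head_atom [simp]: "atom a \<Longrightarrow> head a = a"
  by (auto simp: atom_def)

lemma args_atom [simp]: "atom a \<Longrightarrow> args a = []"
  by (auto simp: atom_def)

lemma atom_simps [simp]: "atom (Fn f)" "atom (Free x)"
  by (auto simp: atom_def)

lemma apps_atom_inject:
  "atom a \<Longrightarrow> atom b \<Longrightarrow> apps a ss = apps b ts \<longleftrightarrow> a = b \<and> ss = ts"
  by (metis args_apps args_atom append_Nil head_apps head_atom)

lemma inst_apps [simp]: "inst k L (apps s ts) = apps (inst k L s) (map (inst k L) ts)"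
  by (induction ts arbitrary: s) auto

lemma subst_apps [simp]: "subst \<gamma> (apps s ts) = apps (subst \<gamma> s) (map (subst \<gamma>) ts)"
  by (induction ts arbitrary: s) auto

lemma fv_apps [simp]: "fv (apps s ts) = fv s \<union> (\<Union>t \<in> set ts. fv t)"
  by (induction ts arbitrary: s) auto

lemma lc_apps [simp]: "lc k (apps s ts) \<longleftrightarrow> lc k s \<and> (\<forall>t \<in> set ts. lc k t)"
  by (induction ts arbitrary: s) auto

lemma syms_apps [simp]: "syms (apps s ts) = syms s \<union> (\<Union>t \<in> set ts. syms t)"
  by (induction ts arbitrary: s) auto

lemma fmv_simps [simp]:
  "fmv (Free x) = {}" "fmv (Bnd i) = {}" "fmv (Fn f) = {}" "fmv (App s t) = fmv s \<union> fmv t"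
  "fmv (Lam \<sigma> s) = fmv s" "fmv (Meta Z ts) = insert Z (\<Union>t \<in> set ts. fmv t)"
  by (auto simp: fmv_def)

lemma fmv_apps [simp]: "fmv (apps s ts) = fmv s \<union> (\<Union>t \<in> set ts. fmv t)"
  by (induction ts arbitrary: s) auto

lemma fmv_bind [simp]: "fmv (bind x k s) = fmv s"
  by (induction s arbitrary: k) auto

lemma fmv_shift [simp]: "fmv (shift d c s) = fmv s"
  by (induction s arbitrary: c) auto

lemma fmv_inst: "fmv (inst k L s) \<subseteq> fmv s \<union> (\<Union>t \<in> set L. fmv t)"
proof (induction s arbitrary: k)
  case (Bnd i)
  then show ?case by (auto dest: nth_mem)
next
  case (Meta Z ts)
  then show ?case by (simp, blast)
qed (simp_all, blast)

lemma fmv_unlam [simp]: "fmv (unlam n s) = fmv s"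
  by (induction n s rule: unlam.induct) auto

lemma fmv_mapply: "fmv (mapply u ss) \<subseteq> fmv u \<union> (\<Union>t \<in> set ss. fmv t)"
proof -
  define n where "n = min (length ss) (nlams u)"
  have "fmv (inst 0 (rev (take n ss)) (unlam n u)) \<subseteq> fmv u \<union> (\<Union>t \<in> set (take n ss). fmv t)"
    using fmv_inst[of 0 "rev (take n ss)" "unlam n u"] by simp
  moreover have "set (take n ss) \<subseteq> set ss" "set (drop n ss) \<subseteq> set ss"
    by (rule set_take_subset, rule set_drop_subset)
  ultimately show ?thesis
    unfolding mapply_def Let_def n_def[symmetric] fmv_apps by blast
qed

lemma lc_unlam: "lc k u \<Longrightarrow> n \<le> nlams u \<Longrightarrow> lc (k + n) (unlam n u)"
proof (induction n u arbitrary: k rule: unlam.induct)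
  case (1 n \<sigma> s)
  from 1(1)[of "Suc k"] 1(2,3) show ?case by simp
qed auto

text \<open>The number of contracted abstractions depends only on \<open>u\<close> and on the number
  of arguments, and an instantiation from outside cannot reach into a value without dangling
  indices.\<close>

lemma inst_mapply: "lc 0 u \<Longrightarrow> inst j L (mapply u ss) = mapply u (map (inst j L) ss)"
proof -
  assume u: "lc 0 u"
  define n where "n = min (length ss) (nlams u)"
  have "lc (0 + length (rev (take n ss))) (unlam n u)"
    using lc_unlam[OF u, of n] by (simp add: n_def)
  from inst_inst[OF this, of j L] show ?thesis
    unfolding mapply_def Let_def n_def[symmetric]
    by (simp add: n_def[symmetric] rev_map take_map drop_map)
qed

text \<open>Bridge between indices and names: contracting the redex formed by
  \<open>subst \<gamma> (lam x s)\<close> and \<open>u\<close> amounts to updating \<gamma> at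
  \<open>x\<close>. The values of \<gamma> must have no dangling indices, or the instantiation would
  change them.\<close>

lemma inst_subst_bind:
  assumes "\<And>v. v \<in> ran \<gamma> \<Longrightarrow> lc 0 v" "lc 0 u" "lc k s"
  shows "inst k [u] (subst \<gamma> (bind x k s)) = subst (\<gamma>(Inl x \<mapsto> u)) s"
proof -
  define \<gamma>' where "\<gamma>' = \<gamma>(Inl x \<mapsto> u)"
  have \<gamma>': "\<gamma>' (Inl x) = Some u" "\<And>y. y \<noteq> x \<Longrightarrow> \<gamma>' (Inl y) = \<gamma> (Inl y)" "\<And>Z. \<gamma>' (Inr Z) = \<gamma> (Inr Z)"
    by (auto simp: \<gamma>'_def)
  have "inst k [u] (subst \<gamma> (bind x k s)) = subst \<gamma>' s"
    using assms(3)
  proof (induction s arbitrary: k)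
    case (Free y)
    have "lc 0 v" if "\<gamma> (Inl y) = Some v" for v using assms(1) that by (simp add: ranI)
    then show ?case
      using assms(2) \<gamma>' by (cases "y = x") (auto split: option.split simp: inst_closed shift_lc)
  next
    case (Meta Z ts)
    have ts: "map (inst k [u]) (map (subst \<gamma>) (map (bind x k) ts)) = map (subst \<gamma>') ts"
      using Meta by simp
    show ?case
    proof (cases "\<gamma> (Inr Z)")
      case None
      then show ?thesis using ts \<gamma>' by simp
    next
      case (Some v)
      then have "lc 0 v" using assms(1) by (simp add: ranI)
      then have "inst k [u] (mapply v (map (subst \<gamma>) (map (bind x k) ts))) = mapply v (map (subst \<gamma>') ts)"
        by (simp only: inst_mapply ts)
      then show ?thesis using Some \<gamma>'(3) by simp
    qed
  qed auto
  then show ?thesis by (simp add: \<gamma>'_def)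
qed

lemma subst_empty [simp]: "subst Map.empty s = s"
  by (induction s) (auto simp: map_idI)

lemma subst_cong:
  "(\<And>x. x \<in> fv s \<Longrightarrow> \<gamma> (Inl x) = \<gamma>' (Inl x)) \<Longrightarrow> (\<And>Z. Z \<in> fmv s \<Longrightarrow> \<gamma> (Inr Z) = \<gamma>' (Inr Z)) \<Longrightarrow>
   subst \<gamma> s = subst \<gamma>' s"
proof (induction s)
  case (Meta Z ts)
  have "subst \<gamma> t = subst \<gamma>' t" if "t \<in> set ts" for t
    using that by (intro Meta.IH Meta.prems) auto
  then have "map (subst \<gamma>) ts = map (subst \<gamma>') ts" by simp
  moreover have "\<gamma> (Inr Z) = \<gamma>' (Inr Z)" by (rule Meta.prems) simp
  ultimately show ?case by (simp only: subst.simps)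
qed auto

lemma inst_bind: "lc 0 u \<Longrightarrow> lc k s \<Longrightarrow> inst k [u] (bind x k s) = subst [Inl x \<mapsto> u] s"
  using inst_subst_bind[of Map.empty u k s x] by simp

lemma subst_Free_self [simp]: "subst [Inl x \<mapsto> Free x] s = s"
  by (induction s) (auto simp: map_idI)

lemma bind_inst: "x \<notin> fv s \<Longrightarrow> lc (Suc k) s \<Longrightarrow> bind x k (inst k [Free x] s) = s"
  by (induction s arbitrary: k) (auto simp: map_idI)

lemma inst_Free_bind: "lc k s \<Longrightarrow> inst k [Free x] (bind x k s) = s"
  by (simp add: inst_bind)

lemma finite_fv [simp]: "finite (fv s)"
  by (induction s) auto

lemma fresh_var: "finite A \<Longrightarrow> \<exists>x. var_ty x = \<sigma> \<and> x \<notin> A"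
proof -
  assume "finite A"
  moreover have "infinite (range (Var \<sigma>))"
    using finite_imageD[of "Var \<sigma>" UNIV] by (auto simp: inj_def)
  ultimately obtain x where "x \<in> range (Var \<sigma>)" "x \<notin> A"
    by (metis finite_subset subsetI)
  then show ?thesis by (intro exI[of _ x]) auto
qed

lemma subst_shift:
  "(\<And>Z. \<theta> (Inr Z) = None) \<Longrightarrow> (\<And>v. v \<in> ran \<theta> \<Longrightarrow> lc 0 v) \<Longrightarrow>
   subst \<theta> (shift d c t) = shift d c (subst \<theta> t)"
proof (induction t arbitrary: c)
  case (Free x)
  show ?case
    using Free(2) by (auto split: option.split simp: ranI intro!: shift_lc[symmetric] intro: lc_mono[of 0])
qed auto

lemma subst_inst:
  assumes "\<And>Z. \<theta> (Inr Z) = None" "\<And>v. v \<in> ran \<theta> \<Longrightarrow> lc 0 v"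
  shows "subst \<theta> (inst k L b) = inst k (map (subst \<theta>) L) (subst \<theta> b)"
proof (induction b arbitrary: k)
  case (Free x)
  then show ?case
    using assms(2) by (auto split: option.split simp: ranI inst_closed)
next
  case (Bnd i)
  then show ?case by (simp add: subst_shift assms)
qed (auto simp: assms(1))

section \<open>Eta-expanded values of meta-variables\<close>

lemma nlams_Lams: "length \<sigma>s \<le> nlams (foldr Lam \<sigma>s b)"
  by (induction \<sigma>s) auto

lemma unlam_Lams [simp]: "unlam (length \<sigma>s) (foldr Lam \<sigma>s b) = b"
proof (induction \<sigma>s)
  case Nil
  show ?case by (cases b) auto
qed auto

lemma mapply_Lams: "length ss = length \<sigma>s \<Longrightarrow> mapply (foldr Lam \<sigma>s b) ss = inst 0 (rev ss) b"
  using nlams_Lams[of \<sigma>s b] by (simp add: mapply_def min_absorb1)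

text \<open>\<open>rev (map Bnd [0..<n])\<close> lists the eta variables in argument order: the
  first argument belongs to the outermost binder and has the highest index.\<close>

lemma map_inst_Bnds: "map (inst 0 (rev ss)) (rev (map Bnd [0..<length ss])) = ss"
  by (rule nth_equalityI) (auto simp: rev_nth shift_zero)

text \<open>After full eta-expansion exactly as many abstractions are contracted as there are
  arguments, whatever \<theta> puts at the head of the body. Hence applying \<theta> commutes with
  filling in the arguments.\<close>

lemma mapply_eta:
  assumes "\<And>Z. \<theta> (Inr Z) = None" "\<And>v. v \<in> ran \<theta> \<Longrightarrow> lc 0 v" "lc 0 w" "length ss = length \<sigma>s"
  shows "mapply (foldr Lam \<sigma>s (subst \<theta> (mapply w (rev (map Bnd [0..<length \<sigma>s]))))) (map (subst \<theta>) ss)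
    = subst \<theta> (mapply w ss)" (is "mapply (foldr Lam \<sigma>s (subst \<theta> ?b)) _ = _")
proof -
  have "inst 0 (rev (map (subst \<theta>) ss)) (subst \<theta> ?b) = subst \<theta> (inst 0 (rev ss) ?b)"
    by (simp add: subst_inst assms(1,2) rev_map)
  also have "inst 0 (rev ss) ?b = mapply w ss"
    using map_inst_Bnds[of ss] by (simp only: inst_mapply[OF assms(3)] assms(4))
  finally show ?thesis by (simp add: mapply_Lams assms(4))
qed


section \<open>Typing\<close>

lemma foldr_Arr_inject:
  "length \<sigma>s = length \<sigma>s' \<Longrightarrow> foldr Arr \<sigma>s \<tau> = foldr Arr \<sigma>s' \<tau>' \<longleftrightarrow> \<sigma>s = \<sigma>s' \<and> \<tau> = \<tau>'"
  by (induction \<sigma>s \<sigma>s' rule: list_induct2) auto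

lemma foldr_Arr_arg_tys [simp]: "foldr Arr (arg_tys \<sigma>) (Sort (out_sort \<sigma>)) = \<sigma>"
  by (induction \<sigma>) auto

lemma arg_tys_foldr [simp]: "arg_tys (foldr Arr \<sigma>s \<tau>) = \<sigma>s @ arg_tys \<tau>"
  by (induction \<sigma>s) auto

lemma out_sort_foldr [simp]: "out_sort (foldr Arr \<sigma>s \<tau>) = out_sort \<tau>"
  by (induction \<sigma>s) auto

context afsm
begin

inductive_cases has_ty_FreeE: "has_ty \<Gamma> (Free x) \<tau>"
inductive_cases has_ty_BndE: "has_ty \<Gamma> (Bnd i) \<tau>"
inductive_cases has_ty_FnE: "has_ty \<Gamma> (Fn f) \<tau>"
inductive_cases has_ty_AppE: "has_ty \<Gamma> (App s t) \<tau>"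
inductive_cases has_ty_LamE: "has_ty \<Gamma> (Lam \<sigma> s) \<tau>"
inductive_cases has_ty_MetaE: "has_ty \<Gamma> (Meta Z ts) \<tau>"

lemma has_ty_unique: "has_ty \<Gamma> s \<sigma> \<Longrightarrow> has_ty \<Gamma> s \<tau> \<Longrightarrow> \<sigma> = \<tau>"
proof (induction arbitrary: \<tau> rule: has_ty.induct)
  case (1 \<Gamma> x)
  from 1(1) show ?case by (rule has_ty_FreeE) (rule sym)
next
  case (2 i \<Gamma>)
  from 2(2) show ?case by (rule has_ty_BndE) (rule sym)
next
  case (3 \<Gamma> f)
  from 3(1) show ?case by (rule has_ty_FnE) (rule sym)
next
  case (4 \<Gamma> s \<sigma> \<tau>' t)
  from 4(5) show ?case
  proof (rule has_ty_AppE)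
    fix \<sigma>' assume "has_ty \<Gamma> s (\<sigma>' \<rightarrow> \<tau>)"
    from 4(3)[OF this] show "\<tau>' = \<tau>" by simp
  qed
next
  case (5 \<sigma> \<Gamma> s \<tau>')
  from 5(3) show ?case
  proof (rule has_ty_LamE)
    fix \<rho> assume "\<tau> = \<sigma> \<rightarrow> \<rho>" "has_ty (\<sigma> # \<Gamma>) s \<rho>"
    with 5(2)[of \<rho>] show "\<sigma> \<rightarrow> \<tau>' = \<tau>" by simp
  qed
next
  case (6 Z \<sigma>s \<tau>' ts \<Gamma>)
  from 6(5) show ?case
  proof (rule has_ty_MetaE)
    fix \<sigma>s' assume "mvar_ty Z = foldr Arr \<sigma>s' \<tau>" "length \<sigma>s' = arity Z"
    \<comment> \<open>The arity determines where the type of \<open>Z\<close> splits into argument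
      types and result.\<close>
    then show "\<tau>' = \<tau>" using 6(1,2) foldr_Arr_inject[of \<sigma>s \<sigma>s' \<tau>' \<tau>] by simp
  qed
qed

lemma has_ty_lc: "has_ty \<Gamma> s \<sigma> \<Longrightarrow> lc (length \<Gamma>) s"
  by (induction rule: has_ty.induct) (auto simp: in_set_conv_nth)

lemma has_ty_append: "has_ty \<Gamma> s \<sigma> \<Longrightarrow> has_ty (\<Gamma> @ \<Delta>) s \<sigma>"
proof (induction rule: has_ty.induct)
  case (2 i \<Gamma>)
  then show ?case using has_ty.intros(2)[of i "\<Gamma> @ \<Delta>"] by (simp add: nth_append)
qed (auto intro: has_ty.intros)

lemma has_ty_weaken: "has_ty [] s \<sigma> \<Longrightarrow> has_ty \<Delta> s \<sigma>"
  using has_ty_append[of "[]"] by simp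

lemma has_ty_shift:
  "has_ty \<Gamma> s \<sigma> \<Longrightarrow> \<Gamma> = \<Gamma>1 @ \<Gamma>2 \<Longrightarrow> has_ty (\<Gamma>1 @ \<Delta> @ \<Gamma>2) (shift (length \<Delta>) (length \<Gamma>1) s) \<sigma>"
proof (induction arbitrary: \<Gamma>1 rule: has_ty.induct)
  case (2 i \<Gamma>)
  define j where "j = (if i < length \<Gamma>1 then i else i + length \<Delta>)"
  have "j < length (\<Gamma>1 @ \<Delta> @ \<Gamma>2)" "(\<Gamma>1 @ \<Delta> @ \<Gamma>2) ! j = \<Gamma> ! i"
    using 2 by (auto simp: j_def nth_append)
  then show ?case using has_ty.intros(2)[of j "\<Gamma>1 @ \<Delta> @ \<Gamma>2"] by (simp add: j_def)
next
  case (5 \<sigma> \<Gamma> s \<tau>)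
  from 5(2)[of "\<sigma> # \<Gamma>1"] 5(3) show ?case by (auto intro: has_ty.intros)
qed (auto intro: has_ty.intros)

lemma has_ty_inst:
  "has_ty \<Gamma> b \<tau> \<Longrightarrow> \<Gamma> = \<Gamma>1 @ \<Delta> @ \<Gamma>2 \<Longrightarrow> list_all2 (has_ty \<Gamma>2) L \<Delta> \<Longrightarrow>
   has_ty (\<Gamma>1 @ \<Gamma>2) (inst (length \<Gamma>1) L b) \<tau>"
proof (induction arbitrary: \<Gamma>1 rule: has_ty.induct)
  case (2 i \<Gamma>)
  then have len: "length L = length \<Delta>" by (simp add: list_all2_lengthD)
  consider "i < length \<Gamma>1" | "i \<ge> length \<Gamma>1" "i - length \<Gamma>1 < length \<Delta>"
    | "i \<ge> length \<Gamma>1 + length \<Delta>" by linarith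
  then show ?case
  proof cases
    case 1
    then show ?thesis
      using 2 has_ty.intros(2)[of i "\<Gamma>1 @ \<Gamma>2"] by (simp add: nth_append)
  next
    case c: 2
    then have "has_ty \<Gamma>2 (L ! (i - length \<Gamma>1)) (\<Delta> ! (i - length \<Gamma>1))"
      using 2 len by (simp add: list_all2_conv_all_nth)
    from has_ty_shift[OF this, of "[]" \<Gamma>2 \<Gamma>1] show ?thesis
      using c len 2 by (simp add: nth_append)
  next
    case 3
    then obtain j where j: "i = length \<Gamma>1 + length \<Delta> + j" using le_Suc_ex by blast
    then have "length \<Gamma>1 + j < length (\<Gamma>1 @ \<Gamma>2)" "(\<Gamma>1 @ \<Gamma>2) ! (length \<Gamma>1 + j) = \<Gamma> ! i"
      using 2(1) by (simp_all add: nth_append 2(2))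
    with has_ty.intros(2)[of "length \<Gamma>1 + j" "\<Gamma>1 @ \<Gamma>2"]
    have "has_ty (\<Gamma>1 @ \<Gamma>2) (Bnd (length \<Gamma>1 + j)) (\<Gamma> ! i)" by (simp only:)
    then show ?thesis using len by (simp add: j)
  qed
next
  case (5 \<sigma> \<Gamma> s \<tau>)
  from 5(2)[of "\<sigma> # \<Gamma>1"] 5(3,4) show ?case by (auto intro: has_ty.intros)
qed (auto intro: has_ty.intros)

lemma has_ty_inst1: "has_ty [\<sigma>] b \<tau> \<Longrightarrow> has_ty [] t \<sigma> \<Longrightarrow> has_ty [] (inst 0 [t] b) \<tau>"
  using has_ty_inst[of "[\<sigma>]" b \<tau> "[]" "[\<sigma>]" "[]" "[t]"] by simp

lemma has_ty_bind: "has_ty \<Gamma> s \<sigma> \<Longrightarrow> has_ty (\<Gamma> @ [var_ty x]) (bind x (length \<Gamma>) s) \<sigma>"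
proof (induction rule: has_ty.induct)
  case (1 \<Gamma> y)
  then show ?case
    using has_ty.intros(2)[of "length \<Gamma>" "\<Gamma> @ [var_ty x]"] by (auto intro: has_ty.intros)
next
  case (2 i \<Gamma>)
  then show ?case using has_ty.intros(2)[of i "\<Gamma> @ [var_ty x]"] by (simp add: nth_append)
qed (auto intro: has_ty.intros)

lemma has_ty_lam: "has_ty [] s \<sigma> \<Longrightarrow> has_ty [] (lam x s) (var_ty x \<rightarrow> \<sigma>)"
  using has_ty_bind[of "[]" s \<sigma> x] by (auto simp: lam_def intro: has_ty.intros)

lemma has_ty_lamD:
  assumes "has_ty [] (lam x s) \<tau>" "lc 0 s"
  obtains \<sigma> where "\<tau> = var_ty x \<rightarrow> \<sigma>" "has_ty [] s \<sigma>"
proof -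
  obtain \<sigma> where \<sigma>: "\<tau> = var_ty x \<rightarrow> \<sigma>" "has_ty [var_ty x] (bind x 0 s) \<sigma>"
    using assms(1) by (auto simp: lam_def elim: has_ty_LamE)
  then have "has_ty [] (inst 0 [Free x] (bind x 0 s)) \<sigma>"
    by (intro has_ty_inst1) (auto intro: has_ty.intros)
  then show ?thesis using \<sigma> that assms(2) by (simp add: inst_Free_bind)
qed

lemma has_ty_apps:
  "has_ty \<Gamma> (apps s ts) \<tau> \<longleftrightarrow> (\<exists>\<sigma>s. has_ty \<Gamma> s (foldr Arr \<sigma>s \<tau>) \<and> list_all2 (has_ty \<Gamma>) ts \<sigma>s)"
proof (induction ts arbitrary: s)
  case (Cons t ts)
  show ?case
  proof
    assume "has_ty \<Gamma> (apps s (t # ts)) \<tau>"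
    then obtain \<sigma>s where "has_ty \<Gamma> (App s t) (foldr Arr \<sigma>s \<tau>)" "list_all2 (has_ty \<Gamma>) ts \<sigma>s"
      using Cons by auto
    then obtain \<sigma> where "has_ty \<Gamma> s (foldr Arr (\<sigma> # \<sigma>s) \<tau>)" "list_all2 (has_ty \<Gamma>) (t # ts) (\<sigma> # \<sigma>s)"
      by (auto elim: has_ty_AppE)
    then show "\<exists>\<sigma>s. has_ty \<Gamma> s (foldr Arr \<sigma>s \<tau>) \<and> list_all2 (has_ty \<Gamma>) (t # ts) \<sigma>s" by blast
  next
    assume "\<exists>\<sigma>s. has_ty \<Gamma> s (foldr Arr \<sigma>s \<tau>) \<and> list_all2 (has_ty \<Gamma>) (t # ts) \<sigma>s"
    then obtain \<sigma> \<sigma>s where "has_ty \<Gamma> s (\<sigma> \<rightarrow> foldr Arr \<sigma>s \<tau>)" "has_ty \<Gamma> t \<sigma>" "list_all2 (has_ty \<Gamma>) ts \<sigma>s"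
      by (auto simp: list_all2_Cons1)
    then show "has_ty \<Gamma> (apps s (t # ts)) \<tau>"
      using Cons[of "App s t"] has_ty.intros(4) by auto
  qed
qed auto

lemma has_ty_appsI:
  "has_ty \<Gamma> s (foldr Arr \<sigma>s \<tau>) \<Longrightarrow> list_all2 (has_ty \<Gamma>) ts \<sigma>s \<Longrightarrow> has_ty \<Gamma> (apps s ts) \<tau>"
  using has_ty_apps by blast

lemma has_ty_Lams: "has_ty (rev \<sigma>s @ \<Gamma>) b \<tau> \<Longrightarrow> has_ty \<Gamma> (foldr Lam \<sigma>s b) (foldr Arr \<sigma>s \<tau>)"
  by (induction \<sigma>s arbitrary: \<Gamma>) (auto intro: has_ty.intros)

lemma has_ty_unlam:
  "has_ty \<Gamma> u (foldr Arr \<sigma>s \<tau>) \<Longrightarrow> n \<le> nlams u \<Longrightarrow> n \<le> length \<sigma>s \<Longrightarrow>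
   has_ty (rev (take n \<sigma>s) @ \<Gamma>) (unlam n u) (foldr Arr (drop n \<sigma>s) \<tau>)"
proof (induction n u arbitrary: \<sigma>s \<Gamma> rule: unlam.induct)
  case (1 n \<sigma> s)
  then obtain \<sigma>' \<sigma>s' where s: "\<sigma>s = \<sigma>' # \<sigma>s'" by (cases \<sigma>s) auto
  then have "\<sigma>' = \<sigma>" "has_ty (\<sigma> # \<Gamma>) s (foldr Arr \<sigma>s' \<tau>)"
    using 1(2) by (auto elim: has_ty_LamE)
  then show ?case using 1(1)[of "\<sigma> # \<Gamma>" \<sigma>s'] 1(3,4) s by simp
qed auto

lemma has_ty_mapply:
  assumes "has_ty [] u (foldr Arr \<sigma>s \<tau>)" "list_all2 (has_ty \<Gamma>) ss \<sigma>s"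
  shows "has_ty \<Gamma> (mapply u ss) \<tau>"
proof -
  define n where "n = min (length ss) (nlams u)"
  have len: "length ss = length \<sigma>s" using assms(2) by (simp add: list_all2_lengthD)
  then have "has_ty (rev (take n \<sigma>s)) (unlam n u) (foldr Arr (drop n \<sigma>s) \<tau>)"
    using has_ty_unlam[OF assms(1), of n] by (simp add: n_def)
  then have "has_ty (rev (take n \<sigma>s) @ \<Gamma>) (unlam n u) (foldr Arr (drop n \<sigma>s) \<tau>)"
    by (simp add: has_ty_append)
  moreover have "list_all2 (has_ty \<Gamma>) (rev (take n ss)) (rev (take n \<sigma>s))"
    using assms(2) by (simp add: list_all2_takeI)
  ultimately have "has_ty \<Gamma> (inst 0 (rev (take n ss)) (unlam n u)) (foldr Arr (drop n \<sigma>s) \<tau>)"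
    using has_ty_inst[OF _ refl, of "[]" "rev (take n \<sigma>s)" \<Gamma>] by simp
  then show ?thesis
    unfolding mapply_def Let_def n_def[symmetric]
    using assms(2) by (intro has_ty_appsI[of _ _ "drop n \<sigma>s"]) (auto intro: list_all2_dropI)
qed

lemma has_ty_Meta_iff:
  "has_ty \<Gamma> (Meta Z ts) \<tau> \<longleftrightarrow>
   (\<exists>\<sigma>s. mvar_ty Z = foldr Arr \<sigma>s \<tau> \<and> length \<sigma>s = arity Z \<and> list_all2 (has_ty \<Gamma>) ts \<sigma>s)"
proof
  assume "has_ty \<Gamma> (Meta Z ts) \<tau>"
  then show "\<exists>\<sigma>s. mvar_ty Z = foldr Arr \<sigma>s \<tau> \<and> length \<sigma>s = arity Z \<and> list_all2 (has_ty \<Gamma>) ts \<sigma>s"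
  proof (rule has_ty_MetaE)
    fix \<sigma>s assume "mvar_ty Z = foldr Arr \<sigma>s \<tau>" "length \<sigma>s = arity Z" "length ts = arity Z"
      "\<forall>i<arity Z. has_ty \<Gamma> (ts ! i) (\<sigma>s ! i)"
    then show ?thesis by (intro exI[of _ \<sigma>s]) (simp add: list_all2_conv_all_nth)
  qed
next
  assume "\<exists>\<sigma>s. mvar_ty Z = foldr Arr \<sigma>s \<tau> \<and> length \<sigma>s = arity Z \<and> list_all2 (has_ty \<Gamma>) ts \<sigma>s"
  then show "has_ty \<Gamma> (Meta Z ts) \<tau>"
    using has_ty.intros(6) by (fastforce simp: list_all2_conv_all_nth)
qed

lemma term_subst_lc: "term_subst \<gamma> \<Longrightarrow> v \<in> ran \<gamma> \<Longrightarrow> lc 0 v"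
proof -
  assume "term_subst \<gamma>" "v \<in> ran \<gamma>"
  then obtain z where "\<gamma> z = Some v" by (auto simp: ran_def)
  then have "\<exists>\<sigma>. has_ty [] v \<sigma>" using \<open>term_subst \<gamma>\<close>
    by (cases z) (simp_all add: term_subst_def, blast+)
  then show ?thesis using has_ty_lc by fastforce
qed

lemma has_ty_subst: "has_ty \<Gamma> s \<sigma> \<Longrightarrow> term_subst \<gamma> \<Longrightarrow> has_ty \<Gamma> (subst \<gamma> s) \<sigma>"
proof (induction rule: has_ty.induct)
  case (1 \<Gamma> x)
  then show ?case
    by (auto split: option.split simp: term_subst_def intro: has_ty.intros has_ty_weaken)
next
  case (6 Z \<sigma>s \<tau> ts \<Gamma>)
  then have ts: "list_all2 (has_ty \<Gamma>) (map (subst \<gamma>) ts) \<sigma>s"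
    by (simp add: list_all2_conv_all_nth)
  show ?case
  proof (cases "\<gamma> (Inr Z)")
    case None
    moreover have "has_ty \<Gamma> (Meta Z (map (subst \<gamma>) ts)) \<tau>"
      unfolding has_ty_Meta_iff using 6(1,2) ts by blast
    ultimately show ?thesis by simp
  next
    case (Some u)
    then have "has_ty [] u (mvar_ty Z)" using 6(5) unfolding term_subst_def by blast
    then have "has_ty [] u (foldr Arr \<sigma>s \<tau>)" using 6(1) by simp
    then show ?thesis using has_ty_mapply[OF _ ts] Some by simp
  qed
qed (auto intro: has_ty.intros)

lemma fmv_subst: "term_subst \<gamma> \<Longrightarrow> fmv (subst \<gamma> s) \<subseteq> {Z \<in> fmv s. \<gamma> (Inr Z) = None}"
proof (induction s)
  case (Free x)
  then show ?case by (auto split: option.split simp: term_subst_def is_term_def)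
next
  case (Meta Z ts)
  show ?case
  proof (cases "\<gamma> (Inr Z)")
    case None
    then show ?thesis using Meta by auto
  next
    case (Some u)
    then have "fmv u = {}" using Meta.prems unfolding term_subst_def is_term_def by blast
    then have "fmv (mapply u (map (subst \<gamma>) ts)) \<subseteq> (\<Union>t\<in>set ts. fmv (subst \<gamma> t))"
      using fmv_mapply[of u "map (subst \<gamma>) ts"] by auto
    moreover have "fmv (subst \<gamma> t) \<subseteq> {Z \<in> fmv t. \<gamma> (Inr Z) = None}" if "t \<in> set ts" for t
      using Meta that by blast
    ultimately show ?thesis using Some by auto
  qed
qed auto

text \<open>The name of a meta-variable alone does not ensure that its type has as many arguments as
  its arity says; occurring in a typed meta-term does.\<close>

lemma mvar_arity:
  "has_ty \<Gamma> s \<sigma> \<Longrightarrow> Z \<in> fmv s \<Longrightarrow> \<exists>\<sigma>s \<tau>. mvar_ty Z = foldr Arr \<sigma>s \<tau> \<and> length \<sigma>s = arity Z"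
proof (induction rule: has_ty.induct)
  case (6 Z' \<sigma>s \<tau> ts \<Gamma>)
  show ?case
  proof (cases "Z = Z'")
    case False
    then obtain t where "t \<in> set ts" "Z \<in> fmv t" using 6(5) by auto
    then show ?thesis using 6(4) by (auto simp: in_set_conv_nth)
  qed (use 6(1,2) in blast)
qed auto

definition wt :: "('f, 's) tm \<Rightarrow> 's ty \<Rightarrow> bool" where
  "wt s \<sigma> \<longleftrightarrow> has_ty [] s \<sigma> \<and> fmv s = {}"

lemma is_term_iff_wt: "is_term s \<longleftrightarrow> (\<exists>\<sigma>. wt s \<sigma>)"
  by (auto simp: is_term_def meta_term_def wt_def)

lemma base_term_iff_wt: "base_term s \<longleftrightarrow> (\<exists>\<iota>. wt s (Sort \<iota>))"
  by (auto simp: base_term_def base_def is_term_def meta_term_def wt_def)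

lemma wt_is_term: "wt s \<sigma> \<Longrightarrow> is_term s"
  by (auto simp: is_term_iff_wt)

lemma wt_unique: "wt s \<sigma> \<Longrightarrow> wt s \<tau> \<Longrightarrow> \<sigma> = \<tau>"
  using has_ty_unique by (auto simp: wt_def)

lemma wt_lc: "wt s \<sigma> \<Longrightarrow> lc 0 s"
  using has_ty_lc by (fastforce simp: wt_def)

lemma wt_App: "wt s (\<sigma> \<rightarrow> \<tau>) \<Longrightarrow> wt t \<sigma> \<Longrightarrow> wt (App s t) \<tau>"
  by (auto simp: wt_def intro: has_ty.intros)

lemma wt_AppE: "wt (App s t) \<tau> \<Longrightarrow> (\<And>\<sigma>. wt s (\<sigma> \<rightarrow> \<tau>) \<Longrightarrow> wt t \<sigma> \<Longrightarrow> thesis) \<Longrightarrow> thesis"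
  by (auto simp: wt_def elim: has_ty_AppE)

lemma wt_Free: "wt (Free x) (var_ty x)"
  by (auto simp: wt_def intro: has_ty.intros)

lemma wt_Fn: "wt (Fn f) (sym_ty f)"
  by (auto simp: wt_def intro: has_ty.intros)

lemma wt_apps: "wt (apps s ts) \<tau> \<longleftrightarrow> (\<exists>\<sigma>s. wt s (foldr Arr \<sigma>s \<tau>) \<and> list_all2 wt ts \<sigma>s)"
proof -
  have "list_all2 wt ts \<sigma>s \<longleftrightarrow> list_all2 (has_ty []) ts \<sigma>s \<and> (\<Union>t \<in> set ts. fmv t) = {}" for \<sigma>s
    by (induction ts arbitrary: \<sigma>s) (auto simp: list_all2_Cons1 wt_def)
  then show ?thesis by (auto simp: wt_def has_ty_apps)
qed

lemma wt_inst: "has_ty [\<sigma>] u \<tau> \<Longrightarrow> fmv u = {} \<Longrightarrow> wt t \<sigma> \<Longrightarrow> wt (inst 0 [t] u) \<tau>"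
  using fmv_inst[of 0 "[t]" u] by (auto simp: wt_def intro: has_ty_inst1)

lemma wt_Lam_iff: "wt (Lam \<sigma> u) \<rho> \<longleftrightarrow> (\<exists>\<tau>. \<rho> = \<sigma> \<rightarrow> \<tau> \<and> has_ty [\<sigma>] u \<tau> \<and> fmv u = {})"
  by (auto simp: wt_def elim: has_ty_LamE intro: has_ty.intros)

lemma wt_lam: "wt s \<sigma> \<Longrightarrow> wt (lam x s) (var_ty x \<rightarrow> \<sigma>)"
  using has_ty_lam by (auto simp: wt_def) (simp add: lam_def)

lemma wt_subst: "has_ty [] s \<sigma> \<Longrightarrow> term_subst \<gamma> \<Longrightarrow> Inr ` fmv s \<subseteq> dom \<gamma> \<Longrightarrow> wt (subst \<gamma> s) \<sigma>"
  using fmv_subst[of \<gamma> s] by (auto simp: wt_def intro: has_ty_subst)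

end

section \<open>Reduction\<close>

locale rule_system = afsm fty geq
  for fty :: "'f \<Rightarrow> 's ty" and geq :: "'s \<Rightarrow> 's \<Rightarrow> bool"  (infix "\<succeq>" 50) +
  fixes U :: "('f, 's) rule set"
  assumes is_rule: "\<rho> \<in> U \<Longrightarrow> is_rule \<rho>"
begin

lemma ruleE:
  assumes "(l, r) \<in> U"
  obtains \<sigma> f ls where "has_ty [] l \<sigma>" "has_ty [] r \<sigma>" "fv l = {}" "fv r = {}" "fmv r \<subseteq> fmv l"
    "l = apps (Fn f) ls" "\<And>\<tau> n. f \<noteq> Fresh \<tau> n"
proof -
  obtain \<sigma> f ls where "has_ty [] l \<sigma>" "has_ty [] r \<sigma>" "fv l = {}" "fv r = {}" "fmv r \<subseteq> fmv l"
    "l = apps (Fn f) ls" "\<forall>\<tau> n. Fresh \<tau> n \<notin> syms l \<union> syms r"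
    using is_rule[OF assms] unfolding is_rule_def by blast
  moreover from this have "f \<noteq> Fresh \<tau> n" for \<tau> n by auto
  ultimately show ?thesis using that by blast
qed

text \<open>Excludes rule steps at the root of a term headed by a variable, an abstraction or a
  fresh symbol.\<close>

lemma head_redex:
  assumes "(l, r) \<in> U"
  shows "\<exists>f. head (subst \<delta> l) = Fn f \<and> (\<forall>\<tau> n. f \<noteq> Fresh \<tau> n)"
  using assms by (rule ruleE) auto

lemma rstep_wt: "rstep U s t \<Longrightarrow> \<exists>\<sigma>. wt s \<sigma> \<and> wt t \<sigma>"
proof (induction rule: rstep.induct)
  case (rule l r \<delta>)
  obtain \<sigma> where "has_ty [] l \<sigma>" "has_ty [] r \<sigma>" "fmv r \<subseteq> fmv l" using rule(1) by (rule ruleE)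
  moreover from this(3) have "Inr ` fmv r \<subseteq> dom \<delta>" using rule(3) by blast
  ultimately have "wt (subst \<delta> l) \<sigma>" "wt (subst \<delta> r) \<sigma>"
    using rule(2,3) by (simp_all add: wt_subst)
  then show ?case by blast
next
  case (beta s x t)
  then obtain \<tau> where \<tau>: "wt (App (lam x s) t) \<tau>" by (auto simp: is_term_iff_wt)
  then have t: "wt t (var_ty x)" and b: "has_ty [var_ty x] (bind x 0 s) \<tau>" "fmv (bind x 0 s) = {}"
    by (auto simp: lam_def wt_Lam_iff elim!: wt_AppE)
  have "inst 0 [t] (bind x 0 s) = subst [Inl x \<mapsto> t] s"
    using t beta(1) by (auto intro: inst_bind wt_lc simp: is_term_iff_wt)
  then show ?case using wt_inst[OF b t] \<tau> by auto
next
  case (appL s s' t)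
  then obtain \<tau> where \<tau>: "wt (App s t) \<tau>" by (auto simp: is_term_iff_wt)
  then obtain \<sigma> where st: "wt s (\<sigma> \<rightarrow> \<tau>)" "wt t \<sigma>" by (rule wt_AppE)
  then have "wt s' (\<sigma> \<rightarrow> \<tau>)" using appL(3) wt_unique by blast
  then show ?case using wt_App st \<tau> by blast
next
  case (appR t t' s)
  then obtain \<tau> where \<tau>: "wt (App s t) \<tau>" by (auto simp: is_term_iff_wt)
  then obtain \<sigma> where st: "wt s (\<sigma> \<rightarrow> \<tau>)" "wt t \<sigma>" by (rule wt_AppE)
  then have "wt t' \<sigma>" using appR(3) wt_unique by blast
  then show ?case using wt_App st \<tau> by blast
next
  case (abs s s' x)
  then show ?case using wt_lam by blast
qed

lemma rstep_preserves_wt: "rstep U s t \<Longrightarrow> wt s \<sigma> \<Longrightarrow> wt t \<sigma>"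
  using rstep_wt wt_unique by blast

lemma rsteps_preserve_wt: "(rstep U)\<^sup>*\<^sup>* s t \<Longrightarrow> wt s \<sigma> \<Longrightarrow> wt t \<sigma>"
  by (induction rule: rtranclp_induct) (auto intro: rstep_preserves_wt)

lemma Lam_eq_lam:
  assumes "x \<notin> fv u" "lc 1 u" "var_ty x = \<sigma>"
  shows "Lam \<sigma> u = lam x (inst 0 [Free x] u)"
  using assms bind_inst[of x u 0] by (simp add: lam_def)

text \<open>\<open>rstep\<close> is defined with named abstractions; choosing a name that is fresh
  for the body turns its beta rule into instantiation of index 0.\<close>

lemma rstep_beta:
  assumes "wt (App (Lam \<sigma> u) t) \<tau>"
  shows "rstep U (App (Lam \<sigma> u) t) (inst 0 [t] u)"
proof -
  obtain x where x: "var_ty x = \<sigma>" "x \<notin> fv u" using fresh_var[OF finite_fv] by blast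
  define s where "s = inst 0 [Free x] u"
  have u: "has_ty [\<sigma>] u \<tau>" "fmv u = {}" "wt t \<sigma>"
    using assms by (auto simp: wt_Lam_iff elim: wt_AppE)
  then have lam: "Lam \<sigma> u = lam x s"
    using has_ty_lc[OF u(1)] x by (simp add: s_def Lam_eq_lam)
  have s: "wt s \<tau>" using wt_inst[OF u(1,2), of "Free x"] wt_Free[of x] x by (simp add: s_def)
  have "u = bind x 0 s" using lam x by (simp add: lam_def)
  then have "inst 0 [t] u = subst [Inl x \<mapsto> t] s"
    using s u(3) by (simp add: inst_bind wt_lc)
  then show ?thesis
    using rstep.beta[OF wt_is_term[OF s], of x t] assms by (simp add: lam wt_is_term)
qed

lemma subst_bind_fresh:
  assumes "term_subst \<theta>" "lc 0 s" "y \<notin> fv (subst \<theta> (bind x 0 s))" "var_ty y = var_ty x"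
    "lc 1 (subst \<theta> (bind x 0 s))"
  shows "subst \<theta> (lam x s) = lam y (subst (\<theta>(Inl x \<mapsto> Free y)) s)"
proof -
  have "inst 0 [Free y] (subst \<theta> (bind x 0 s)) = subst (\<theta>(Inl x \<mapsto> Free y)) s"
    using assms term_subst_lc by (intro inst_subst_bind) auto
  then show ?thesis
    using Lam_eq_lam[OF assms(3,5,4)] by (simp add: lam_def)
qed

section \<open>Closure of reduction under substitution\<close>

definition eta_subst :: "('f, 's) subst \<Rightarrow> ('f, 's) subst \<Rightarrow> ('f, 's) subst" where
  "eta_subst \<theta> \<delta> z = (case z of Inl x \<Rightarrow> None | Inr Z \<Rightarrow> map_option (\<lambda>w.
     foldr Lam (take (arity Z) (arg_tys (mvar_ty Z)))
       (subst \<theta> (mapply w (rev (map Bnd [0..<arity Z]))))) (\<delta> (Inr Z)))"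

text \<open>The naive composition \<open>\<lambda>Z. subst \<theta> (\<delta> Z)\<close> would not do: if \<open>\<delta> Z\<close> has fewer abstractions than
  the arity of \<open>Z\<close>, then \<open>\<theta>\<close> can create new ones, and \<open>mapply\<close> would contract them.\<close>

lemma subst_subst:
  assumes \<theta>: "term_subst \<theta>" "\<And>Z. \<theta> (Inr Z) = None" and \<delta>: "term_subst \<delta>"
  shows "has_ty \<Gamma> s \<sigma> \<Longrightarrow> fv s = {} \<Longrightarrow> Inr ` fmv s \<subseteq> dom \<delta> \<Longrightarrow>
    subst \<theta> (subst \<delta> s) = subst (eta_subst \<theta> \<delta>) s"
proof (induction rule: has_ty.induct)
  case (6 Z \<sigma>s \<tau> ts \<Gamma>)
  have "subst \<theta> (subst \<delta> t) = subst (eta_subst \<theta> \<delta>) t" if t: "t \<in> set ts" for t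
  proof -
    obtain i where i: "i < length ts" "t = ts ! i" using t by (metis in_set_conv_nth)
    have sub: "fv t \<subseteq> fv (Meta Z ts)" "fmv t \<subseteq> fmv (Meta Z ts)" using t by auto
    have "fv t = {}" using sub(1) 6(5) by simp
    moreover have "Inr ` fmv t \<subseteq> dom \<delta>" using image_mono[OF sub(2)] 6(6) by (rule order_trans)
    ultimately show ?thesis using 6(4)[rule_format, OF i(1)] unfolding i(2) by simp
  qed
  then have ts: "map (subst \<theta>) (map (subst \<delta>) ts) = map (subst (eta_subst \<theta> \<delta>)) ts" by simp
  have "Inr Z \<in> dom \<delta>" using 6(6) by simp
  then obtain w where w: "\<delta> (Inr Z) = Some w" by blast
  then have "lc 0 w" using term_subst_lc[OF \<delta>] by (simp add: ranI)
  have \<sigma>s: "take (arity Z) (arg_tys (mvar_ty Z)) = \<sigma>s" using 6(1,2) by simp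
  have "subst \<theta> (mapply w (map (subst \<delta>) ts)) = mapply (foldr Lam \<sigma>s
      (subst \<theta> (mapply w (rev (map Bnd [0..<length \<sigma>s]))))) (map (subst \<theta>) (map (subst \<delta>) ts))"
    using \<theta>(2) term_subst_lc[OF \<theta>(1)] \<open>lc 0 w\<close> 6(2,3) by (intro mapply_eta[symmetric]) simp_all
  moreover have "eta_subst \<theta> \<delta> (Inr Z) =
      Some (foldr Lam \<sigma>s (subst \<theta> (mapply w (rev (map Bnd [0..<length \<sigma>s])))))"
    using w \<sigma>s by (simp add: eta_subst_def 6(2))
  ultimately show ?case by (simp only: subst.simps w option.case ts)
qed (auto simp: image_Un)

lemma fmv_Lams: "fmv (foldr Lam \<sigma>s b) = fmv b"
  by (induction \<sigma>s) auto

lemma term_subst_eta: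
  assumes \<theta>: "term_subst \<theta>" and \<delta>: "term_subst \<delta>"
    and ar: "\<And>Z. Inr Z \<in> dom \<delta> \<Longrightarrow> \<exists>\<sigma>s \<tau>. mvar_ty Z = foldr Arr \<sigma>s \<tau> \<and> length \<sigma>s = arity Z"
  shows "term_subst (eta_subst \<theta> \<delta>)"
proof -
  have "wt u (mvar_ty Z)" if eta: "eta_subst \<theta> \<delta> (Inr Z) = Some u" for Z u
  proof -
    obtain w where w: "\<delta> (Inr Z) = Some w" using eta by (auto simp: eta_subst_def)
    obtain \<sigma>s \<tau> where Z: "mvar_ty Z = foldr Arr \<sigma>s \<tau>" "length \<sigma>s = arity Z" using ar w by blast
    let ?b = "mapply w (rev (map Bnd [0..<length \<sigma>s]))"
    have u: "u = foldr Lam \<sigma>s (subst \<theta> ?b)" using eta w Z by (simp add: eta_subst_def)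
    have wty: "has_ty [] w (mvar_ty Z)" "fmv w = {}"
      using \<delta> w unfolding term_subst_def is_term_def by blast+
    have "list_all2 (has_ty (rev \<sigma>s)) (rev (map Bnd [0..<length \<sigma>s])) \<sigma>s"
      unfolding list_all2_conv_all_nth
    proof (intro conjI allI impI)
      fix i assume "i < length (rev (map Bnd [0..<length \<sigma>s]) :: ('f, 's) tm list)"
      then have i: "i < length \<sigma>s" by simp
      \<comment> \<open>The context lists binder types from the innermost outwards, so argument
        \<open>i\<close> sits at the mirrored index.\<close>
      then have "has_ty (rev \<sigma>s) (Bnd (length \<sigma>s - Suc i)) (rev \<sigma>s ! (length \<sigma>s - Suc i))"
        by (intro has_ty.intros(2)) simp
      then show "has_ty (rev \<sigma>s) (rev (map Bnd [0..<length \<sigma>s]) ! i) (\<sigma>s ! i)"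
        using i by (simp add: rev_nth)
    qed simp
    then have "has_ty (rev \<sigma>s) (subst \<theta> ?b) \<tau>"
      using has_ty_mapply wty(1) Z(1) \<theta> by (metis has_ty_subst)
    then have "has_ty [] u (mvar_ty Z)" using has_ty_Lams[of \<sigma>s "[]"] by (simp add: u Z)
    moreover have "fmv ?b = {}"
      using fmv_mapply[of w "rev (map Bnd [0..<length \<sigma>s])"] wty(2) by auto
    then have "fmv (subst \<theta> ?b) = {}" using fmv_subst[OF \<theta>, of ?b] by auto
    then have "fmv u = {}" unfolding u by (simp add: fmv_Lams)
    ultimately show ?thesis by (simp add: wt_def)
  qed
  then have "\<forall>Z u. eta_subst \<theta> \<delta> (Inr Z) = Some u \<longrightarrow> is_term u \<and> has_ty [] u (mvar_ty Z)"
    by (meson wt_is_term wt_def)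
  then show ?thesis unfolding term_subst_def by (simp add: eta_subst_def)
qed

lemma rstep_subst:
  "rstep U s t \<Longrightarrow> term_subst \<theta> \<Longrightarrow> (\<And>Z. \<theta> (Inr Z) = None) \<Longrightarrow> rstep U (subst \<theta> s) (subst \<theta> t)"
proof (induction arbitrary: \<theta> rule: rstep.induct)
  case (rule l r \<delta>)
  obtain \<sigma> where lr: "has_ty [] l \<sigma>" "has_ty [] r \<sigma>" "fv l = {}" "fv r = {}" "fmv r \<subseteq> fmv l"
    using rule(1) by (rule ruleE)
  have dom: "dom (eta_subst \<theta> \<delta>) = Inr ` fmv l"
  proof -
    have "Inl x \<notin> dom \<delta>" for x using rule(3) by auto
    then have "\<delta> (Inl x) = None" for x by (meson domIff)
    then have "eta_subst \<theta> \<delta> z = None \<longleftrightarrow> \<delta> z = None" for z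
      by (cases z) (simp_all add: eta_subst_def)
    then show ?thesis unfolding rule(3)[symmetric] dom_def by simp
  qed
  have "term_subst (eta_subst \<theta> \<delta>)"
    using mvar_arity[OF lr(1)] rule by (intro term_subst_eta) auto
  then have "rstep U (subst (eta_subst \<theta> \<delta>) l) (subst (eta_subst \<theta> \<delta>) r)"
    using rule(1) dom by (intro rstep.rule)
  moreover have "subst \<theta> (subst \<delta> l) = subst (eta_subst \<theta> \<delta>) l"
    using rule lr by (intro subst_subst[of _ _ "[]" _ \<sigma>]) auto
  moreover have "subst \<theta> (subst \<delta> r) = subst (eta_subst \<theta> \<delta>) r"
    using rule lr by (intro subst_subst[of _ _ "[]" _ \<sigma>]) auto
  ultimately show ?case by simp
next
  case (beta s x t)
  then obtain \<tau> where \<tau>: "wt (App (lam x s) t) \<tau>" by (auto simp: is_term_iff_wt)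
  then have "wt (subst \<theta> (App (lam x s) t)) \<tau>"
    using beta(3) by (intro wt_subst) (auto simp: wt_def)
  then have "rstep U (subst \<theta> (App (lam x s) t)) (inst 0 [subst \<theta> t] (subst \<theta> (bind x 0 s)))"
    by (simp add: lam_def rstep_beta)
  also have "inst 0 [subst \<theta> t] (subst \<theta> (bind x 0 s)) = subst \<theta> (inst 0 [t] (bind x 0 s))"
    using beta(3,4) term_subst_lc by (simp add: subst_inst)
  also have "inst 0 [t] (bind x 0 s) = subst [Inl x \<mapsto> t] s"
    using \<tau> beta(1) by (auto intro!: inst_bind simp: is_term_iff_wt elim!: wt_AppE intro: wt_lc)
  finally show ?case .
next
  case (appL s s' t)
  then obtain \<tau> where \<tau>: "wt (App s t) \<tau>" by (auto simp: is_term_iff_wt)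
  then have "wt (subst \<theta> (App s t)) \<tau>" using appL(4) by (intro wt_subst) (auto simp: wt_def)
  then show ?case using appL by (auto intro: rstep.appL wt_is_term)
next
  case (appR t t' s)
  then obtain \<tau> where \<tau>: "wt (App s t) \<tau>" by (auto simp: is_term_iff_wt)
  then have "wt (subst \<theta> (App s t)) \<tau>" using appR(4) by (intro wt_subst) (auto simp: wt_def)
  then show ?case using appR by (auto intro: rstep.appR wt_is_term)
next
  case (abs s s' x)
  obtain \<sigma> where s: "wt s \<sigma>" "wt s' \<sigma>" using rstep_wt[OF abs(1)] by blast
  \<comment> \<open>One name has to be fresh for both sides, because a step below an abstraction
    keeps its binder.\<close>
  obtain y where y: "var_ty y = var_ty x"
    "y \<notin> fv (subst \<theta> (bind x 0 s)) \<union> fv (subst \<theta> (bind x 0 s'))"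
    using fresh_var by (metis finite_UnI finite_fv)
  have lc: "lc 1 (subst \<theta> (bind x 0 u))" if "wt u \<sigma>" for u
  proof -
    have "has_ty [var_ty x] (bind x 0 u) \<sigma>" using that has_ty_bind[of "[]" u] by (auto simp: wt_def)
    from has_ty_lc[OF has_ty_subst[OF this abs(4)]] show ?thesis by simp
  qed
  let ?\<theta> = "\<theta>(Inl x \<mapsto> Free y)"
  have \<theta>': "term_subst ?\<theta>"
    using abs(4) y(1) wt_Free[of y] wt_is_term[OF wt_Free[of y]] by (auto simp: term_subst_def wt_def)
  have st: "rstep U (subst ?\<theta> s) (subst ?\<theta> s')" by (rule abs(3)[OF \<theta>']) (simp add: abs(5))
  have "is_term (subst ?\<theta> s)" using rstep_wt[OF st] wt_is_term by blast
  with st have "rstep U (lam y (subst ?\<theta> s)) (lam y (subst ?\<theta> s'))" by (rule rstep.abs)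
  moreover have "subst \<theta> (lam x u) = lam y (subst ?\<theta> u)"
    if "wt u \<sigma>" "y \<notin> fv (subst \<theta> (bind x 0 u))" for u
    using that y(1) lc abs(4) by (intro subst_bind_fresh) (auto intro: wt_lc)
  ultimately show ?case using s y(2) by simp
qed

text \<open>Stating the step below the binder through all its instances avoids any bound name;
  closure under substitution makes this possible.\<close>

lemma rstep_Lam:
  assumes "rstep U (Lam \<sigma> u) v"
  obtains u' where "v = Lam \<sigma> u'" "\<And>t. wt t \<sigma> \<Longrightarrow> rstep U (inst 0 [t] u) (inst 0 [t] u')"
  using assms
proof (cases rule: rstep.cases)
  case (rule l r \<delta>)
  then have "\<exists>f. head (Lam \<sigma> u) = Fn f" using head_redex by metis
  then show ?thesis by simp
next
  case (abs s s' x)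
  then have x: "\<sigma> = var_ty x" "u = bind x 0 s" by (auto simp: lam_def)
  show ?thesis
  proof (rule that[of "bind x 0 s'"])
    show "v = Lam \<sigma> (bind x 0 s')" using abs x by (simp add: lam_def)
    fix t assume t: "wt t \<sigma>"
    then have "term_subst [Inl x \<mapsto> t]" using x by (auto simp: term_subst_def wt_is_term wt_def)
    from rstep_subst[OF abs(3) this]
    have "rstep U (subst [Inl x \<mapsto> t] s) (subst [Inl x \<mapsto> t] s')" by simp
    then show "rstep U (inst 0 [t] u) (inst 0 [t] (bind x 0 s'))"
      using t rstep_wt[OF abs(3)] by (auto simp: x inst_bind wt_lc)
  qed
qed

text \<open>As rules are headed by symbols that are not fresh, the premise on the head leaves beta
  as the only step at the root.\<close>

lemma rstep_App:
  assumes "rstep U (App s t) v" "\<And>f. head s = Fn f \<Longrightarrow> \<exists>\<tau> n. f = Fresh \<tau> n"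
  obtains \<sigma> u where "s = Lam \<sigma> u" "v = inst 0 [t] u"
  | s' where "v = App s' t" "rstep U s s'"
  | t' where "v = App s t'" "rstep U t t'"
  using assms(1)
proof (cases rule: rstep.cases)
  case (rule l r \<delta>)
  then show ?thesis using head_redex[OF rule(3), of \<delta>] assms(2) by (metis head.simps(1))
next
  case (beta s' x)
  then have "wt t (var_ty x) \<and> (\<exists>\<sigma>. wt s' \<sigma>)"
    by (auto simp: is_term_iff_wt lam_def wt_Lam_iff elim!: wt_AppE)
  then have "inst 0 [t] (bind x 0 s') = subst [Inl x \<mapsto> t] s'" by (auto intro: inst_bind wt_lc)
  then show ?thesis using beta that(1) by (simp add: lam_def)
qed (use that in \<open>auto simp: lam_def\<close>)

lemma rstep_apps: "rstep U s s' \<Longrightarrow> wt (apps s ts) \<tau> \<Longrightarrow> rstep U (apps s ts) (apps s' ts)"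
proof (induction ts arbitrary: \<tau> rule: rev_induct)
  case (snoc t ts)
  then have "wt (App (apps s ts) t) \<tau>" by simp
  then obtain \<sigma> where "wt (apps s ts) (\<sigma> \<rightarrow> \<tau>)" by (rule wt_AppE)
  then have "rstep U (apps s ts) (apps s' ts)" using snoc by blast
  then show ?case using rstep.appL wt_is_term[OF \<open>wt (App (apps s ts) t) \<tau>\<close>] by simp
qed simp

lemma no_rstep_Free: "\<not> rstep U (Free x) t"
proof (rule notI)
  assume "rstep U (Free x) t"
  then show False
  proof (cases rule: rstep.cases)
    case (rule l r \<delta>)
    have "\<exists>f. head (subst \<delta> l) = Fn f" using head_redex[OF rule(3), of \<delta>] by blast
    then show ?thesis unfolding rule(1)[symmetric] by simp
  qed (simp_all add: lam_def)
qed

end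

section \<open>Existence of the set of computable terms\<close>

context afsm
begin

lemma comp_at_wt: "comp_at I \<sigma> s \<Longrightarrow> wt s \<sigma>"
  by (cases \<sigma>) (auto simp: wt_def is_term_def)

lemma comp_at_Sort [simp]: "comp_at I (Sort \<iota>) s \<longleftrightarrow> wt s (Sort \<iota>) \<and> s \<in> I"
  by (auto simp: wt_def is_term_def meta_term_def)

lemma comp_at_Arr [simp]:
  "comp_at I (\<sigma> \<rightarrow> \<tau>) s \<longleftrightarrow> wt s (\<sigma> \<rightarrow> \<tau>) \<and> (\<forall>t. comp_at I \<sigma> t \<longrightarrow> comp_at I \<tau> (App s t))"
  by (auto simp: wt_def is_term_def meta_term_def)

declare comp_at.simps [simp del]

lemma computable_iff: "wt s \<sigma> \<Longrightarrow> computable I s \<longleftrightarrow> comp_at I \<sigma> s"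
  unfolding computable_def using comp_at_wt wt_unique by blast

lemma comp_at_apps:
  "comp_at I (foldr Arr \<sigma>s \<tau>) s \<Longrightarrow> list_all2 (comp_at I) \<sigma>s ts \<Longrightarrow> comp_at I \<tau> (apps s ts)"
  by (induction \<sigma>s arbitrary: s ts) (auto simp: list_all2_Cons1)

text \<open>Peeling off one argument at a time opens the two relations to structural induction on
  types.\<close>

lemma geq_pos_simps [simp]:
  "geq_pos \<iota> (Sort \<kappa>) \<longleftrightarrow> \<iota> \<succeq> \<kappa>" "geq_pos \<iota> (\<sigma> \<rightarrow> \<tau>) \<longleftrightarrow> gt_neg \<iota> \<sigma> \<and> geq_pos \<iota> \<tau>"
  by (subst geq_pos.simps, simp) (subst (1 2) geq_pos.simps, auto)

lemma gt_neg_simps [simp]: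
  "gt_neg \<iota> (Sort \<kappa>) \<longleftrightarrow> \<iota> \<succ> \<kappa>" "gt_neg \<iota> (\<sigma> \<rightarrow> \<tau>) \<longleftrightarrow> geq_pos \<iota> \<sigma> \<and> gt_neg \<iota> \<tau>"
  by (subst gt_neg.simps, simp) (subst (1 2) gt_neg.simps, auto)

lemma geq_pos_foldr: "geq_pos \<iota> (foldr Arr \<tau>s \<tau>) \<longleftrightarrow> (\<forall>\<rho> \<in> set \<tau>s. gt_neg \<iota> \<rho>) \<and> geq_pos \<iota> \<tau>"
  by (induction \<tau>s) auto

lemma wt_apps_Fn:
  assumes "wt (apps (Fn f) ss) (Sort \<kappa>)"
  shows "list_all2 wt ss (arg_tys (sym_ty f))" "out_sort (sym_ty f) = \<kappa>"
proof -
  obtain \<sigma>s where "wt (Fn f) (foldr Arr \<sigma>s (Sort \<kappa>))" "list_all2 wt ss \<sigma>s"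
    using assms by (auto simp: wt_apps)
  then have "sym_ty f = foldr Arr \<sigma>s (Sort \<kappa>)" using wt_Fn wt_unique by blast
  then show "list_all2 wt ss (arg_tys (sym_ty f))" "out_sort (sym_ty f) = \<kappa>"
    using \<open>list_all2 wt ss \<sigma>s\<close> by auto
qed

lemma wt_apps_Fn_Acc:
  assumes "wt (apps (Fn f) ss) (Sort \<kappa>)" "i < length ss" "i \<in> Acc (Fn f)"
  obtains \<sigma> where "wt (ss ! i) \<sigma>" "geq_pos \<kappa> \<sigma>"
  using wt_apps_Fn[OF assms(1)] assms(2,3) by (auto simp: list_all2_conv_all_nth)

end

context rule_system
begin

text \<open>The right-hand side of the equation in \<open>is_C\<close>, as an operator whose fixed
  points are sought.\<close>

definition comp_op :: "('f, 's) tm set \<Rightarrow> ('f, 's) tm set" where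
  "comp_op I = {s. base_term s \<and> terminating (\<lambda>u v. rstep U u v \<or> acc_step I u v) s \<and>
      (\<forall>f ss i. (rstep U)\<^sup>*\<^sup>* s (apps (Fn f) ss) \<longrightarrow> i < length ss \<longrightarrow> i \<in> Acc (Fn f) \<longrightarrow>
        computable I (ss ! i))}"

lemma acc_step_head: "acc_step I s t \<Longrightarrow> \<exists>f. head s = Fn f"
  by (auto simp: acc_step_def)

lemma base_term_rstep: "base_term s \<Longrightarrow> rstep U s t \<Longrightarrow> base_term t"
  by (auto simp: base_term_iff_wt intro: rstep_preserves_wt)

lemma comp_op_rstep: "s \<in> comp_op I \<Longrightarrow> rstep U s t \<Longrightarrow> t \<in> comp_op I"
  unfolding comp_op_def terminating_iff_SN
  by (auto intro: base_term_rstep accp_downward converse_rtranclp_into_rtranclp)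

text \<open>Without a function symbol at the head there is no accessibility step, and the condition
  on accessible arguments concerns proper reducts only. So everything is inherited from the reducts,
  for any \<open>I\<close>.\<close>

lemma comp_op_neutral:
  assumes "base_term s" "\<And>f. head s \<noteq> Fn f" "\<And>t. rstep U s t \<Longrightarrow> t \<in> comp_op I"
  shows "s \<in> comp_op I"
proof -
  have "SN (\<lambda>u v. rstep U u v \<or> acc_step I u v) s"
  proof (rule accp.accI)
    fix t assume "rstep U s t \<or> acc_step I s t"
    then have "rstep U s t" using acc_step_head assms(2) by blast
    then show "SN (\<lambda>u v. rstep U u v \<or> acc_step I u v) t"
      using assms(3) by (auto simp: comp_op_def terminating_iff_SN)
  qed
  moreover have "computable I (ss ! i)"
    if st: "(rstep U)\<^sup>*\<^sup>* s (apps (Fn f) ss)" "i < length ss" "i \<in> Acc (Fn f)" for f ss i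
    using st(1)
  proof (cases rule: converse_rtranclpE)
    case base
    then show ?thesis using assms(2)[of f] by simp
  next
    case (step t)
    then show ?thesis using assms(3)[OF step(1)] st(2,3) unfolding comp_op_def by blast
  qed
  ultimately show ?thesis using assms(1) unfolding comp_op_def terminating_iff_SN by blast
qed

text \<open>The closure properties of an RC-set hold for every set of the form
  \<open>comp_op I\<close>, so the equation is all that has to be solved.\<close>

lemma is_C_fixed_point:
  assumes "I = comp_op I"
  shows "is_C U I"
proof -
  have "terminating (rstep U) s" if "s \<in> comp_op I" for s
  proof -
    have "SN (\<lambda>u v. rstep U u v \<or> acc_step I u v) s"
      using that by (simp add: comp_op_def terminating_iff_SN)
    then show ?thesis unfolding terminating_iff_SN
      by (rule SN_image[of _ "\<lambda>x. x" _ "\<lambda>_. True"]) auto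
  qed
  moreover have "s \<in> comp_op I"
    if "base_term s" "(\<exists>x ss. s = apps (Free x) ss) \<or> (\<exists>x u s\<^sub>0 ss. s = apps (lam x u) (s\<^sub>0 # ss))"
      "\<forall>t. rstep U s t \<longrightarrow> t \<in> comp_op I" for s
  proof (rule comp_op_neutral)
    show "head s \<noteq> Fn f" for f using that(2) by (auto simp: lam_def)
  qed (use that in auto)
  moreover have "base_term s" if "s \<in> comp_op I" for s using that by (simp add: comp_op_def)
  ultimately have "rc_set U (comp_op I)"
    unfolding rc_set_def using comp_op_rstep by blast
  then show ?thesis unfolding is_C_def using assms by (simp add: comp_op_def)
qed

end

locale ordered_rule_system = rule_system fty geq U
  for fty :: "'f \<Rightarrow> 's ty" and geq :: "'s \<Rightarrow> 's \<Rightarrow> bool"  (infix "\<succeq>" 50) and U +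
  assumes geq_refl: "reflp geq" and geq_trans: "transp geq" and gt_wf: "wfp (\<lambda>\<kappa> \<iota>. gt \<iota> \<kappa>)"
begin

lemma geq_reflD: "\<iota> \<succeq> \<iota>"
  using geq_refl by (rule reflpD)

lemma geq_transD: "\<iota> \<succeq> \<kappa> \<Longrightarrow> \<kappa> \<succeq> \<mu> \<Longrightarrow> \<iota> \<succeq> \<mu>"
  using geq_trans by (rule transpD)

lemma geq_gt_trans: "\<iota> \<succeq> \<kappa> \<Longrightarrow> \<kappa> \<succ> \<mu> \<Longrightarrow> \<iota> \<succ> \<mu>"
  unfolding gt_def using geq_transD by blast

lemma geq_pos_mono: "\<iota> \<succeq> \<kappa> \<Longrightarrow> (geq_pos \<kappa> \<sigma> \<longrightarrow> geq_pos \<iota> \<sigma>) \<and> (gt_neg \<kappa> \<sigma> \<longrightarrow> gt_neg \<iota> \<sigma>)"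
  by (induction \<sigma>) (auto intro: geq_transD geq_gt_trans)

text \<open>\<open>I\<close> and \<open>J\<close> are compared at the sorts that matter for \<open>\<iota>\<close>. The operator \<open>comp_op\<close> is not
  monotone, but sorts equivalent to \<open>\<iota>\<close> occur only positively in the types that are accessible for \<open>\<iota>\<close>.\<close>

definition sort_le :: "'s \<Rightarrow> ('f, 's) tm set \<Rightarrow> ('f, 's) tm set \<Rightarrow> bool" where
  "sort_le \<iota> I J \<longleftrightarrow> (\<forall>\<kappa> s. wt s (Sort \<kappa>) \<longrightarrow>
     (\<iota> \<succ> \<kappa> \<longrightarrow> (s \<in> I \<longleftrightarrow> s \<in> J)) \<and> (\<iota> \<succeq> \<kappa> \<longrightarrow> s \<in> I \<longrightarrow> s \<in> J))"

text \<open>Both polarities go through one induction, as the argument of an arrow swaps them. At a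
  sort, the negative case lies strictly below \<iota>, where the sets agree; the positive case needs
  just the inclusion.\<close>

lemma comp_at_mono:
  assumes "sort_le \<iota> I J"
  shows "(geq_pos \<iota> \<sigma> \<longrightarrow> comp_at I \<sigma> s \<longrightarrow> comp_at J \<sigma> s) \<and>
    (gt_neg \<iota> \<sigma> \<longrightarrow> comp_at J \<sigma> s \<longrightarrow> comp_at I \<sigma> s)"
proof (induction \<sigma> arbitrary: s)
  case (Sort \<kappa>)
  then show ?case using assms by (auto simp: sort_le_def)
qed simp

text \<open>The direction is reversed: the arguments supplied in an accessibility step have types
  negative for \<iota>, so for them \<open>J\<close>-computability implies
  \<open>I\<close>-computability. The target has again a sort at most \<iota>, which keeps the
  comparison applicable along a reduction.\<close>

lemma acc_step_mono:
  assumes le: "sort_le \<iota> I J" and s: "wt s (Sort \<kappa>)" "\<iota> \<succeq> \<kappa>" and st: "acc_step J s t"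
  shows "(\<exists>\<mu>. wt t (Sort \<mu>) \<and> \<iota> \<succeq> \<mu>) \<and> acc_step I s t"
proof -
  obtain f ss i ts where f: "s = apps (Fn f) ss" "i < length ss" "i \<in> Acc (Fn f)"
    "t = apps (ss ! i) ts" "\<forall>u \<in> set ts. computable J u" and base: "base_term s" "base_term t"
    using st unfolding acc_step_def by blast
  obtain \<mu> where \<mu>: "wt t (Sort \<mu>)" using base(2) by (auto simp: base_term_iff_wt)
  obtain \<sigma> where \<sigma>: "wt (ss ! i) \<sigma>" "geq_pos \<kappa> \<sigma>"
    using wt_apps_Fn_Acc f(2,3) s(1) unfolding f(1) by blast
  obtain \<tau>s where \<tau>s: "wt (ss ! i) (foldr Arr \<tau>s (Sort \<mu>))" "list_all2 wt ts \<tau>s"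
    using \<mu> unfolding f(4) wt_apps by blast
  have "geq_pos \<iota> (foldr Arr \<tau>s (Sort \<mu>))"
    using \<sigma> \<tau>s(1) wt_unique geq_pos_mono[OF s(2)] by blast
  then have pos: "\<And>\<rho>. \<rho> \<in> set \<tau>s \<Longrightarrow> gt_neg \<iota> \<rho>" "\<iota> \<succeq> \<mu>" by (auto simp: geq_pos_foldr)
  have "computable I u" if u: "u \<in> set ts" for u
  proof -
    obtain \<rho> where \<rho>: "\<rho> \<in> set \<tau>s" "wt u \<rho>"
      using \<tau>s(2) u by (metis in_set_conv_nth list_all2_conv_all_nth)
    then have "comp_at J \<rho> u" using f(5) u computable_iff by blast
    then have "comp_at I \<rho> u" using comp_at_mono[OF le] pos(1)[OF \<rho>(1)] by blast
    then show ?thesis unfolding computable_def by blast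
  qed
  then have "acc_step I s t" unfolding acc_step_def using base f by blast
  then show ?thesis using \<mu> pos(2) by blast
qed

text \<open>Both clauses go the right way: steps for \<open>J\<close> are steps for
  \<open>I\<close>, so termination carries over, and accessible arguments have positive
  types.\<close>

lemma comp_op_mono:
  assumes le: "sort_le \<iota> I J" and s: "wt s (Sort \<kappa>)" "\<iota> \<succeq> \<kappa>" and "s \<in> comp_op I"
  shows "s \<in> comp_op J"
proof -
  have "SN (\<lambda>u v. rstep U u v \<or> acc_step I u v) s"
    using assms(4) by (simp add: comp_op_def terminating_iff_SN)
  then have "SN (\<lambda>u v. rstep U u v \<or> acc_step J u v) s"
  proof (rule SN_image[of _ "\<lambda>x. x" _ "\<lambda>u. \<exists>\<kappa>. wt u (Sort \<kappa>) \<and> \<iota> \<succeq> \<kappa>"])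
    fix u v assume "\<exists>\<kappa>. wt u (Sort \<kappa>) \<and> \<iota> \<succeq> \<kappa>" "rstep U u v \<or> acc_step J u v"
    then show "(\<exists>\<kappa>. wt v (Sort \<kappa>) \<and> \<iota> \<succeq> \<kappa>) \<and> (rstep U u v \<or> acc_step I u v)"
      using rstep_preserves_wt acc_step_mono[OF le] by blast
  qed (use s in blast)
  moreover have "computable J (ss ! i)"
    if st: "(rstep U)\<^sup>*\<^sup>* s (apps (Fn f) ss)" and i: "i < length ss" "i \<in> Acc (Fn f)" for f ss i
  proof -
    have "wt (apps (Fn f) ss) (Sort \<kappa>)" using rsteps_preserve_wt[OF st s(1)] .
    then obtain \<sigma> where \<sigma>: "wt (ss ! i) \<sigma>" "geq_pos \<kappa> \<sigma>" using wt_apps_Fn_Acc i by blast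
    have "computable I (ss ! i)" using assms(4) st i unfolding comp_op_def by blast
    then have "comp_at I \<sigma> (ss ! i)" using \<sigma>(1) computable_iff by blast
    then have "comp_at J \<sigma> (ss ! i)"
      using comp_at_mono[OF le] geq_pos_mono[OF s(2)] \<sigma>(2) by blast
    then show ?thesis unfolding computable_def by blast
  qed
  moreover have "base_term s" using s(1) unfolding base_term_iff_wt by blast
  ultimately show ?thesis unfolding comp_op_def terminating_iff_SN by blast
qed

section \<open>Layers: one least fixed point per class of equivalent sorts\<close>

definition sort_class :: "'s \<Rightarrow> ('f, 's) tm set" where
  "sort_class \<iota> = {s. \<exists>\<kappa>. wt s (Sort \<kappa>) \<and> \<iota> \<succeq> \<kappa> \<and> \<kappa> \<succeq> \<iota>}"

definition layer_op :: "('f, 's) tm set \<Rightarrow> 's \<Rightarrow> ('f, 's) tm set \<Rightarrow> ('f, 's) tm set" where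
  "layer_op L \<iota> I = comp_op (L \<union> I \<inter> sort_class \<iota>) \<inter> sort_class \<iota>"

text \<open>Equivalent sorts share one fixed point, since their computability may depend on each
  other positively. What occurs negatively is strictly smaller and already fixed by the
  recursion.\<close>

definition layer :: "'s \<Rightarrow> ('f, 's) tm set" where
  "layer = wfrec {(\<kappa>, \<iota>). \<iota> \<succ> \<kappa>} (\<lambda>g \<iota>. lfp (layer_op (\<Union>\<kappa> \<in> {\<kappa>. \<iota> \<succ> \<kappa>}. g \<kappa>) \<iota>))"

definition below :: "'s \<Rightarrow> ('f, 's) tm set" where
  "below \<iota> = (\<Union>\<kappa> \<in> {\<kappa>. \<iota> \<succ> \<kappa>}. layer \<kappa>)"

lemma layer_eq: "layer \<iota> = lfp (layer_op (below \<iota>) \<iota>)"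
proof -
  have wf: "wf {(\<kappa>, \<iota>). \<iota> \<succ> \<kappa>}" using gt_wf by (simp add: wfp_def)
  show ?thesis
    unfolding layer_def below_def
    by (subst wfrec[OF wf]) (simp add: cut_def)
qed

text \<open>Terms of sorts strictly below \<iota> lie outside \<open>sort_class \<iota>\<close>, so
  varying \<open>I\<close> leaves them untouched, as \<open>sort_le\<close> demands.\<close>

lemma mono_layer_op: "mono (layer_op L \<iota>)"
proof (rule monoI, rule subsetI)
  fix I J s assume "I \<subseteq> J" and s: "s \<in> layer_op L \<iota> I"
  have "sort_le \<iota> (L \<union> I \<inter> sort_class \<iota>) (L \<union> J \<inter> sort_class \<iota>)"
    using \<open>I \<subseteq> J\<close> wt_unique unfolding sort_le_def sort_class_def gt_def by fastforce
  moreover obtain \<kappa> where "wt s (Sort \<kappa>)" "\<iota> \<succeq> \<kappa>"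
    using s unfolding layer_op_def sort_class_def by blast
  ultimately show "s \<in> layer_op L \<iota> J"
    using s comp_op_mono unfolding layer_op_def by blast
qed

lemma layer_unfold: "layer \<iota> = layer_op (below \<iota>) \<iota> (layer \<iota>)"
  using lfp_unfold[OF mono_layer_op] layer_eq by metis

lemma layer_sort_class: "layer \<iota> \<subseteq> sort_class \<iota>"
  using layer_unfold unfolding layer_op_def by blast

lemma layer_cong:
  assumes "\<iota> \<succeq> \<kappa>" "\<kappa> \<succeq> \<iota>"
  shows "layer \<iota> = layer \<kappa>"
proof -
  have "below \<iota> = below \<kappa>" unfolding below_def using assms geq_gt_trans by blast
  moreover have "sort_class \<iota> = sort_class \<kappa>"
    unfolding sort_class_def using assms geq_transD by blast
  ultimately show ?thesis unfolding layer_eq layer_op_def by simp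
qed

text \<open>A term occurs only in layers of sorts equivalent to its own; such a sort is either
  strictly below \<iota> or equivalent to it.\<close>

lemma layers_at_sort:
  assumes "wt s (Sort \<kappa>)" "\<iota> \<succeq> \<kappa>"
  shows "s \<in> (\<Union>\<mu>. layer \<mu>) \<longleftrightarrow> s \<in> below \<iota> \<union> layer \<iota>"
proof
  assume "s \<in> (\<Union>\<mu>. layer \<mu>)"
  then obtain \<mu> where \<mu>: "s \<in> layer \<mu>" by blast
  then have eq: "\<mu> \<succeq> \<kappa>" "\<kappa> \<succeq> \<mu>"
    using layer_sort_class assms(1) wt_unique unfolding sort_class_def by fastforce+
  show "s \<in> below \<iota> \<union> layer \<iota>"
  proof (cases "\<iota> \<succ> \<mu>")
    case True
    then show ?thesis using \<mu> unfolding below_def by blast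
  next
    case False
    then have "\<iota> \<succeq> \<mu>" "\<mu> \<succeq> \<iota>" using geq_transD[OF assms(2) eq(2)] unfolding gt_def by blast+
    then show ?thesis using \<mu> layer_cong by blast
  qed
qed (auto simp: below_def)

text \<open>At all sorts up to \<iota> the union of the layers agrees with
  \<open>below \<iota> \<union> layer \<iota>\<close>. Hence \<open>comp_op_mono\<close> applies in
  both directions and transports the fixed-point equations of the layers to the union.\<close>

lemma ex_is_C: "\<exists>I. is_C U I"
proof -
  define I where "I = (\<Union>\<mu>. layer \<mu>)"
  have "s \<in> I \<longleftrightarrow> s \<in> below \<iota> \<union> layer \<iota>" if "wt s (Sort \<kappa>)" "\<iota> \<succeq> \<kappa>" for s \<kappa> \<iota>
    unfolding I_def using layers_at_sort that by blast
  then have le: "sort_le \<iota> I (below \<iota> \<union> layer \<iota>)" "sort_le \<iota> (below \<iota> \<union> layer \<iota>) I" for \<iota>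
    unfolding sort_le_def gt_def by meson+
  have unfold: "layer \<iota> = comp_op (below \<iota> \<union> layer \<iota>) \<inter> sort_class \<iota>" for \<iota>
  proof -
    have "layer \<iota> \<inter> sort_class \<iota> = layer \<iota>" using layer_sort_class by blast
    then show ?thesis using layer_unfold[of \<iota>] unfolding layer_op_def by simp
  qed
  have "I = comp_op I"
  proof (intro equalityI subsetI)
    fix s assume "s \<in> I"
    then obtain \<iota> where "s \<in> layer \<iota>" unfolding I_def by blast
    then have s: "s \<in> comp_op (below \<iota> \<union> layer \<iota>)" "s \<in> sort_class \<iota>" using unfold by blast+
    then obtain \<kappa> where "wt s (Sort \<kappa>)" "\<iota> \<succeq> \<kappa>" unfolding sort_class_def by blast
    then show "s \<in> comp_op I" using comp_op_mono le(2) s(1) by blast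
  next
    fix s assume s: "s \<in> comp_op I"
    then obtain \<iota> where \<iota>: "wt s (Sort \<iota>)" by (auto simp: comp_op_def base_term_iff_wt)
    then have "s \<in> comp_op (below \<iota> \<union> layer \<iota>)" using comp_op_mono le(1) geq_reflD s by blast
    moreover have "s \<in> sort_class \<iota>" using \<iota> geq_reflD unfolding sort_class_def by blast
    ultimately have "s \<in> layer \<iota>" using unfold by blast
    then show "s \<in> I" unfolding I_def by blast
  qed
  then show ?thesis using is_C_fixed_point by blast
qed

definition C where "C = C_set U"

lemma is_C_C: "is_C U C"
  unfolding C_def C_set_def using ex_is_C by (rule someI_ex)

lemma C_eq: "C = comp_op C"
  using is_C_C unfolding is_C_def comp_op_def by blast

end

section \<open>Computability\<close>

context ordered_rule_system
begin

abbreviation cred :: "('f, 's) tm \<Rightarrow> ('f, 's) tm \<Rightarrow> bool" where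
  "cred u v \<equiv> rstep U u v \<or> acc_step C u v"

abbreviation comp :: "'s ty \<Rightarrow> ('f, 's) tm \<Rightarrow> bool" where
  "comp \<equiv> comp_at C"

lemma C_SN: "s \<in> C \<Longrightarrow> SN cred s"
  using C_eq unfolding comp_op_def terminating_iff_SN by blast

lemma C_SN_rstep: "s \<in> C \<Longrightarrow> SN (rstep U) s"
  by (rule SN_image[of cred "\<lambda>x. x" _ "\<lambda>_. True"]) (auto dest: C_SN)

lemma C_rstep: "s \<in> C \<Longrightarrow> rstep U s t \<Longrightarrow> t \<in> C"
  using C_eq comp_op_rstep by blast

text \<open>Applying a neutral term never creates a redex at the root. A beta redex is neutral, an
  abstraction is not.\<close>

definition neutral :: "('f, 's) tm \<Rightarrow> bool" where
  "neutral s \<longleftrightarrow> (\<forall>f. head s \<noteq> Fn f) \<and> \<not> is_Lam s"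

lemma neutral_simps [simp]: "neutral (Free x)" "neutral (App (Lam \<sigma> u) t)" "neutral s \<Longrightarrow> neutral (App s t)"
  by (auto simp: neutral_def)

text \<open>Girard's three conditions on reducibility candidates. They need a joint induction:
  termination at an arrow type uses a computable variable of the argument type, given by the third,
  and the third at an arrow type uses termination of arguments.\<close>

lemma comp_candidate:
  "(comp \<sigma> s \<longrightarrow> SN (rstep U) s) \<and> (comp \<sigma> s \<longrightarrow> rstep U s t \<longrightarrow> comp \<sigma> t) \<and>
   (wt s \<sigma> \<longrightarrow> neutral s \<longrightarrow> (\<forall>t. rstep U s t \<longrightarrow> comp \<sigma> t) \<longrightarrow> comp \<sigma> s)"
proof (induction \<sigma> arbitrary: s t)
  case (Sort \<iota>)
  have "s \<in> C" if "wt s (Sort \<iota>)" "neutral s" "\<forall>t. rstep U s t \<longrightarrow> comp (Sort \<iota>) t"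
  proof -
    have "s \<in> comp_op C"
    proof (rule comp_op_neutral)
      show "base_term s" using that(1) by (auto simp: base_term_iff_wt)
      show "head s \<noteq> Fn f" for f using that(2) by (simp add: neutral_def)
      show "t \<in> comp_op C" if "rstep U s t" for t
        using that \<open>\<forall>t. rstep U s t \<longrightarrow> comp (Sort \<iota>) t\<close> C_eq by auto
    qed
    then show ?thesis using C_eq by blast
  qed
  then show ?case using C_SN_rstep C_rstep rstep_preserves_wt by auto
next
  case (Arr \<sigma> \<tau>)
  have SN1: "\<And>s. comp \<sigma> s \<Longrightarrow> SN (rstep U) s" and step1: "\<And>s t. comp \<sigma> s \<Longrightarrow> rstep U s t \<Longrightarrow> comp \<sigma> t"
    and neut1: "\<And>s. wt s \<sigma> \<Longrightarrow> neutral s \<Longrightarrow> \<forall>t. rstep U s t \<longrightarrow> comp \<sigma> t \<Longrightarrow> comp \<sigma> s"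
    using Arr.IH(1) by blast+
  have SN2: "\<And>s. comp \<tau> s \<Longrightarrow> SN (rstep U) s" and step2: "\<And>s t. comp \<tau> s \<Longrightarrow> rstep U s t \<Longrightarrow> comp \<tau> t"
    and neut2: "\<And>s. wt s \<tau> \<Longrightarrow> neutral s \<Longrightarrow> \<forall>t. rstep U s t \<longrightarrow> comp \<tau> t \<Longrightarrow> comp \<tau> s"
    using Arr.IH(2) by blast+
  have appL: "rstep U (App s u) (App s' u)" if "rstep U s s'" "wt s (\<sigma> \<rightarrow> \<tau>)" "wt u \<sigma>" for s s' u
    using rstep.appL[OF that(1)] wt_App[OF that(2,3)] wt_is_term by blast
  have "SN (rstep U) s" if s: "comp (\<sigma> \<rightarrow> \<tau>) s"
  proof -
    \<comment> \<open>A variable is neutral and normal, hence computable; termination of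
      \<open>s\<close> is read off from \<open>s\<close> applied to it.\<close>
    obtain x where x: "var_ty x = \<sigma>" using fresh_var[of "{}" \<sigma>] by blast
    then have wx: "wt (Free x) \<sigma>" using wt_Free[of x] by simp
    then have "comp \<sigma> (Free x)" using neut1 no_rstep_Free by simp
    then have "SN (rstep U) (App s (Free x))" using s SN2 by simp
    then show ?thesis
    proof (rule SN_image[of _ "\<lambda>s. App s (Free x)" _ "\<lambda>s. wt s (\<sigma> \<rightarrow> \<tau>)"])
      show "wt s (\<sigma> \<rightarrow> \<tau>)" using s comp_at_wt by blast
      fix s t assume "wt s (\<sigma> \<rightarrow> \<tau>)" "rstep U s t"
      then show "wt t (\<sigma> \<rightarrow> \<tau>) \<and> rstep U (App s (Free x)) (App t (Free x))"
        using appL wx rstep_preserves_wt by blast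
    qed
  qed
  moreover have "comp (\<sigma> \<rightarrow> \<tau>) t" if s: "comp (\<sigma> \<rightarrow> \<tau>) s" and st: "rstep U s t"
  proof -
    have ws: "wt s (\<sigma> \<rightarrow> \<tau>)" using s comp_at_wt by blast
    have "comp \<tau> (App t u)" if "comp \<sigma> u" for u
    proof (rule step2)
      show "comp \<tau> (App s u)" using s that by simp
      show "rstep U (App s u) (App t u)" using appL[OF st ws] comp_at_wt[OF that] .
    qed
    then show ?thesis using rstep_preserves_wt[OF st ws] by simp
  qed
  moreover have "comp (\<sigma> \<rightarrow> \<tau>) s"
    if s: "wt s (\<sigma> \<rightarrow> \<tau>)" "neutral s" and red: "\<forall>t. rstep U s t \<longrightarrow> comp (\<sigma> \<rightarrow> \<tau>) t"
  proof -
    \<comment> \<open>Reducts of \<open>App s u\<close> also come from \<open>u\<close>, hence the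
      induction on its termination.\<close>
    have "comp \<tau> (App s u)" if "comp \<sigma> u" for u
      using SN1[OF that] that
    proof (induction rule: accp.induct)
      case (accI u)
      have wu: "wt u \<sigma>" using accI(3) comp_at_wt by blast
      show ?case
      proof (rule neut2)
        show "wt (App s u) \<tau>" using wt_App s(1) wu by blast
        show "neutral (App s u)" using s(2) by simp
        show "\<forall>t. rstep U (App s u) t \<longrightarrow> comp \<tau> t"
        proof (intro allI impI)
          fix t assume "rstep U (App s u) t"
          then show "comp \<tau> t"
          proof (rule rstep_App)
            show "\<exists>\<rho> n. f = Fresh \<rho> n" if "head s = Fn f" for f using s(2) that by (simp add: neutral_def)
            show "comp \<tau> t" if "s = Lam \<rho> b" for \<rho> b using s(2) that by (simp add: neutral_def)
            show "comp \<tau> t" if "t = App s' u" "rstep U s s'" for s'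
              using red that accI(3) by simp
            show "comp \<tau> t" if "t = App s u'" "rstep U u u'" for u'
              using accI(2)[OF that(2) step1[OF accI(3) that(2)]] that(1) by simp
          qed
        qed
      qed
    qed
    then show ?thesis using s(1) by simp
  qed
  ultimately show ?case by blast
qed

lemma comp_SN: "comp \<sigma> s \<Longrightarrow> SN (rstep U) s"
  using comp_candidate[of \<sigma> s s] by simp

lemma comp_rstep: "comp \<sigma> s \<Longrightarrow> rstep U s t \<Longrightarrow> comp \<sigma> t"
  using comp_candidate[of \<sigma> s t] by simp

lemma comp_neutral:
  "wt s \<sigma> \<Longrightarrow> neutral s \<Longrightarrow> (\<And>t. rstep U s t \<Longrightarrow> comp \<sigma> t) \<Longrightarrow> comp \<sigma> s"
  using comp_candidate[of \<sigma> s s] by simp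

lemma comp_Free: "comp (var_ty x) (Free x)"
  by (rule comp_neutral[OF wt_Free]) (simp_all add: no_rstep_Free)

text \<open>The application to a computable argument is neutral. It reduces to its contractum,
  covered by the assumption, or inside the body or the argument, where termination of both supports
  a nested induction.\<close>

lemma comp_Lam:
  assumes "has_ty [\<sigma>] u \<tau>" "fmv u = {}" "\<And>t. comp \<sigma> t \<Longrightarrow> comp \<tau> (inst 0 [t] u)"
  shows "comp (\<sigma> \<rightarrow> \<tau>) (Lam \<sigma> u)"
proof -
  obtain x where x: "var_ty x = \<sigma>" using fresh_var[of "{}" \<sigma>] by blast
  then have cx: "comp \<sigma> (Free x)" using comp_Free[of x] by simp
  have "SN (rstep U) (Lam \<sigma> u)"
  \<comment> \<open>A step of the abstraction is simulated by a step of its instance at the variable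
    \<open>x\<close>.\<close>
  proof (rule SN_image[of "rstep U" "\<lambda>s. case s of Lam _ u \<Rightarrow> inst 0 [Free x] u" _ "\<lambda>s. \<exists>u. s = Lam \<sigma> u"])
    show "SN (rstep U) (case Lam \<sigma> u of Lam _ u \<Rightarrow> inst 0 [Free x] u)"
      using assms(3)[OF cx] comp_SN by simp
    fix s t assume "\<exists>u. s = Lam \<sigma> u" and st: "rstep U s t"
    then obtain u where s: "s = Lam \<sigma> u" by blast
    show "(\<exists>u. t = Lam \<sigma> u) \<and>
        rstep U (case s of Lam _ u \<Rightarrow> inst 0 [Free x] u) (case t of Lam _ u \<Rightarrow> inst 0 [Free x] u)"
      using st[unfolded s]
    proof (rule rstep_Lam)
      fix u' assume "t = Lam \<sigma> u'" "\<And>t. wt t \<sigma> \<Longrightarrow> rstep U (inst 0 [t] u) (inst 0 [t] u')"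
      then show ?thesis using s comp_at_wt[OF cx] by simp
    qed
  qed blast
  \<comment> \<open>The outer induction generalises the body: its hypothesis is applied to a reduced
    body, whose instances stay computable by \<open>comp_rstep\<close>.\<close>
  then have app: "comp \<tau> (App (Lam \<sigma> u) t)" if "comp \<sigma> t" for t
    using assms that
  proof (induction "Lam \<sigma> u" arbitrary: u t rule: accp.induct)
    case (accI u)
    from comp_SN[OF accI(6)] accI(6) show ?case
    proof (induction rule: accp.induct)
      case inner: (accI t)
      have wt1: "wt (Lam \<sigma> u) (\<sigma> \<rightarrow> \<tau>)" using accI(3,4) by (simp add: wt_Lam_iff)
      show ?case
      proof (rule comp_neutral)
        show "wt (App (Lam \<sigma> u) t) \<tau>" using wt_App wt1 comp_at_wt inner(3) by blast
        fix v assume "rstep U (App (Lam \<sigma> u) t) v"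
        then show "comp \<tau> v"
        proof (rule rstep_App)
          show "\<exists>\<rho> n. f = Fresh \<rho> n" if "head (Lam \<sigma> u) = Fn f" for f using that by simp
          show "comp \<tau> v" if "Lam \<sigma> u = Lam \<rho> b" "v = inst 0 [t] b" for \<rho> b
            using that accI(5)[OF inner(3)] by simp
          show "comp \<tau> v" if v: "v = App s' t" and s': "rstep U (Lam \<sigma> u) s'" for s'
            using s'
          proof (rule rstep_Lam)
            fix u' assume u': "s' = Lam \<sigma> u'" "\<And>t. wt t \<sigma> \<Longrightarrow> rstep U (inst 0 [t] u) (inst 0 [t] u')"
            have "wt (Lam \<sigma> u') (\<sigma> \<rightarrow> \<tau>)" using rstep_preserves_wt[OF s' wt1] u'(1) by simp
            then have ty: "has_ty [\<sigma>] u' \<tau>" "fmv u' = {}" by (auto simp: wt_Lam_iff)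
            have "comp \<tau> (App (Lam \<sigma> u') t)"
            proof (rule accI(2)[OF _ ty _ inner(3)])
              show "rstep U (Lam \<sigma> u) (Lam \<sigma> u')" using s' u'(1) by simp
              show "comp \<tau> (inst 0 [t] u')" if "comp \<sigma> t" for t
                by (rule comp_rstep[OF accI(5)[OF that] u'(2)[OF comp_at_wt[OF that]]])
            qed
            then show ?thesis using u'(1) v by simp
          qed
          show "comp \<tau> v" if "v = App (Lam \<sigma> u) t'" "rstep U t t'" for t'
            using inner(2)[OF that(2) comp_rstep[OF inner(3) that(2)]] that(1) by simp
        qed
      qed simp
    qed
  qed
  moreover have "wt (Lam \<sigma> u) (\<sigma> \<rightarrow> \<tau>)" using assms(1,2) by (simp add: wt_Lam_iff)
  ultimately show ?thesis by simp
qed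

lemma comp_const_Lams: "comp \<tau> w \<Longrightarrow> comp (foldr Arr \<sigma>s \<tau>) (foldr Lam \<sigma>s w)"
proof (induction \<sigma>s)
  case (Cons \<sigma> \<sigma>s)
  let ?w = "foldr Lam \<sigma>s w"
  have w: "comp (foldr Arr \<sigma>s \<tau>) ?w" using Cons by blast
  then have wt: "wt ?w (foldr Arr \<sigma>s \<tau>)" by (rule comp_at_wt)
  have "comp (\<sigma> \<rightarrow> foldr Arr \<sigma>s \<tau>) (Lam \<sigma> ?w)"
  proof (rule comp_Lam)
    show "has_ty [\<sigma>] ?w (foldr Arr \<sigma>s \<tau>)" "fmv ?w = {}"
      using wt unfolding wt_def by (auto intro: has_ty_weaken)
    show "comp (foldr Arr \<sigma>s \<tau>) (inst 0 [t] ?w)" for t using w wt_lc[OF wt] by (simp add: inst_lc)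
  qed
  then show ?case by simp
qed simp

text \<open>No rule is headed by a fresh symbol, so a box is never a redex itself. The number 0 is
  an arbitrary pick among the fresh symbols of this type.\<close>

abbreviation box :: "'s \<Rightarrow> 's \<Rightarrow> ('f, 's) tm \<Rightarrow> ('f, 's) tm" where
  "box \<kappa> \<iota> v \<equiv> App (Fn (Fresh (Sort \<kappa> \<rightarrow> Sort \<iota>) 0)) v"

lemma wt_box: "wt v (Sort \<kappa>) \<Longrightarrow> wt (box \<kappa> \<iota> v) (Sort \<iota>)"
  using wt_Fn[of "Fresh (Sort \<kappa> \<rightarrow> Sort \<iota>) 0"] wt_App by simp

lemma rstep_box:
  assumes "rstep U (box \<kappa> \<iota> v) t"
  obtains v' where "t = box \<kappa> \<iota> v'" "rstep U v v'"
  using assms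
proof (rule rstep_App)
  fix s' assume "rstep U (Fn (Fresh (Sort \<kappa> \<rightarrow> Sort \<iota>) 0)) s'"
  then show ?thesis
  proof (cases rule: rstep.cases)
    case (rule l r \<delta>)
    from head_redex[OF rule(3), of \<delta>] show ?thesis unfolding rule(1)[symmetric] head.simps by blast
  qed (simp_all add: lam_def)
qed (use that in auto)

lemma box_Acc: "\<iota> \<succeq> \<kappa> \<Longrightarrow> 0 \<in> Acc (Fn (Fresh (Sort \<kappa> \<rightarrow> Sort \<iota>) 0))"
  by simp

lemma box_args: "box \<kappa> \<iota> v = apps (Fn f) ss \<longleftrightarrow> f = Fresh (Sort \<kappa> \<rightarrow> Sort \<iota>) 0 \<and> ss = [v]"
  using apps_atom_inject[of "Fn (Fresh (Sort \<kappa> \<rightarrow> Sort \<iota>) 0)" "Fn f" "[v]" ss] by auto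

lemma acc_step_box:
  assumes "wt v (Sort \<kappa>)" "\<iota> \<succeq> \<kappa>"
  shows "acc_step C (box \<kappa> \<iota> v) v"
proof -
  have "base_term v" "base_term (box \<kappa> \<iota> v)"
    using wt_box assms(1) by (auto simp: base_term_iff_wt)
  moreover have "box \<kappa> \<iota> v = apps (Fn (Fresh (Sort \<kappa> \<rightarrow> Sort \<iota>) 0)) [v]" by simp
  moreover have "v = apps ([v] ! 0) []" by simp
  ultimately show ?thesis unfolding acc_step_def using box_Acc[OF assms(2)]
    by (metis length_Cons zero_less_Suc empty_iff empty_set)
qed

text \<open>The content has base type and so cannot take further arguments.\<close>

lemma acc_step_boxD:
  assumes "acc_step C (box \<kappa> \<iota> v) t" "wt v (Sort \<kappa>)"
  shows "t = v"
proof -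
  obtain f ss i ts where f: "box \<kappa> \<iota> v = apps (Fn f) ss" "i < length ss" "t = apps (ss ! i) ts"
    and "base_term t" using assms(1) unfolding acc_step_def by blast
  then have "t = apps v ts" by (simp add: box_args)
  moreover obtain \<mu> where "wt t (Sort \<mu>)" using \<open>base_term t\<close> by (auto simp: base_term_iff_wt)
  ultimately obtain \<tau>s where "wt v (foldr Arr \<tau>s (Sort \<mu>))" "list_all2 wt ts \<tau>s"
    by (auto simp: wt_apps)
  then have "foldr Arr \<tau>s (Sort \<mu>) = Sort \<kappa>" using wt_unique assms(2) by blast
  then have "\<tau>s = []" by (cases \<tau>s) auto
  then show ?thesis using \<open>t = apps v ts\<close> \<open>list_all2 wt ts \<tau>s\<close> by simp
qed

text \<open>A step either reduces the content or opens the box, and the content already lies in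
  \<open>C\<close>; every reduct that still has the box holds a reduct of \<open>v\<close>.\<close>

lemma comp_box:
  assumes "comp (Sort \<kappa>) v" "\<iota> \<succeq> \<kappa>"
  shows "comp (Sort \<iota>) (box \<kappa> \<iota> v)"
proof -
  have v: "v \<in> C" "wt v (Sort \<kappa>)" using assms(1) by auto
  have "SN cred (box \<kappa> \<iota> v)" using C_SN[OF v(1)] v(2)
  proof (induction rule: accp.induct)
    case (accI v)
    show ?case
    proof (rule accp.accI)
      fix t assume "cred (box \<kappa> \<iota> v) t"
      then show "SN cred t"
      proof
        assume "rstep U (box \<kappa> \<iota> v) t"
        then show ?thesis
        proof (rule rstep_box)
          fix v' assume v': "t = box \<kappa> \<iota> v'" "rstep U v v'"
          then show ?thesis using accI(2)[of v'] rstep_preserves_wt[OF v'(2) accI(3)] by simp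
        qed
      next
        assume "acc_step C (box \<kappa> \<iota> v) t"
        then have "t = v" using acc_step_boxD accI(3) by blast
        then show ?thesis using accI(1) by (blast intro: accp.accI)
      qed
    qed
  qed
  moreover have "computable C (ss ! i)"
    if st: "(rstep U)\<^sup>*\<^sup>* (box \<kappa> \<iota> v) (apps (Fn f) ss)" and i: "i < length ss" for f ss i
  proof -
    have "\<exists>v'. apps (Fn f) ss = box \<kappa> \<iota> v' \<and> v' \<in> C \<and> wt v' (Sort \<kappa>)"
      using st
    proof (induction rule: rtranclp_induct)
      case base
      then show ?case using v by blast
    next
      case (step y z)
      then obtain v' where v': "y = box \<kappa> \<iota> v'" "v' \<in> C" "wt v' (Sort \<kappa>)" by blast
      from step(2)[unfolded v'(1)] show ?case
      proof (rule rstep_box)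
        fix w assume "z = box \<kappa> \<iota> w" "rstep U v' w"
        then show ?thesis using C_rstep[OF v'(2)] rstep_preserves_wt[OF _ v'(3)] by blast
      qed
    qed
    then obtain v' where v': "box \<kappa> \<iota> v' = apps (Fn f) ss" "v' \<in> C" "wt v' (Sort \<kappa>)" by metis
    then have "ss ! i = v'" using i by (simp add: box_args)
    moreover have "comp (Sort \<kappa>) v'" using v' by simp
    ultimately show ?thesis unfolding computable_def by blast
  qed
  moreover have wb: "wt (box \<kappa> \<iota> v) (Sort \<iota>)" using wt_box v(2) by blast
  then have "base_term (box \<kappa> \<iota> v)" unfolding base_term_iff_wt by blast
  ultimately have "box \<kappa> \<iota> v \<in> comp_op C" unfolding comp_op_def terminating_iff_SN by blast
  then show ?thesis using wb C_eq by simp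
qed

end

section \<open>Accessible subterms\<close>

context ordered_rule_system
begin

lemma inst_Lams: "inst k L (foldr Lam \<sigma>s b) = foldr Lam \<sigma>s (inst (k + length \<sigma>s) L b)"
  by (induction \<sigma>s arbitrary: k) auto

lemma rsteps_apps:
  assumes "(rstep U)\<^sup>*\<^sup>* s s'" "wt (apps s ts) \<tau>"
  shows "(rstep U)\<^sup>*\<^sup>* (apps s ts) (apps s' ts)"
  using assms(1)
proof (induction rule: rtranclp_induct)
  case (step y z)
  have "wt (apps y ts) \<tau>" using rsteps_preserve_wt[OF step(3) assms(2)] .
  then show ?case using rstep_apps[OF step(2)] step(3) by (meson rtranclp.rtrancl_into_rtrancl)
qed simp

lemma const_Lams_rsteps:
  "wt w \<tau> \<Longrightarrow> list_all2 wt as \<sigma>s \<Longrightarrow> (rstep U)\<^sup>*\<^sup>* (apps (foldr Lam \<sigma>s w) as) w"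
proof (induction \<sigma>s arbitrary: as)
  case (Cons \<sigma> \<sigma>s)
  then obtain a as' where as: "as = a # as'" "wt a \<sigma>" "list_all2 wt as' \<sigma>s"
    by (auto simp: list_all2_Cons2)
  let ?w = "foldr Lam \<sigma>s w"
  have "has_ty (rev \<sigma>s) w \<tau>" using Cons.prems(1) by (simp add: wt_def has_ty_weaken)
  then have w: "wt ?w (foldr Arr \<sigma>s \<tau>)"
    using has_ty_Lams[of \<sigma>s "[]" w \<tau>] Cons.prems(1) by (simp add: wt_def fmv_Lams)
  then have "has_ty [\<sigma>] ?w (foldr Arr \<sigma>s \<tau>)" "fmv ?w = {}"
    unfolding wt_def by (simp_all add: has_ty_weaken)
  then have "wt (Lam \<sigma> ?w) (\<sigma> \<rightarrow> foldr Arr \<sigma>s \<tau>)" unfolding wt_Lam_iff by blast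
  then have app: "wt (App (Lam \<sigma> ?w) a) (foldr Arr \<sigma>s \<tau>)" using as(2) by (rule wt_App)
  then have "rstep U (App (Lam \<sigma> ?w) a) ?w"
    using rstep_beta[OF app] inst_lc[OF wt_lc[OF w]] by simp
  moreover have "wt (apps (App (Lam \<sigma> ?w) a) as') \<tau>" using app as(3) unfolding wt_apps by blast
  ultimately have "rstep U (apps (App (Lam \<sigma> ?w) a) as') (apps ?w as')" by (rule rstep_apps)
  then show ?case using Cons.IH[OF Cons.prems(1) as(3)] as(1) by simp
qed simp

text \<open>The term \<open>\<lambda>y\<^sub>1\<dots>y\<^sub>m. c (y\<^sub>i us)\<close> for a fresh symbol \<open>c\<close>, which makes \<open>y\<^sub>i\<close> accessible. As a value
  of a variable it lets accessibility steps simulate the case of a variable head in \<open>\<unrhd>\<^sub>a\<^sub>c\<^sub>c\<close>.\<close>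

definition selector ::
  "'s ty list \<Rightarrow> 's ty \<Rightarrow> 's ty list \<Rightarrow> 's \<Rightarrow> 's \<Rightarrow> ('f, 's) tm list \<Rightarrow> ('f, 's) tm" where
  "selector \<sigma>s \<sigma> \<sigma>s' \<kappa> \<iota> us =
    foldr Lam \<sigma>s (Lam \<sigma> (foldr Lam \<sigma>s' (box \<kappa> \<iota> (apps (Bnd (length \<sigma>s')) us))))"

lemma list_all2_comp_wt: "list_all2 comp \<tau>s us \<Longrightarrow> list_all2 wt us \<tau>s"
  unfolding list_all2_conv_all_nth using comp_at_wt by metis

lemma list_all2_wt_lc: "list_all2 wt us \<tau>s \<Longrightarrow> u \<in> set us \<Longrightarrow> lc 0 u"
  by (metis in_set_conv_nth list_all2_conv_all_nth wt_lc)

text \<open>Below the abstractions for \<open>\<sigma>s'\<close>, the index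
  \<open>length \<sigma>s'\<close> denotes the variable bound just outside them.\<close>

lemma selector_inst:
  assumes "lc 0 a" "\<And>u. u \<in> set us \<Longrightarrow> lc 0 u"
  shows "inst 0 [a] (foldr Lam \<sigma>s' (box \<kappa> \<iota> (apps (Bnd (length \<sigma>s')) us)))
    = foldr Lam \<sigma>s' (box \<kappa> \<iota> (apps a us))"
proof -
  have "map (inst (length \<sigma>s') [a]) us = us" using assms(2) by (simp add: map_idI inst_closed)
  then show ?thesis using assms(1) by (simp add: inst_Lams shift_lc)
qed

text \<open>Applying the bound variable to \<open>us\<close> reaches base sort \<kappa> before the
  box is put around it, so comparing the sorts \<kappa> and \<iota> suffices, whatever the types in
  \<open>\<tau>s\<close> are.\<close>

lemma comp_selector_body:
  assumes "list_all2 comp \<tau>s us" "\<iota> \<succeq> \<kappa>"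
  defines "\<sigma> \<equiv> foldr Arr \<tau>s (Sort \<kappa>)"
  shows "comp (\<sigma> \<rightarrow> foldr Arr \<sigma>s' (Sort \<iota>))
    (Lam \<sigma> (foldr Lam \<sigma>s' (box \<kappa> \<iota> (apps (Bnd (length \<sigma>s')) us))))"
proof (rule comp_Lam)
  have us: "list_all2 wt us \<tau>s" using assms(1) by (rule list_all2_comp_wt)
  let ?b = "box \<kappa> \<iota> (apps (Bnd (length \<sigma>s')) us)" and ?\<Gamma> = "rev \<sigma>s' @ [\<sigma>]"
  have "has_ty ?\<Gamma> (Bnd (length \<sigma>s')) (?\<Gamma> ! length \<sigma>s')" by (rule has_ty.intros(2)) simp
  then have "has_ty ?\<Gamma> (Bnd (length \<sigma>s')) \<sigma>" by (simp add: nth_append)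
  moreover have "list_all2 (has_ty ?\<Gamma>) us \<tau>s"
    using us by (simp add: list_all2_conv_all_nth wt_def has_ty_weaken)
  ultimately have "has_ty ?\<Gamma> (apps (Bnd (length \<sigma>s')) us) (Sort \<kappa>)"
    unfolding \<sigma>_def by (rule has_ty_appsI)
  then have "has_ty ?\<Gamma> ?b (Sort \<iota>)"
    using has_ty.intros(3)[of ?\<Gamma> "Fresh (Sort \<kappa> \<rightarrow> Sort \<iota>) 0"] has_ty.intros(4) by fastforce
  then show "has_ty [\<sigma>] (foldr Lam \<sigma>s' ?b) (foldr Arr \<sigma>s' (Sort \<iota>))" by (rule has_ty_Lams)
  have "fmv u = {}" if "u \<in> set us" for u
    using us that by (metis in_set_conv_nth list_all2_conv_all_nth wt_def)
  then show "fmv (foldr Lam \<sigma>s' ?b) = {}" by (simp add: fmv_Lams)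
  fix a assume a: "comp \<sigma> a"
  have "comp (Sort \<kappa>) (apps a us)" using a assms(1) unfolding \<sigma>_def by (rule comp_at_apps)
  then have "comp (Sort \<iota>) (box \<kappa> \<iota> (apps a us))" using assms(2) by (rule comp_box)
  then have "comp (foldr Arr \<sigma>s' (Sort \<iota>)) (foldr Lam \<sigma>s' (box \<kappa> \<iota> (apps a us)))"
    by (rule comp_const_Lams)
  then show "comp (foldr Arr \<sigma>s' (Sort \<iota>)) (inst 0 [a] (foldr Lam \<sigma>s' ?b))"
    using selector_inst[OF wt_lc[OF comp_at_wt[OF a]] list_all2_wt_lc[OF us]] by simp
qed

lemma comp_selector:
  assumes "list_all2 comp \<tau>s us" "\<iota> \<succeq> \<kappa>" "\<sigma> = foldr Arr \<tau>s (Sort \<kappa>)"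
  shows "comp (foldr Arr (\<sigma>s @ \<sigma> # \<sigma>s') (Sort \<iota>)) (selector \<sigma>s \<sigma> \<sigma>s' \<kappa> \<iota> us)"
  using comp_const_Lams[OF comp_selector_body[OF assms(1,2)]] by (simp add: selector_def assms(3))

text \<open>Vacuous abstractions swallow the arguments before and after the selected one.\<close>

lemma selector_rsteps:
  assumes "list_all2 comp \<tau>s us" "\<iota> \<succeq> \<kappa>" "\<sigma> = foldr Arr \<tau>s (Sort \<kappa>)"
    and as: "list_all2 wt as \<sigma>s" and a: "wt a \<sigma>" and as': "list_all2 wt as' \<sigma>s'"
  shows "(rstep U)\<^sup>*\<^sup>* (apps (selector \<sigma>s \<sigma> \<sigma>s' \<kappa> \<iota> us) (as @ a # as')) (box \<kappa> \<iota> (apps a us))"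
proof -
  let ?b = "Lam \<sigma> (foldr Lam \<sigma>s' (box \<kappa> \<iota> (apps (Bnd (length \<sigma>s')) us)))"
    and ?s = "selector \<sigma>s \<sigma> \<sigma>s' \<kappa> \<iota> us"
  have us: "list_all2 wt us \<tau>s" using assms(1) by (rule list_all2_comp_wt)
  have b: "wt ?b (\<sigma> \<rightarrow> foldr Arr \<sigma>s' (Sort \<iota>))"
    using comp_selector_body[OF assms(1,2)] unfolding assms(3) by (rule comp_at_wt)
  have "wt ?s (foldr Arr (\<sigma>s @ \<sigma> # \<sigma>s') (Sort \<iota>))"
    using comp_selector[OF assms(1-3)] by (rule comp_at_wt)
  moreover have all: "list_all2 wt (as @ a # as') (\<sigma>s @ \<sigma> # \<sigma>s')"
    using as a as' by (simp add: list_all2_appendI)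
  ultimately have "wt (apps ?s (as @ a # as')) (Sort \<iota>)" unfolding wt_apps by blast
  then have "wt (apps (apps ?s as) (a # as')) (Sort \<iota>)" by simp
  moreover have "(rstep U)\<^sup>*\<^sup>* (apps ?s as) ?b"
    unfolding selector_def using b as by (rule const_Lams_rsteps)
  ultimately have 1: "(rstep U)\<^sup>*\<^sup>* (apps (apps ?s as) (a # as')) (apps ?b (a # as'))"
    by (rule rsteps_apps[rotated])
  let ?c = "foldr Lam \<sigma>s' (box \<kappa> \<iota> (apps a us))"
  have ba: "wt (App ?b a) (foldr Arr \<sigma>s' (Sort \<iota>))" using b a by (rule wt_App)
  then have "rstep U (App ?b a) ?c"
    using rstep_beta[OF ba] selector_inst[OF wt_lc[OF a] list_all2_wt_lc[OF us]] by simp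
  moreover have "wt (apps (App ?b a) as') (Sort \<iota>)" using ba as' unfolding wt_apps by blast
  ultimately have 2: "rstep U (apps (App ?b a) as') (apps ?c as')" by (rule rstep_apps)
  have "wt (apps a us) (Sort \<kappa>)" using a us assms(3) unfolding wt_apps by blast
  then have "wt (box \<kappa> \<iota> (apps a us)) (Sort \<iota>)" by (rule wt_box)
  then have 3: "(rstep U)\<^sup>*\<^sup>* (apps ?c as') (box \<kappa> \<iota> (apps a us))"
    using as' by (rule const_Lams_rsteps)
  have "(rstep U)\<^sup>*\<^sup>* (apps ?b (a # as')) (box \<kappa> \<iota> (apps a us))"
    using 2 3 by (simp add: converse_rtranclp_into_rtranclp)
  then show ?thesis using rtranclp_trans[OF 1] by simp
qed

text \<open>The substitutions of a chain are defined on meta-variables only, while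
  \<open>acc_sub\<close> opens binders; the variables set free in this way get their values from
  \<delta>.\<close>

definition extend :: "('s var \<Rightarrow> ('f, 's) tm) \<Rightarrow> ('f, 's) subst \<Rightarrow> ('f, 's) subst" where
  "extend \<delta> \<gamma> z = (case z of Inl x \<Rightarrow> Some (\<delta> x) | Inr Z \<Rightarrow> \<gamma> (Inr Z))"

definition comp_val :: "('s var \<Rightarrow> ('f, 's) tm) \<Rightarrow> bool" where
  "comp_val \<delta> \<longleftrightarrow> (\<forall>x. comp (var_ty x) (\<delta> x))"

lemma term_subst_extend: "term_subst \<gamma> \<Longrightarrow> comp_val \<delta> \<Longrightarrow> term_subst (extend \<delta> \<gamma>)"
proof -
  assume \<gamma>: "term_subst \<gamma>" and \<delta>: "comp_val \<delta>"
  have "wt (\<delta> x) (var_ty x)" for x using \<delta> comp_at_wt unfolding comp_val_def by blast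
  then have "is_term (\<delta> x) \<and> has_ty [] (\<delta> x) (var_ty x)" for x
    using wt_is_term unfolding wt_def by blast
  then show ?thesis using \<gamma> unfolding term_subst_def by (simp add: extend_def)
qed

lemma wt_subst_extend:
  assumes "has_ty [] s \<sigma>" "term_subst \<gamma>" "comp_val \<delta>" "Inr ` fmv s \<subseteq> dom \<gamma>"
  shows "wt (subst (extend \<delta> \<gamma>) s) \<sigma>"
proof (rule wt_subst[OF assms(1) term_subst_extend[OF assms(2,3)]])
  have "Inr Z \<in> dom (extend \<delta> \<gamma>)" if "Z \<in> fmv s" for Z
    using assms(4) that by (auto simp: extend_def dom_def)
  then show "Inr ` fmv s \<subseteq> dom (extend \<delta> \<gamma>)" by blast
qed

lemma ex_comp_list: "\<exists>ys. list_all2 comp \<tau>s ys"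
proof
  have "comp \<tau> (Free (Var \<tau> 0))" for \<tau> using comp_Free[of "Var \<tau> 0"] by simp
  then show "list_all2 comp \<tau>s (map (\<lambda>\<tau>. Free (Var \<tau> 0)) \<tau>s)" by (simp add: list_all2_conv_all_nth)
qed

lemma acc_stepI:
  assumes "wt (apps (Fn f) ss) (Sort \<iota>)" "i < length ss" "i \<in> Acc (Fn f)"
    "wt (ss ! i) (foldr Arr \<tau>s (Sort \<kappa>))" "list_all2 comp \<tau>s us"
  shows "acc_step C (apps (Fn f) ss) (apps (ss ! i) us)"
proof -
  have "wt (apps (ss ! i) us) (Sort \<kappa>)"
    using assms(4) list_all2_comp_wt[OF assms(5)] unfolding wt_apps by blast
  then have "base_term (apps (ss ! i) us)" "base_term (apps (Fn f) ss)"
    using assms(1) unfolding base_term_iff_wt by blast+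
  moreover have "\<forall>u \<in> set us. computable C u"
    using assms(5) unfolding computable_def by (metis in_set_conv_nth list_all2_conv_all_nth)
  ultimately show ?thesis unfolding acc_step_def using assms(2,3) by blast
qed

lemma rsteps_cred: "(rstep U)\<^sup>*\<^sup>* s t \<Longrightarrow> cred\<^sup>*\<^sup>* s t"
  by (induction rule: rtranclp_induct) (auto intro: rtranclp.rtrancl_into_rtrancl)

lemma acc_sub_has_ty:
  "s \<unrhd>\<^sub>a\<^sub>c\<^sub>c t \<Longrightarrow> has_ty [] s \<sigma> \<Longrightarrow> (\<exists>\<tau>. has_ty [] t \<tau>) \<and> fmv t \<subseteq> fmv s"
proof (induction arbitrary: \<sigma> rule: acc_sub.induct)
  case (2 s t x)
  obtain \<tau> where "has_ty [] s \<tau>" using 2(1) unfolding meta_term_def by blast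
  then show ?case using 2(3) by (simp add: lam_def)
next
  case (3 a i ss t)
  obtain \<sigma>s where "list_all2 (has_ty []) ss \<sigma>s" using 3(7) unfolding has_ty_apps by blast
  then have "has_ty [] (ss ! i) (\<sigma>s ! i)" using 3(2) by (simp add: list_all2_conv_all_nth)
  then have "(\<exists>\<tau>. has_ty [] t \<tau>) \<and> fmv t \<subseteq> fmv (ss ! i)" by (rule 3(6))
  moreover have "fmv (ss ! i) \<subseteq> fmv (apps a ss)" using 3(2) by auto
  ultimately show ?case by blast
qed blast

text \<open>The valuation is constructed from \<open>t\<close> outwards to \<open>s\<close>: the
  given one is revised at each variable head. Arguments are supplied up to base type because
  accessibility steps relate only terms of base type.\<close>

lemma acc_sub_steps:
  assumes "s \<unrhd>\<^sub>a\<^sub>c\<^sub>c t" "has_ty [] s \<sigma>" "term_subst \<gamma>" "Inr ` fmv s \<subseteq> dom \<gamma>"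
    "comp_val \<delta>\<^sub>0" "list_all2 comp \<tau>s ts" "has_ty [] t (foldr Arr \<tau>s (Sort \<kappa>))"
  shows "\<exists>\<delta> us. comp_val \<delta> \<and> list_all2 comp (arg_tys \<sigma>) us \<and>
    cred\<^sup>*\<^sup>* (apps (subst (extend \<delta> \<gamma>) s) us) (apps (subst (extend \<delta>\<^sub>0 \<gamma>) t) ts)"
  using assms
proof (induction arbitrary: \<sigma> rule: acc_sub.induct)
  case (1 s)
  have "\<sigma> = foldr Arr \<tau>s (Sort \<kappa>)" using has_ty_unique 1(1,6) by blast
  then have "list_all2 comp (arg_tys \<sigma>) ts" using 1(5) by simp
  then show ?case using 1(4) by blast
next
  case (2 s t x)
  have lc: "lc 0 s" using 2(1) has_ty_lc unfolding meta_term_def by fastforce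
  obtain \<tau> where \<tau>: "\<sigma> = var_ty x \<rightarrow> \<tau>" "has_ty [] s \<tau>" using has_ty_lamD[OF 2(4) lc] by blast
  have dom: "Inr ` fmv s \<subseteq> dom \<gamma>" using 2(6) by (simp add: lam_def)
  obtain \<delta> us where \<delta>: "comp_val \<delta>" and us: "list_all2 comp (arg_tys \<tau>) us"
    and st: "cred\<^sup>*\<^sup>* (apps (subst (extend \<delta> \<gamma>) s) us) (apps (subst (extend \<delta>\<^sub>0 \<gamma>) t) ts)"
    using 2(3)[OF \<tau>(2) 2(5) dom 2(7-9)] by blast
  let ?J = "extend \<delta> \<gamma>"
  \<comment> \<open>The additional argument is the value that \<delta> already assigns to
    \<open>x\<close>, so beta yields exactly the instance of \<open>s\<close> treated by the
    induction hypothesis.\<close>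
  have x: "comp (var_ty x) (\<delta> x)" using \<delta> unfolding comp_val_def by blast
  have "wt (subst ?J (lam x s)) \<sigma>" by (rule wt_subst_extend[OF 2(4,5) \<delta> 2(6)])
  then have wt: "wt (App (subst ?J (lam x s)) (\<delta> x)) \<tau>"
    using comp_at_wt[OF x] unfolding \<tau>(1) by (rule wt_App)
  have upd: "?J(Inl x \<mapsto> \<delta> x) = ?J" by (rule ext) (simp add: extend_def)
  have "inst 0 [\<delta> x] (subst ?J (bind x 0 s)) = subst (?J(Inl x \<mapsto> \<delta> x)) s"
    using term_subst_lc[OF term_subst_extend[OF 2(5) \<delta>]] wt_lc[OF comp_at_wt[OF x]] lc
    by (rule inst_subst_bind)
  then have "rstep U (App (subst ?J (lam x s)) (\<delta> x)) (subst ?J s)"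
    using rstep_beta[OF wt[unfolded lam_def subst.simps]] by (simp add: lam_def upd)
  moreover have "wt (App (subst ?J (lam x s)) (\<delta> x)) (foldr Arr (arg_tys \<tau>) (Sort (out_sort \<tau>)))"
    using wt by simp
  then have "wt (apps (App (subst ?J (lam x s)) (\<delta> x)) us) (Sort (out_sort \<tau>))"
    using list_all2_comp_wt[OF us] unfolding wt_apps by blast
  ultimately have "cred (apps (subst ?J (lam x s)) (\<delta> x # us)) (apps (subst ?J s) us)"
    using rstep_apps by simp
  then have "cred\<^sup>*\<^sup>* (apps (subst ?J (lam x s)) (\<delta> x # us)) (apps (subst (extend \<delta>\<^sub>0 \<gamma>) t) ts)"
    using st by (rule converse_rtranclp_into_rtranclp)
  moreover have "list_all2 comp (arg_tys \<sigma>) (\<delta> x # us)" using us x \<tau>(1) by simp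
  ultimately show ?case using \<delta> by blast
next
  case (3 a i ss t)
  obtain \<rho>s where a: "has_ty [] a (foldr Arr \<rho>s \<sigma>)" and ss: "list_all2 (has_ty []) ss \<rho>s"
    using 3(7) unfolding has_ty_apps by blast
  then have len: "length ss = length \<rho>s" by (simp add: list_all2_lengthD)
  have si: "has_ty [] (ss ! i) (\<rho>s ! i)" using ss 3(2) by (simp add: list_all2_conv_all_nth)
  have dom: "Inr ` fmv u \<subseteq> dom \<gamma>" if "u \<in> set ss" for u
  proof -
    have "fmv u \<subseteq> fmv (apps a ss)" using that by auto
    then show ?thesis using 3(9) by blast
  qed
  then have domi: "Inr ` fmv (ss ! i) \<subseteq> dom \<gamma>" using 3(2) by simp
  obtain \<delta> us where \<delta>: "comp_val \<delta>" and us: "list_all2 comp (arg_tys (\<rho>s ! i)) us"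
    and st: "cred\<^sup>*\<^sup>* (apps (subst (extend \<delta> \<gamma>) (ss ! i)) us) (apps (subst (extend \<delta>\<^sub>0 \<gamma>) t) ts)"
    using 3(6)[OF si 3(8) domi 3(10-12)] by blast
  define \<mu> \<iota> where "\<mu> = out_sort (\<rho>s ! i)" and "\<iota> = out_sort \<sigma>"
  have \<rho>i: "\<rho>s ! i = foldr Arr (arg_tys (\<rho>s ! i)) (Sort \<mu>)" by (simp add: \<mu>_def)
  \<comment> \<open>Any computable arguments will do to bring \<open>apps a ss\<close> to base type:
    the step to the argument at \<open>i\<close> discards them.\<close>
  obtain ys where ys: "list_all2 comp (arg_tys \<sigma>) ys" using ex_comp_list by blast
  define \<theta>s where "\<theta>s = \<rho>s @ arg_tys \<sigma>"
  have as: "list_all2 wt (map (subst (extend \<delta>' \<gamma>)) ss @ ys) \<theta>s" if "comp_val \<delta>'" for \<delta>'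
  proof -
    have "list_all2 wt (map (subst (extend \<delta>' \<gamma>)) ss) \<rho>s"
      unfolding list_all2_conv_all_nth
    proof (intro conjI allI impI)
      fix j assume "j < length (map (subst (extend \<delta>' \<gamma>)) ss)"
      then have j: "j < length ss" by simp
      then have "has_ty [] (ss ! j) (\<rho>s ! j)" using ss by (simp add: list_all2_conv_all_nth)
      then show "wt (map (subst (extend \<delta>' \<gamma>)) ss ! j) (\<rho>s ! j)"
        using j wt_subst_extend[OF _ 3(8) that dom] by simp
    qed (simp add: len)
    then show ?thesis using list_all2_comp_wt[OF ys] unfolding \<theta>s_def by (rule list_all2_appendI)
  qed
  have nth: "(map (subst (extend \<delta>' \<gamma>)) ss @ ys) ! i = subst (extend \<delta>' \<gamma>) (ss ! i)" for \<delta>'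
    using 3(2) by (simp add: nth_append)
  have wti: "wt (subst (extend \<delta> \<gamma>) (ss ! i)) (foldr Arr (arg_tys (\<rho>s ! i)) (Sort \<mu>))"
    using wt_subst_extend[OF si 3(8) \<delta> domi] \<rho>i by simp
  have ty: "foldr Arr \<rho>s \<sigma> = foldr Arr \<theta>s (Sort \<iota>)" by (simp add: \<theta>s_def \<iota>_def)
  show ?case
  proof (cases "\<exists>f. a = Fn f")
    case True
    then obtain f where f: "a = Fn f" by blast
    let ?ss = "map (subst (extend \<delta> \<gamma>)) ss @ ys"
    have "wt (Fn f) (foldr Arr \<theta>s (Sort \<iota>))" using a unfolding f ty by (simp add: wt_def)
    then have "wt (apps (Fn f) ?ss) (Sort \<iota>)" using as[OF \<delta>] unfolding wt_apps by blast
    moreover have "i < length ?ss" using 3(2) by simp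
    ultimately have "acc_step C (apps (Fn f) ?ss) (apps (?ss ! i) us)"
      using 3(3) wti us unfolding f by (intro acc_stepI) (simp_all only: nth)
    then have "cred (apps (subst (extend \<delta> \<gamma>) (apps a ss)) ys) (apps (subst (extend \<delta> \<gamma>) (ss ! i)) us)"
      unfolding f nth by simp
    then have "cred\<^sup>*\<^sup>* (apps (subst (extend \<delta> \<gamma>) (apps a ss)) ys) (apps (subst (extend \<delta>\<^sub>0 \<gamma>) t) ts)"
      using st by (rule converse_rtranclp_into_rtranclp)
    then show ?thesis using \<delta> ys by blast
  next
    case False
    then obtain x where x: "a = Free x" using 3(1) unfolding atom_def by blast
    have vx: "var_ty x = foldr Arr \<theta>s (Sort \<iota>)"
      using has_ty_unique[OF a[unfolded x] has_ty.intros(1)] ty by simp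
    have i\<theta>: "i < length \<theta>s" "\<theta>s ! i = \<rho>s ! i" using 3(2) len by (simp_all add: \<theta>s_def nth_append)
    then have geq: "\<iota> \<succeq> \<mu>" using 3(3) unfolding x by (simp add: vx \<mu>_def)
    define sel where "sel = selector (take i \<theta>s) (\<rho>s ! i) (drop (Suc i) \<theta>s) \<mu> \<iota> us"
    have split: "\<theta>s = take i \<theta>s @ \<rho>s ! i # drop (Suc i) \<theta>s"
      using id_take_nth_drop[OF i\<theta>(1)] i\<theta>(2) by simp
    have "comp (foldr Arr (take i \<theta>s @ \<rho>s ! i # drop (Suc i) \<theta>s) (Sort \<iota>)) sel"
      unfolding sel_def using us geq \<rho>i by (rule comp_selector)
    then have sel: "comp (var_ty x) sel" unfolding vx split[symmetric] .
    \<comment> \<open>The other arguments may contain \<open>x\<close> and change their instances,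
      but the selector drops them; the argument at \<open>i\<close> does not contain
      \<open>x\<close>.\<close>
    define \<delta>' where "\<delta>' = \<delta>(x := sel)"
    have \<delta>': "comp_val \<delta>'" using \<delta> sel unfolding comp_val_def \<delta>'_def by simp
    let ?as = "map (subst (extend \<delta>' \<gamma>)) ss @ ys"
    have eqi: "subst (extend \<delta>' \<gamma>) (ss ! i) = subst (extend \<delta> \<gamma>) (ss ! i)"
    proof (rule subst_cong)
      fix y assume "y \<in> fv (ss ! i)"
      then have "y \<noteq> x" using 3(4) unfolding x by auto
      then show "extend \<delta>' \<gamma> (Inl y) = extend \<delta> \<gamma> (Inl y)" by (simp add: extend_def \<delta>'_def)
    qed (simp add: extend_def)
    have ias: "i < length ?as" using 3(2) by simp
    have spl: "?as = take i ?as @ ?as ! i # drop (Suc i) ?as" using id_take_nth_drop[OF ias] .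
    have "list_all2 wt (take i ?as) (take i \<theta>s)" "list_all2 wt (drop (Suc i) ?as) (drop (Suc i) \<theta>s)"
      using as[OF \<delta>'] by (blast intro: list_all2_takeI list_all2_dropI)+
    moreover have ai: "?as ! i = subst (extend \<delta> \<gamma>) (ss ! i)" by (simp only: nth eqi)
    then have "wt (?as ! i) (\<rho>s ! i)" using wti \<rho>i by simp
    ultimately have "(rstep U)\<^sup>*\<^sup>* (apps sel (take i ?as @ ?as ! i # drop (Suc i) ?as))
        (box \<mu> \<iota> (apps (?as ! i) us))"
      unfolding sel_def using us geq \<rho>i by (intro selector_rsteps)
    then have "(rstep U)\<^sup>*\<^sup>* (apps sel ?as) (box \<mu> \<iota> (apps (?as ! i) us))"
      unfolding spl[symmetric] .
    then have "(rstep U)\<^sup>*\<^sup>* (apps sel ?as) (box \<mu> \<iota> (apps (subst (extend \<delta> \<gamma>) (ss ! i)) us))"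
      unfolding ai .
    moreover have "apps sel ?as = apps (subst (extend \<delta>' \<gamma>) (apps a ss)) ys"
      unfolding x by (simp add: extend_def \<delta>'_def)
    ultimately have "cred\<^sup>*\<^sup>* (apps (subst (extend \<delta>' \<gamma>) (apps a ss)) ys)
        (box \<mu> \<iota> (apps (subst (extend \<delta> \<gamma>) (ss ! i)) us))"
      using rsteps_cred by simp
    moreover have "wt (apps (subst (extend \<delta> \<gamma>) (ss ! i)) us) (Sort \<mu>)"
      using wti list_all2_comp_wt[OF us] unfolding wt_apps by blast
    then have "cred (box \<mu> \<iota> (apps (subst (extend \<delta> \<gamma>) (ss ! i)) us))
        (apps (subst (extend \<delta> \<gamma>) (ss ! i)) us)"
      using acc_step_box geq by blast
    then have "cred\<^sup>*\<^sup>* (box \<mu> \<iota> (apps (subst (extend \<delta> \<gamma>) (ss ! i)) us))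
        (apps (subst (extend \<delta>\<^sub>0 \<gamma>) t) ts)"
      using st by (rule converse_rtranclp_into_rtranclp)
    ultimately have "cred\<^sup>*\<^sup>* (apps (subst (extend \<delta>' \<gamma>) (apps a ss)) ys)
        (apps (subst (extend \<delta>\<^sub>0 \<gamma>) t) ts)"
      by (rule rtranclp_trans)
    then show ?thesis using \<delta>' ys by blast
  qed
qed

text \<open>A closed \<open>s\<close> of base type that differs from \<open>t\<close> must be headed
  by a function symbol, and this contributes the one genuine step.\<close>

lemma acc_sub_strict:
  assumes sub: "s \<unrhd>\<^sub>a\<^sub>c\<^sub>c t" "s \<noteq> t" and s: "has_ty [] s (Sort \<iota>)" "fv s = {}"
    and \<gamma>: "term_subst \<gamma>" "Inr ` fmv s \<subseteq> dom \<gamma>" "\<And>x. \<gamma> (Inl x) = None"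
    and t: "comp_val \<delta>\<^sub>0" "list_all2 comp \<tau>s ts" "has_ty [] t (foldr Arr \<tau>s (Sort \<kappa>))"
  shows "cred\<^sup>+\<^sup>+ (subst \<gamma> s) (apps (subst (extend \<delta>\<^sub>0 \<gamma>) t) ts)"
  using sub(1)
proof (cases rule: acc_sub.cases)
  case 1
  then show ?thesis using sub(2) by simp
next
  case (2 s' x)
  then show ?thesis using s(1) by (auto simp: lam_def elim: has_ty_LamE)
next
  case (3 a i ss)
  then obtain f where f: "a = Fn f" using s(2) unfolding atom_def by auto
  obtain \<rho>s where ss: "list_all2 (has_ty []) ss \<rho>s" using s(1) unfolding 3(1) has_ty_apps by blast
  then have si: "has_ty [] (ss ! i) (\<rho>s ! i)" using 3(3) by (simp add: list_all2_conv_all_nth)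
  have "fmv (ss ! i) \<subseteq> fmv s" using 3(3) unfolding 3(1) by auto
  then have dom: "Inr ` fmv (ss ! i) \<subseteq> dom \<gamma>" using \<gamma>(2) by blast
  obtain \<delta> us where \<delta>: "comp_val \<delta>" and us: "list_all2 comp (arg_tys (\<rho>s ! i)) us"
    and st: "cred\<^sup>*\<^sup>* (apps (subst (extend \<delta> \<gamma>) (ss ! i)) us) (apps (subst (extend \<delta>\<^sub>0 \<gamma>) t) ts)"
    using acc_sub_steps[OF 3(6) si \<gamma>(1) dom t] by blast
  have "fv (ss ! i) = {}" using s(2) 3(3) unfolding 3(1) by auto
  then have eq: "subst (extend \<delta> \<gamma>) (ss ! i) = subst \<gamma> (ss ! i)"
    by (intro subst_cong) (simp_all add: extend_def)
  have "acc_step C (apps (Fn f) (map (subst \<gamma>) ss)) (apps (map (subst \<gamma>) ss ! i) us)"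
  proof (rule acc_stepI[OF _ _ _ _ us])
    show "wt (apps (Fn f) (map (subst \<gamma>) ss)) (Sort \<iota>)"
      using wt_subst[OF s(1) \<gamma>(1,2)] unfolding 3(1) f by simp
    show "i < length (map (subst \<gamma>) ss)" using 3(3) by simp
    show "i \<in> Acc (Fn f)" using 3(4) f by simp
    show "wt (map (subst \<gamma>) ss ! i) (foldr Arr (arg_tys (\<rho>s ! i)) (Sort (out_sort (\<rho>s ! i))))"
      using wt_subst[OF si \<gamma>(1) dom] 3(3) by simp
  qed
  then have "cred (subst \<gamma> s) (apps (subst (extend \<delta> \<gamma>) (ss ! i)) us)"
    unfolding 3(1) f eq using 3(3) by simp
  then show ?thesis using st by (rule rtranclp_into_tranclp2)
qed

end

section \<open>Distinct arguments in patterns\<close>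

text \<open>A consequence of \<open>pattern\<close> defined by recursion on the raw syntax: it
  survives the opening of a binder without inverting \<open>pattern\<close> up to renaming. Here
  \<open>k\<close> counts the binders already passed.\<close>

fun distinct_meta_args :: "nat \<Rightarrow> ('f, 's) tm \<Rightarrow> bool" where
  "distinct_meta_args k (App s t) \<longleftrightarrow> distinct_meta_args k s \<and> distinct_meta_args k t"
| "distinct_meta_args k (Lam \<sigma> s) \<longleftrightarrow> distinct_meta_args (Suc k) s"
| "distinct_meta_args k (Meta Z ts) \<longleftrightarrow>
    distinct ts \<and> (\<forall>t \<in> set ts. (\<exists>x. t = Free x) \<or> (\<exists>i < k. t = Bnd i))"
| "distinct_meta_args k s \<longleftrightarrow> True"

lemma distinct_meta_args_apps [simp]:
  "distinct_meta_args k (apps s ts) \<longleftrightarrow>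
    distinct_meta_args k s \<and> (\<forall>t \<in> set ts. distinct_meta_args k t)"
  by (induction ts arbitrary: s) auto

lemma distinct_meta_args_bind:
  "lc k s \<Longrightarrow> distinct_meta_args (Suc k) (bind x k s) \<longleftrightarrow> distinct_meta_args k s"
proof (induction s arbitrary: k)
  case (Meta Z ts)
  have var: "((\<exists>y. bind x k t = Free y) \<or> (\<exists>i < Suc k. bind x k t = Bnd i)) \<longleftrightarrow>
      ((\<exists>y. t = Free y) \<or> (\<exists>i < k. t = Bnd i))" if "t \<in> set ts" for t
    using Meta.prems that by (cases t) auto
  have "inj_on (bind x k) (set ts)" if "\<forall>t \<in> set ts. (\<exists>y. t = Free y) \<or> (\<exists>i < k. t = Bnd i)"
  proof (rule inj_onI)
    fix t t' assume "t \<in> set ts" "t' \<in> set ts" "bind x k t = bind x k t'"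
    with that[rule_format, of t] that[rule_format, of t'] show "t = t'" by (auto split: if_splits)
  qed
  then show ?case using var by (auto simp: distinct_map)
qed auto

context afsm
begin

lemma meta_term_lc: "meta_term s \<Longrightarrow> lc 0 s"
  unfolding meta_term_def using has_ty_lc by fastforce

lemma pattern_distinct_meta_args: "pattern l \<Longrightarrow> distinct_meta_args 0 l"
proof (induction rule: pattern.induct)
  case (2 l x)
  then show ?case using distinct_meta_args_bind[OF meta_term_lc] by (simp add: lam_def)
next
  case (3 a ls)
  then show ?case by (auto simp: atom_def)
qed (auto simp: distinct_map inj_on_def)

lemma acc_sub_distinct_meta_args:
  "s \<unrhd>\<^sub>a\<^sub>c\<^sub>c t \<Longrightarrow> distinct_meta_args 0 s \<Longrightarrow> distinct_meta_args 0 t"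
proof (induction rule: acc_sub.induct)
  case (2 s t x)
  then show ?case using distinct_meta_args_bind[OF meta_term_lc] by (simp add: lam_def)
qed auto

end

section \<open>Arguments that are not used\<close>

fun occ :: "nat \<Rightarrow> ('f, 's) tm \<Rightarrow> bool" where
  "occ k (Bnd i) \<longleftrightarrow> i = k"
| "occ k (App s t) \<longleftrightarrow> occ k s \<or> occ k t"
| "occ k (Lam \<sigma> s) \<longleftrightarrow> occ (Suc k) s"
| "occ k (Meta Z ts) \<longleftrightarrow> (\<exists>t \<in> set ts. occ k t)"
| "occ k s \<longleftrightarrow> False"

lemma inst_not_occ: "\<not> occ (k + j) b \<Longrightarrow> inst k (L[j := v]) b = inst k L b"
proof (induction b arbitrary: k)
  case (Lam \<sigma> b)
  from Lam.IH[of "Suc k"] Lam.prems show ?case by simp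
qed auto

lemma occ_unlam: "occ (k + n) (unlam n u) \<Longrightarrow> n \<le> nlams u \<Longrightarrow> occ k u"
proof (induction n u arbitrary: k rule: unlam.induct)
  case (1 n \<sigma> s)
  from 1(1)[of "Suc k"] 1(2,3) show ?case by simp
qed auto

lemma occ_inst: "occ j b \<Longrightarrow> j < m \<Longrightarrow> occ j (inst m L b)"
  by (induction b arbitrary: j m) auto

lemma occ_inst_Free: "occ k b \<Longrightarrow> x \<in> fv (inst k [Free x] b)"
  by (induction b arbitrary: k) auto

lemma nlams_inst_Free: "nlams (inst k [Free x] s) = nlams s"
  by (induction s arbitrary: k rule: nlams.induct) auto

lemma unlam_inst: "n \<le> nlams s \<Longrightarrow> unlam n (inst k L s) = inst (k + n) L (unlam n s)"
proof (induction n s arbitrary: k rule: unlam.induct)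
  case (1 n \<sigma> s)
  from 1(1)[of "Suc k"] 1(2) show ?case by simp
qed (auto split: tm.splits)

lemma fv_bind: "fv (bind x k s) \<subseteq> fv s"
  by (induction s arbitrary: k) auto

lemma fv_lams: "fv (lams xs t) \<subseteq> fv t"
proof (induction xs)
  case (Cons x xs)
  then show ?case using fv_bind[of x 0 "lams xs t"] by (auto simp: lams_def lam_def)
qed (simp add: lams_def)

lemma mapply_unused:
  assumes "\<not> occ (n - Suc i) (unlam n u)" "n = min (length ss) (nlams u)" "i < n"
  shows "mapply u (ss[i := v]) = mapply u ss"
proof -
  \<comment> \<open>Argument \<open>i\<close> of the \<open>n\<close> contracted ones fills index
    \<open>n - Suc i\<close>, the innermost binder having index 0.\<close>
  have "rev ((take n ss)[i := v]) = (rev (take n ss))[n - Suc i := v]"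
    using assms(2,3) by (simp add: rev_update)
  then have "inst 0 (rev (take n (ss[i := v]))) (unlam n u) = inst 0 (rev (take n ss)) (unlam n u)"
    using inst_not_occ[of 0 "n - Suc i"] assms(1) by (simp add: take_update_swap)
  moreover have "drop n (ss[i := v]) = drop n ss" using assms(3) by simp
  ultimately show ?thesis unfolding mapply_def Let_def using assms(2) by simp
qed

text \<open>The arguments are exchanged one at a time from the left. Irrelevance of a position is
  assumed for all argument lists of this length, as the intermediate lists are mixtures of
  both.\<close>

lemma mapply_cong_used:
  assumes "length ss = length ts"
    and "\<And>i. i < length ss \<Longrightarrow> ss ! i \<noteq> ts ! i \<Longrightarrow>
      (\<And>us v. length us = length ss \<Longrightarrow> mapply u (us[i := v]) = mapply u us)"
  shows "mapply u ss = mapply u ts"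
proof -
  have "mapply u (take k ts @ drop k ss) = mapply u ss" if "k \<le> length ss" for k
    using that
  proof (induction k)
    case (Suc k)
    let ?us = "take k ts @ drop k ss"
    have len: "length ?us = length ss" "k < length ss" using Suc.prems assms(1) by auto
    have upd: "?us[k := ts ! k] = take (Suc k) ts @ drop (Suc k) ss"
      using len(2) assms(1) by (simp add: list_update_append Cons_nth_drop_Suc[symmetric] take_Suc_conv_app_nth)
    have "mapply u (?us[k := ts ! k]) = mapply u ?us"
    proof (cases "ss ! k = ts ! k")
      case True
      then have "?us[k := ts ! k] = ?us"
        using len assms(1) by (intro list_update_same_conv[THEN iffD2]) (auto simp: nth_append)
      then show ?thesis by simp
    next
      case False
      then show ?thesis using assms(2) len by blast
    qed
    then show ?case using Suc upd by simp
  qed simp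
  from this[of "length ss"] show ?thesis using assms(1) by simp
qed

context rule_system
begin

text \<open>\<open>respects_conds\<close> speaks of names, \<open>mapply\<close> of indices; the
  last clause translates. It ranges over all \<open>n\<close> up to the maximal prefix, because
  \<open>mapply\<close> strips fewer abstractions if there are fewer arguments. The set
  \<open>A\<close> keeps the names distinct during the induction.\<close>

lemma ex_lams:
  "has_ty [] u \<tau> \<Longrightarrow> finite A \<Longrightarrow>
   \<exists>xs t. u = lams xs t \<and> distinct xs \<and> set xs \<inter> A = {} \<and> meta_term t \<and> \<not> is_Lam t \<and>
     length xs = nlams u \<and>
     (\<forall>n i. i < n \<longrightarrow> n \<le> nlams u \<longrightarrow> occ (n - Suc i) (unlam n u) \<longrightarrow> xs ! i \<in> fv t)"
proof (induction "nlams u" arbitrary: u \<tau> A)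
  case 0
  then have "\<not> is_Lam u" by (cases u) auto
  then show ?case
    using 0 by (intro exI[of _ "[]"] exI[of _ u]) (auto simp: lams_def meta_term_def)
next
  case (Suc N)
  then obtain \<sigma> s where u: "u = Lam \<sigma> s" by (cases u) auto
  obtain \<tau>' where s: "has_ty [\<sigma>] s \<tau>'" using Suc.prems(1) unfolding u by (rule has_ty_LamE)
  obtain x where x: "var_ty x = \<sigma>" "x \<notin> A \<union> fv s"
    using fresh_var[of "A \<union> fv s"] Suc.prems(2) by auto
  define s' where "s' = inst 0 [Free x] s"
  have us: "u = lam x s'"
    unfolding u s'_def using x has_ty_lc[OF s] by (intro Lam_eq_lam) auto
  have s': "has_ty [] s' \<tau>'"
    unfolding s'_def using s wt_Free[of x] x(1) by (auto intro: has_ty_inst1 simp: wt_def)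
  have N: "N = nlams s'" using Suc(2) by (simp add: u s'_def nlams_inst_Free)
  obtain xs t where xs: "s' = lams xs t" "distinct xs" "set xs \<inter> insert x A = {}" "meta_term t"
    "\<not> is_Lam t" "length xs = N"
    and occ: "\<And>n i. i < n \<Longrightarrow> n \<le> N \<Longrightarrow> occ (n - Suc i) (unlam n s') \<Longrightarrow> xs ! i \<in> fv t"
    using Suc(1)[OF N s', of "insert x A"] Suc.prems(2) N by auto
  have "(x # xs) ! i \<in> fv t"
    if i: "i < n" "n \<le> Suc N" and oc: "occ (n - Suc i) (unlam n u)" for n i
  proof -
    obtain m where m: "n = Suc m" using i(1) by (cases n) auto
    have ms: "m \<le> nlams s" using i(2) m N by (simp add: s'_def nlams_inst_Free)
    have oc': "occ (m - i) (unlam m s)" using oc by (simp add: u m)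
    show ?thesis
    proof (cases i)
      case 0
      \<comment> \<open>Index \<open>m\<close> below \<open>m\<close> abstractions is the dangling
        index 0 of \<open>s\<close>, the one replaced by \<open>x\<close>.\<close>
      then have "occ 0 s" using oc' ms occ_unlam[of 0 m s] by simp
      then have "x \<in> fv s'" unfolding s'_def by (rule occ_inst_Free)
      then show ?thesis using fv_lams[of xs t] xs(1) 0 by auto
    next
      case (Suc j)
      have "unlam m s' = inst m [Free x] (unlam m s)" using unlam_inst[OF ms, of 0] by (simp add: s'_def)
      moreover have "m - Suc j < m" using i(1) m Suc by simp
      ultimately have "occ (m - Suc j) (unlam m s')" using oc' Suc occ_inst by metis
      then show ?thesis using occ[of j m] i m Suc by simp
    qed
  qed
  moreover have "u = lams (x # xs) t" using us xs(1) by (simp add: lams_def)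
  ultimately show ?case
    using xs x(2) Suc(2) by (intro exI[of _ "x # xs"] exI[of _ t]) auto
qed

text \<open>If the condition fails, the maximal prefix is longer than \<open>i\<close> and its
  variable number \<open>i\<close> is absent from the body.\<close>

lemma mapply_not_respected:
  assumes "\<not> respects_conds \<gamma> {(Z, i)}" "\<gamma> (Inr Z) = Some u" "has_ty [] u \<tau>" "i < length ss"
  shows "mapply u (ss[i := v]) = mapply u ss"
proof -
  obtain xs t where xs: "u = lams xs t" "distinct xs" "meta_term t" "\<not> is_Lam t" "length xs = nlams u"
    and occ: "\<And>n i. i < n \<Longrightarrow> n \<le> nlams u \<Longrightarrow> occ (n - Suc i) (unlam n u) \<Longrightarrow> xs ! i \<in> fv t"
    using ex_lams[OF assms(3), of "{}"] by auto
  have no: "\<not> (length xs \<le> i \<or> i < length xs \<and> xs ! i \<in> fv t)"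
  proof (rule notI)
    assume "length xs \<le> i \<or> i < length xs \<and> xs ! i \<in> fv t"
    then have "\<exists>xs t. u = lams xs t \<and> distinct xs \<and> meta_term t \<and> \<not> is_Lam t \<and>
        (length xs \<le> i \<or> i < length xs \<and> xs ! i \<in> fv t)"
      using xs(1-4) by blast
    then show False using assms(1,2) unfolding respects_conds_def by simp
  qed
  define n where "n = min (length ss) (nlams u)"
  have "i < n" "n \<le> nlams u" using no xs(5) assms(4) by (auto simp: n_def)
  then have "\<not> occ (n - Suc i) (unlam n u)" using occ no \<open>i < n\<close> xs(5) by fastforce
  then show ?thesis using mapply_unused n_def \<open>i < n\<close> by blast
qed

end

section \<open>The processor\<close>

context afsm
begin

lemma inf_chainE:
  assumes "inf_chain P R c \<gamma>"
  obtains l p A s t l' s' t' f us ws where "c i = ((l, p, A), s, t)" "c (Suc i) = (l', s', t')"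
    "(l, p, A) \<in> P" "term_subst (\<gamma> i)" "dom (\<gamma> i) = Inr ` (fmv l \<union> fmv p)"
    "respects_conds (\<gamma> i) A" "s = subst (\<gamma> i) l" "t = subst (\<gamma> i) p"
    "t = apps (Fn f) us" "s' = apps (Fn f) ws" "length us = length ws"
    "\<forall>j < length us. (rstep R)\<^sup>*\<^sup>* (us ! j) (ws ! j)"
  using assms[unfolded inf_chain_def, rule_format, of i] by (elim exE conjE) (rule that)

lemma inf_chain_fst: "inf_chain P R c \<gamma> \<Longrightarrow> fst (c i) \<in> P"
  by (rule inf_chainE[of P R c \<gamma> i]) simp_all

end

context ordered_rule_system
begin

lemma comp_val_Free: "comp_val Free"
  unfolding comp_val_def using comp_Free by blast

lemma subst_extend_closed: "fv s = {} \<Longrightarrow> subst (extend \<delta> \<gamma>) s = subst \<gamma> s"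
  by (rule subst_cong) (auto simp: extend_def)

lemma computable_closed_list:
  assumes "list_all2 (has_ty []) ss \<tau>s" "term_subst \<gamma>"
    and "\<And>s. s \<in> set ss \<Longrightarrow> Inr ` fmv s \<subseteq> dom \<gamma> \<and> computable C (subst \<gamma> s)"
  shows "list_all2 comp \<tau>s (map (subst \<gamma>) ss)"
  unfolding list_all2_conv_all_nth
proof (intro conjI allI impI)
  show "length \<tau>s = length (map (subst \<gamma>) ss)" using assms(1) by (simp add: list_all2_lengthD)
  fix i assume "i < length \<tau>s"
  then have i: "i < length ss" "has_ty [] (ss ! i) (\<tau>s ! i)"
    using assms(1) by (auto simp: list_all2_conv_all_nth)
  then have "wt (subst \<gamma> (ss ! i)) (\<tau>s ! i)" using wt_subst assms(2,3) nth_mem by blast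
  then show "comp (\<tau>s ! i) (map (subst \<gamma>) ss ! i)"
    using computable_iff assms(3)[OF nth_mem[OF i(1)]] i(1) by auto
qed

text \<open>An argument of \<open>Z\<close> whose position is not respected by \<open>\<gamma>\<close> need not be computable, but it is
  discarded by \<open>\<gamma> Z\<close>, and so it may be replaced by a variable.\<close>

lemma meta_acc_steps:
  assumes sub: "s \<unrhd>\<^sub>a\<^sub>c\<^sub>c Meta Z (map Free xs)" and t: "t = apps (Meta Z ts) ss" and "s \<noteq> t"
    and s: "has_ty [] s (Sort \<iota>)" "fv s = {}" "distinct_meta_args 0 s"
    and tt: "has_ty [] t (Sort \<kappa>)" "fv t = {}"
    and \<gamma>: "term_subst \<gamma>" "Inr ` fmv s \<subseteq> dom \<gamma>" "Inr ` fmv t \<subseteq> dom \<gamma>" "\<And>x. \<gamma> (Inl x) = None"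
    and comp: "\<And>B v. beta_sub B t v \<Longrightarrow> respects_conds \<gamma> B \<Longrightarrow> fv v = {} \<Longrightarrow> computable C (subst \<gamma> v)"
  shows "cred\<^sup>+\<^sup>+ (subst \<gamma> s) (subst \<gamma> t)"
proof -
  have dx: "distinct xs"
    using acc_sub_distinct_meta_args[OF sub s(3)] by (simp add: distinct_map)
  obtain \<rho> where \<rho>: "has_ty [] (Meta Z (map Free xs)) \<rho>"
    and fm: "fmv (Meta Z (map Free xs) :: ('f, 's) tm) \<subseteq> fmv s" using acc_sub_has_ty[OF sub s(1)] by blast
  obtain \<sigma>s where \<sigma>s: "mvar_ty Z = foldr Arr \<sigma>s \<rho>" "length \<sigma>s = arity Z"
    and xs: "list_all2 (has_ty []) (map Free xs) \<sigma>s" using \<rho> unfolding has_ty_Meta_iff by blast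
  obtain \<tau>s where \<tau>s: "has_ty [] (Meta Z ts) (foldr Arr \<tau>s (Sort \<kappa>))" "list_all2 (has_ty []) ss \<tau>s"
    using tt(1) unfolding t has_ty_apps by blast
  obtain \<sigma>s' where \<sigma>s': "mvar_ty Z = foldr Arr \<sigma>s' (foldr Arr \<tau>s (Sort \<kappa>))" "length \<sigma>s' = arity Z"
    "list_all2 (has_ty []) ts \<sigma>s'" using \<tau>s(1) unfolding has_ty_Meta_iff by blast
  have eq: "\<sigma>s' = \<sigma>s" "\<rho> = foldr Arr \<tau>s (Sort \<kappa>)"
    using foldr_Arr_inject[of \<sigma>s' \<sigma>s] \<sigma>s \<sigma>s'(1,2) by auto
  have lens: "length xs = length \<sigma>s" "length ts = length \<sigma>s" "length ss = length \<tau>s"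
    using xs \<sigma>s'(3) \<tau>s(2) eq(1) by (auto dest: list_all2_lengthD)
  \<comment> \<open>Otherwise \<open>s\<close> would be \<open>Z\<close> with no arguments at all,
    by closedness and base type, and would coincide with \<open>t\<close>.\<close>
  have neq: "s \<noteq> Meta Z (map Free xs)"
  proof (rule notI)
    assume eqs: "s = Meta Z (map Free xs)"
    then have "xs = []" using s(2) by (cases xs) auto
    moreover have "\<rho> = Sort \<iota>" using has_ty_unique \<rho> s(1) eqs by blast
    then have "\<tau>s = []" using eq(2) by (cases \<tau>s) auto
    ultimately show False using lens eqs t \<open>s \<noteq> t\<close> by simp
  qed
  have "Inr Z \<in> dom \<gamma>" using \<gamma>(2) fm by auto
  then obtain u where u: "\<gamma> (Inr Z) = Some u" by blast
  then have uty: "has_ty [] u (mvar_ty Z)" using \<gamma>(1) unfolding term_subst_def by blast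
  have sub_t: "fv v = {} \<and> Inr ` fmv v \<subseteq> dom \<gamma>" if "v \<in> set ts \<union> set ss" for v
  proof -
    have "fv v \<subseteq> fv t" "fmv v \<subseteq> fmv t" using that unfolding t by auto
    then show ?thesis using tt(2) \<gamma>(3) by blast
  qed
  have "computable C (subst \<gamma> v)" if v: "v \<in> set ss" for v
  proof (rule comp)
    show "beta_sub {} t v" unfolding t using v by (intro beta_sub.intros(6)[OF _ beta_sub.intros(1)])
    show "respects_conds \<gamma> {}" by (simp add: respects_conds_def)
    show "fv v = {}" using sub_t v by blast
  qed
  then have ss: "list_all2 comp \<tau>s (map (subst \<gamma>) ss)"
    using sub_t by (intro computable_closed_list[OF \<tau>s(2) \<gamma>(1)]) blast
  define as where "as = map (\<lambda>i. if respects_conds \<gamma> {(Z, i)} then subst \<gamma> (ts ! i)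
    else Free (Var (\<sigma>s ! i) 0)) [0..<length ts]"
  have las: "length as = length xs" using lens by (simp add: as_def)
  have as: "comp (\<sigma>s ! i) (as ! i)" if i: "i < length ts" for i
  proof (cases "respects_conds \<gamma> {(Z, i)}")
    case True
    have mem: "ts ! i \<in> set ts" using i by simp
    \<comment> \<open>Extracting this argument needs no condition besides its own, so respecting
      that single one is enough.\<close>
    have "beta_sub {(Z, i)} t (ts ! i)"
      unfolding t using i by (intro beta_sub.intros(7)[OF _ _ beta_sub.intros(1)]) auto
    then have "computable C (subst \<gamma> (ts ! i))" using comp True sub_t mem by blast
    moreover have "has_ty [] (ts ! i) (\<sigma>s ! i)" using \<sigma>s'(3) i eq(1) by (simp add: list_all2_conv_all_nth)
    then have "wt (subst \<gamma> (ts ! i)) (\<sigma>s ! i)" using wt_subst \<gamma>(1) sub_t mem by blast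
    ultimately show ?thesis using computable_iff True i by (simp add: as_def)
  next
    case False
    then show ?thesis using comp_Free[of "Var (\<sigma>s ! i) 0"] i by (simp add: as_def)
  qed
  \<comment> \<open>Distinctness of \<open>xs\<close> lets every variable receive exactly the
    argument at its own position.\<close>
  define \<delta> where "\<delta> x = (case map_of (zip xs as) x of Some a \<Rightarrow> a | None \<Rightarrow> Free x)" for x
  have \<delta>_nth: "\<delta> (xs ! i) = as ! i" if "i < length xs" for i
    using that dx las by (simp add: \<delta>_def map_of_zip_nth)
  have "comp (var_ty x) (\<delta> x)" for x
  proof (cases "x \<in> set xs")
    case True
    then obtain i where i: "i < length xs" "x = xs ! i" by (metis in_set_conv_nth)
    have "has_ty [] (Free x) (\<sigma>s ! i)" using xs i by (simp add: list_all2_conv_all_nth)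
    then have "var_ty x = \<sigma>s ! i" using has_ty_unique has_ty.intros(1) by blast
    then show ?thesis using as[of i] \<delta>_nth i lens by simp
  next
    case False
    then have "map_of (zip xs as) x = None" using las by simp
    then show ?thesis using comp_Free by (simp add: \<delta>_def)
  qed
  then have \<delta>: "comp_val \<delta>" by (simp add: comp_val_def)
  have "map (subst (extend \<delta> \<gamma>)) (map Free xs) = as"
    using \<delta>_nth las by (intro nth_equalityI) (simp_all add: extend_def)
  then have "subst (extend \<delta> \<gamma>) (Meta Z (map Free xs)) = mapply u as"
    using u by (simp add: extend_def)
  also have "\<dots> = mapply u (map (subst \<gamma>) ts)"
  proof (rule mapply_cong_used)
    show "length as = length (map (subst \<gamma>) ts)" by (simp add: as_def)
    fix i and us :: "('f, 's) tm list" and v assume i: "i < length as" "as ! i \<noteq> map (subst \<gamma>) ts ! i"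
      and us: "length us = length as"
    then have "\<not> respects_conds \<gamma> {(Z, i)}" by (auto simp: as_def)
    then show "mapply u (us[i := v]) = mapply u us"
      using mapply_not_respected u uty i(1) us by metis
  qed
  finally have "apps (subst (extend \<delta> \<gamma>) (Meta Z (map Free xs))) (map (subst \<gamma>) ss) = subst \<gamma> t"
    using u by (simp add: t)
  moreover have "cred\<^sup>+\<^sup>+ (subst \<gamma> s)
      (apps (subst (extend \<delta> \<gamma>) (Meta Z (map Free xs))) (map (subst \<gamma>) ss))"
    by (rule acc_sub_strict[OF sub neq s(1,2) \<gamma>(1,2,4) \<delta> ss \<rho>[unfolded eq(2)]])
  ultimately show ?thesis by simp
qed

lemma sqsupset_steps:
  assumes sq: "s \<sqsupset> t" and closed: "fv s = {}" "fv t = {}" and "distinct_meta_args 0 s"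
    and \<gamma>: "term_subst \<gamma>" "Inr ` fmv s \<subseteq> dom \<gamma>" "Inr ` fmv t \<subseteq> dom \<gamma>" "\<And>x. \<gamma> (Inl x) = None"
    and comp: "\<And>B v. beta_sub B t v \<Longrightarrow> respects_conds \<gamma> B \<Longrightarrow> fv v = {} \<Longrightarrow> computable C (subst \<gamma> v)"
  shows "cred\<^sup>+\<^sup>+ (subst \<gamma> s) (subst \<gamma> t)" "subst \<gamma> t \<in> C"
proof -
  obtain \<iota> \<kappa> where s: "has_ty [] s (Sort \<iota>)" and t: "has_ty [] t (Sort \<kappa>)" and "s \<noteq> t"
    using sq unfolding sqsupset_def base_def by blast
  have "s \<unrhd>\<^sub>a\<^sub>c\<^sub>c t \<or> (\<exists>Z xs ts ss. s \<unrhd>\<^sub>a\<^sub>c\<^sub>c Meta Z (map Free xs) \<and> t = apps (Meta Z ts) ss)"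
    using sq unfolding sqsupset_def by blast
  then show "cred\<^sup>+\<^sup>+ (subst \<gamma> s) (subst \<gamma> t)"
  proof
    assume "s \<unrhd>\<^sub>a\<^sub>c\<^sub>c t"
    \<comment> \<open>Since \<open>t\<close> is closed, its instance does not depend on the
      valuation, and the identity is a computable one.\<close>
    from acc_sub_strict[OF this \<open>s \<noteq> t\<close> s closed(1) \<gamma>(1,2,4) comp_val_Free, of "[]" "[]" \<kappa>] t
    show ?thesis using subst_extend_closed[OF closed(2)] by simp
  next
    assume "\<exists>Z xs ts ss. s \<unrhd>\<^sub>a\<^sub>c\<^sub>c Meta Z (map Free xs) \<and> t = apps (Meta Z ts) ss"
    then obtain Z xs ts ss where "s \<unrhd>\<^sub>a\<^sub>c\<^sub>c Meta Z (map Free xs)" "t = apps (Meta Z ts) ss" by blast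
    from meta_acc_steps[OF this \<open>s \<noteq> t\<close> s closed(1) assms(4) t closed(2) \<gamma> comp]
    show ?thesis .
  qed
  have "computable C (subst \<gamma> t)"
    using closed(2) by (intro comp[of "{}"]) (auto simp: respects_conds_def intro: beta_sub.intros)
  moreover have "wt (subst \<gamma> t) (Sort \<kappa>)" using wt_subst[OF t \<gamma>(1,3)] .
  ultimately show "subst \<gamma> t \<in> C" using computable_iff by fastforce
qed

lemma proj_apps_Fn: "proj \<nu> (apps (Fn f) ss) = ss ! \<nu> f"
  by (simp add: proj_def)

lemma proj_subst:
  assumes "head s = Fn f" "\<nu> f < length (args s)"
  shows "proj \<nu> (subst \<gamma> s) = subst \<gamma> (proj \<nu> s)"
proof -
  have "s = apps (Fn f) (args s)" using apps_head_args[of s] assms(1) by simp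
  then obtain ss where "s = apps (Fn f) ss" "\<nu> f < length ss" using assms(2) by metis
  then show ?thesis by (simp add: proj_apps_Fn)
qed

text \<open>What \<open>beta_sub\<close> extracts from the projected argument it also extracts from
  \<open>p\<close>, whose head is a symbol; thus computability of the chain reaches the
  projection.\<close>

lemma dp_decrease:
  assumes dp: "is_dp (l, p, A)" and head: "head l = Fn f" "\<nu> f < length (args l)"
      "head p = Fn g" "\<nu> g < length (args p)"
    and dec: "proj \<nu> l \<sqsupset> proj \<nu> p"
    and \<gamma>: "term_subst \<gamma>" "dom \<gamma> = Inr ` (fmv l \<union> fmv p)"
    and comp: "\<And>B v. beta_sub B p v \<Longrightarrow> respects_conds \<gamma> B \<Longrightarrow> fv v = {} \<Longrightarrow> computable C (subst \<gamma> v)"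
  shows "cred\<^sup>+\<^sup>+ (proj \<nu> (subst \<gamma> l)) (proj \<nu> (subst \<gamma> p))" "proj \<nu> (subst \<gamma> p) \<in> C"
proof -
  obtain ls ps where l: "l = apps (Fn f) ls" "\<nu> f < length ls" and p: "p = apps (Fn g) ps" "\<nu> g < length ps"
    using apps_head_args[of l] apps_head_args[of p] head by metis
  have pl: "proj \<nu> l = ls ! \<nu> f" "ls ! \<nu> f \<in> set ls" and pp: "proj \<nu> p = ps ! \<nu> g" "ps ! \<nu> g \<in> set ps"
    using l p by (simp_all add: proj_apps_Fn)
  have closed: "fv l = {}" "fv p = {}" and pat: "pattern l" using dp unfolding is_dp_def by auto
  have sub: "fv (proj \<nu> l) \<subseteq> fv l" "fmv (proj \<nu> l) \<subseteq> fmv l"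
    "fv (proj \<nu> p) \<subseteq> fv p" "fmv (proj \<nu> p) \<subseteq> fmv p"
    using pl pp unfolding l(1) p(1) by auto
  have dist: "distinct_meta_args 0 (proj \<nu> l)"
    using pattern_distinct_meta_args[OF pat] pl unfolding l(1) by auto
  have comp': "computable C (subst \<gamma> v)"
    if "beta_sub B (proj \<nu> p) v" "respects_conds \<gamma> B" "fv v = {}" for B v
  proof -
    have "beta_sub B p v"
      using beta_sub.intros(5)[OF atom_simps(1) pp(2)] that(1) pp(1) unfolding p(1) by simp
    then show ?thesis using comp that by blast
  qed
  have dom: "Inr ` fmv (proj \<nu> l) \<subseteq> dom \<gamma>" "Inr ` fmv (proj \<nu> p) \<subseteq> dom \<gamma>"
    using sub(2,4) \<gamma>(2) by blast+
  have none: "\<gamma> (Inl x) = None" for x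
  proof -
    have "Inl x \<notin> dom \<gamma>" using \<gamma>(2) by auto
    then show ?thesis by (meson domIff)
  qed
  have fv: "fv (proj \<nu> l) = {}" "fv (proj \<nu> p) = {}" using sub closed by auto
  note steps = sqsupset_steps[OF dec fv dist \<gamma>(1) dom none comp']
  have "proj \<nu> (subst \<gamma> l) = subst \<gamma> (proj \<nu> l)" "proj \<nu> (subst \<gamma> p) = subst \<gamma> (proj \<nu> p)"
    using proj_subst[where \<nu> = \<nu>, OF head(1,2)] proj_subst[where \<nu> = \<nu>, OF head(3,4)] by auto
  then show "cred\<^sup>+\<^sup>+ (proj \<nu> (subst \<gamma> l)) (proj \<nu> (subst \<gamma> p))" "proj \<nu> (subst \<gamma> p) \<in> C"
    using steps by simp_all
qed

text \<open>Followed along the projected right-hand sides, the chain is a \<open>cred\<close>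
  reduction that is strict at every DP from \<open>P\<^sub>1\<close>; infinitely many of these
  contradict termination.\<close>

lemma eventually_equal_projections:
  assumes chain: "inf_chain (P\<^sub>1 \<union> P\<^sub>2) R c \<gamma>" "computable_chain U R c \<gamma>"
    and dp: "\<And>d. d \<in> P\<^sub>1 \<union> P\<^sub>2 \<Longrightarrow> is_dp d" and proj: "projection (P\<^sub>1 \<union> P\<^sub>2) \<nu>"
    and P\<^sub>1: "\<forall>(l, p, A) \<in> P\<^sub>1. proj \<nu> l \<sqsupset> proj \<nu> p" and P\<^sub>2: "\<forall>(l, p, A) \<in> P\<^sub>2. proj \<nu> l = proj \<nu> p"
  shows "\<exists>n. \<forall>i \<ge> n. fst (c i) \<in> P\<^sub>2"
proof (rule ccontr)
  assume "\<not> (\<exists>n. \<forall>i \<ge> n. fst (c i) \<in> P\<^sub>2)"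
  moreover have mem: "fst (c i) \<in> P\<^sub>1 \<union> P\<^sub>2" for i
    using inf_chain_fst chain(1) by blast
  ultimately have inf: "\<exists>i \<ge> n. fst (c i) \<in> P\<^sub>1" for n by blast
  define v w where "v i = proj \<nu> (fst (snd (c i)))" and "w i = proj \<nu> (snd (snd (c i)))" for i
  have step: "(fst (c i) \<in> P\<^sub>1 \<longrightarrow> cred\<^sup>+\<^sup>+ (v i) (w i) \<and> w i \<in> C) \<and>
      (fst (c i) \<in> P\<^sub>2 \<longrightarrow> v i = w i) \<and> cred\<^sup>*\<^sup>* (w i) (v (Suc i))" for i
  proof -
    obtain l p A s t l' s' t' f us ws where ci: "c i = ((l, p, A), s, t)" "c (Suc i) = (l', s', t')"
      and P: "(l, p, A) \<in> P\<^sub>1 \<union> P\<^sub>2" and \<gamma>: "term_subst (\<gamma> i)" "dom (\<gamma> i) = Inr ` (fmv l \<union> fmv p)"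
      and "respects_conds (\<gamma> i) A"
      and st: "s = subst (\<gamma> i) l" "t = subst (\<gamma> i) p"
      and ts: "t = apps (Fn f) us" "s' = apps (Fn f) ws" "length us = length ws"
        "\<forall>j < length us. (rstep R)\<^sup>*\<^sup>* (us ! j) (ws ! j)"
      by (rule inf_chainE[OF chain(1), of i])
    have "\<forall>s \<in> {l, p}. \<exists>f. head s = Fn f \<and> \<nu> f < length (args s)"
      using proj P unfolding projection_def by blast
    then obtain f1 f2 where head: "head l = Fn f1" "\<nu> f1 < length (args l)"
      "head p = Fn f2" "\<nu> f2 < length (args p)" by auto
    have comp: "computable C (subst (\<gamma> i) v)"
      if "beta_sub B p v" "respects_conds (\<gamma> i) B" "fv v = {}" for B v
    proof -
      \<comment> \<open>For closed \<open>v\<close> the prefix of abstracted variables is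
        empty.\<close>
      have "computable (C_set U) (subst (\<gamma> i) (lams [] v))"
        using chain(2) ci(1) that distinct.simps(1) unfolding computable_chain_def by (metis list.set(1))
      then show ?thesis by (simp add: lams_def C_def)
    qed
    have vw: "v i = proj \<nu> (subst (\<gamma> i) l)" "w i = proj \<nu> (subst (\<gamma> i) p)"
      using ci st by (simp_all add: v_def w_def)
    have "cred\<^sup>+\<^sup>+ (v i) (w i) \<and> w i \<in> C" if "(l, p, A) \<in> P\<^sub>1"
    proof -
      have "proj \<nu> l \<sqsupset> proj \<nu> p" using P\<^sub>1 that by blast
      note dec = dp_decrease[where \<nu> = \<nu>, OF dp[OF P] head this \<gamma> comp]
      show ?thesis unfolding vw by (intro conjI dec)
    qed
    moreover have "v i = w i" if "(l, p, A) \<in> P\<^sub>2"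
    proof -
      have "proj \<nu> l = proj \<nu> p" using P\<^sub>2 that by blast
      then show ?thesis
        using proj_subst[where \<nu> = \<nu>, OF head(1,2)] proj_subst[where \<nu> = \<nu>, OF head(3,4)]
        by (simp add: vw)
    qed
    moreover have "cred\<^sup>*\<^sup>* (w i) (v (Suc i))"
    proof -
      have p: "p = apps (Fn f2) (args p)" using apps_head_args[of p] head(3) by simp
      have "apps (Fn f) us = apps (Fn f2) (map (subst (\<gamma> i)) (args p))"
        using ts(1) st(2) p by (metis subst_apps subst.simps(3))
      then have "f = f2" "length us = length (args p)"
        using apps_atom_inject[of "Fn f" "Fn f2"] by auto
      then have "(rstep R)\<^sup>*\<^sup>* (us ! \<nu> f) (ws ! \<nu> f)" using ts(4) head(4) by simp
      moreover have "w i = us ! \<nu> f" "v (Suc i) = ws ! \<nu> f"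
        using ci ts by (simp_all add: v_def w_def proj_apps_Fn)
      moreover have "rstep R a b \<Longrightarrow> rstep U a b" for a b
        using chain(2) unfolding computable_chain_def by blast
      ultimately have "(rstep U)\<^sup>*\<^sup>* (w i) (v (Suc i))"
        using rtranclp_mono[of "rstep R" "rstep U"] by (simp add: le_fun_def)
      then show ?thesis by (rule rsteps_cred)
    qed
    ultimately show ?thesis unfolding ci(1) fst_conv by meson
  qed
  have next_step: "cred\<^sup>*\<^sup>* (w i) (w (Suc i))" for i
  proof -
    have "cred\<^sup>+\<^sup>+ (v (Suc i)) (w (Suc i)) \<or> v (Suc i) = w (Suc i)"
      using step[of "Suc i"] mem[of "Suc i"] by blast
    then have "cred\<^sup>*\<^sup>* (v (Suc i)) (w (Suc i))"
      by (elim disjE) (simp_all add: tranclp_into_rtranclp)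
    moreover have "cred\<^sup>*\<^sup>* (w i) (v (Suc i))" using step[of i] by (elim conjE)
    ultimately show ?thesis by (rule rtranclp_trans[rotated])
  qed
  \<comment> \<open>The start has to be a DP from \<open>P\<^sub>1\<close>: only there is the
    projection known to have base type and so to lie in \<open>C\<close>.\<close>
  obtain n where n: "fst (c n) \<in> P\<^sub>1" using inf by blast
  then have "SN cred (w n)" using step C_SN by blast
  then show False
  proof (rule SN_no_descending[where a = "\<lambda>k. w (n + k)"])
    show "cred\<^sup>*\<^sup>* (w n) (w (n + 0))" by simp
    show "cred\<^sup>*\<^sup>* (w (n + k)) (w (n + Suc k))" for k using next_step[of "n + k"] by simp
    show "\<exists>k \<ge> m. cred\<^sup>+\<^sup>+ (w (n + k)) (w (n + Suc k))" for m
    proof -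
      \<comment> \<open>The strict decrease at DP \<open>j\<close> shows in the step from
        \<open>w (j - 1)\<close> to \<open>w j\<close>, hence the bound with
        \<open>Suc\<close>.\<close>
      obtain j where j: "j \<ge> Suc (n + m)" "fst (c j) \<in> P\<^sub>1" using inf by blast
      define k where "k = j - Suc n"
      have k: "j = Suc (n + k)" "k \<ge> m" using j(1) by (auto simp: k_def)
      have "cred\<^sup>*\<^sup>* (w (n + k)) (v j)" using step[of "n + k"] k(1) by simp
      moreover have "cred\<^sup>+\<^sup>+ (v j) (w j)" using step[of j] j(2) by blast
      ultimately have "cred\<^sup>+\<^sup>+ (w (n + k)) (w (n + Suc k))" using k(1) by simp
      then show ?thesis using k(2) by blast
    qed
  qed
qed

end

context afsm
begin

text \<open>Serves both directions: soundness shrinks the set of DPs for a tail, completeness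
  enlarges it.\<close>

lemma inf_chain_mono:
  assumes "inf_chain P R c \<gamma>" "\<And>i. fst (c i) \<in> Q"
  shows "inf_chain Q R c \<gamma>"
proof -
  have "d \<in> Q" if "c i = (d, s, t)" for i d s t using assms(2)[of i] that by simp
  then show ?thesis using assms(1) unfolding inf_chain_def by meson
qed

lemma chain_tail:
  "inf_chain P R c \<gamma> \<Longrightarrow> inf_chain P R (\<lambda>i. c (n + i)) (\<lambda>i. \<gamma> (n + i))"
  "computable_chain U R c \<gamma> \<Longrightarrow> computable_chain U R (\<lambda>i. c (n + i)) (\<lambda>i. \<gamma> (n + i))"
  "formative_chain R c \<gamma> \<Longrightarrow> formative_chain R (\<lambda>i. c (n + i)) (\<lambda>i. \<gamma> (n + i))"
  unfolding inf_chain_def computable_chain_def formative_chain_def add_Suc_right by blast+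

lemma statcrit_finite:
  assumes geq: "reflp geq" "transp geq" "wfp (\<lambda>\<kappa> \<iota>. gt \<iota> \<kappa>)"
    and M: "is_problem M" and step: "statcrit_step M N" and N: "finite_problem N"
  shows "finite_problem M"
proof -
  obtain P\<^sub>1 P\<^sub>2 R U f \<nu> where M_def: "M = (P\<^sub>1 \<union> P\<^sub>2, R, Computable U, f)"
    and N_def: "N = (P\<^sub>2, R, Computable U, f)" and \<nu>: "projection (P\<^sub>1 \<union> P\<^sub>2) \<nu>"
    "\<forall>(l, p, A) \<in> P\<^sub>1. proj \<nu> l \<sqsupset> proj \<nu> p" "\<forall>(l, p, A) \<in> P\<^sub>2. proj \<nu> l = proj \<nu> p"
    using step unfolding statcrit_step_def by blast
  have "\<forall>\<rho> \<in> U. is_rule \<rho>" and dp: "\<And>d. d \<in> P\<^sub>1 \<union> P\<^sub>2 \<Longrightarrow> is_dp d"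
    using M unfolding M_def is_problem_def by auto
  \<comment> \<open>Computability is relative to the rules \<open>U\<close> of the flag; reduction
    by \<open>R\<close> is included in that by \<open>U\<close> for a computable chain.\<close>
  then interpret ordered_rule_system fty geq U
    using geq by unfold_locales auto
  have "\<not> (inf_chain (P\<^sub>1 \<union> P\<^sub>2) R c \<gamma> \<and> computable_chain U R c \<gamma> \<and>
      (f = Formative \<longrightarrow> formative_chain R c \<gamma>))" for c \<gamma>
  proof
    assume chain: "inf_chain (P\<^sub>1 \<union> P\<^sub>2) R c \<gamma> \<and> computable_chain U R c \<gamma> \<and>
      (f = Formative \<longrightarrow> formative_chain R c \<gamma>)"
    then obtain n where n: "\<And>i. i \<ge> n \<Longrightarrow> fst (c i) \<in> P\<^sub>2"
      using eventually_equal_projections[OF _ _ dp \<nu>] by blast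
    let ?c = "\<lambda>i. c (n + i)" and ?\<gamma> = "\<lambda>i. \<gamma> (n + i)"
    have "inf_chain P\<^sub>2 R ?c ?\<gamma>"
      using chain n by (intro inf_chain_mono[OF chain_tail(1)]) auto
    moreover have "computable_chain U R ?c ?\<gamma>" "f = Formative \<longrightarrow> formative_chain R ?c ?\<gamma>"
      using chain chain_tail(2,3) by blast+
    ultimately show False using N unfolding N_def finite_problem_def by auto
  qed
  then show ?thesis unfolding M_def finite_problem_def by auto
qed

lemma statcrit_infinite:
  assumes "statcrit_step M N" "infinite_problem N"
  shows "infinite_problem M"
proof -
  obtain P\<^sub>1 P\<^sub>2 R U f where M: "M = (P\<^sub>1 \<union> P\<^sub>2, R, Computable U, f)" and N: "N = (P\<^sub>2, R, Computable U, f)"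
    using assms(1) unfolding statcrit_step_def by blast
  have "inf_chain (P\<^sub>1 \<union> P\<^sub>2) R c \<gamma>" if chain: "inf_chain P\<^sub>2 R c \<gamma>" for c \<gamma>
  proof (rule inf_chain_mono[OF chain])
    show "fst (c i) \<in> P\<^sub>1 \<union> P\<^sub>2" for i
      using inf_chain_fst[OF chain] by blast
  qed
  then show ?thesis using assms(2) unfolding M N infinite_problem_def prod.case by meson
qed

end

theorem theorem63:
  fixes fty :: "'f \<Rightarrow> 's ty"
    and geq :: "'s \<Rightarrow> 's \<Rightarrow> bool"
    and Proc_statcrit :: "('f, 's) processor"
  assumes "reflp geq" and "transp geq" and "wfp (\<lambda>\<kappa> \<iota>. afsm.gt geq \<iota> \<kappa>)"
    and "afsm.is_statcrit fty geq Proc_statcrit"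
  shows "afsm.sound fty geq Proc_statcrit \<and> afsm.complete fty Proc_statcrit"
proof -
  interpret afsm fty geq .
  have Proc: "(\<exists>N. statcrit_step M N \<and> Proc_statcrit M = Some {N}) \<or> Proc_statcrit M = Some {M}"
    if "is_problem M" for M
    using assms(4) that unfolding is_statcrit_def by metis
  have "sound Proc_statcrit"
    unfolding sound_def using Proc statcrit_finite[OF assms(1-3)] by fastforce
  moreover have "complete Proc_statcrit"
    unfolding complete_def using Proc statcrit_infinite by fastforce
  ultimately show ?thesis by blast
qed

end
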